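(* Let $g\in H^1_{\rm ext}(\mathbb{R})$ be such that $g(t)\ge c-\kappa t^2$ for all $t\in\mathbb{R}$, for some $c\in\mathbb{R}$ and some $\kappa\in[0,3/4)$. Let $\mathcal{A}$ be the Airy$_2$ process. Then $$\mathbb{P}\left(\mathcal{A}(t)\le g(t)+t^2\ \ \forall\,t\in\mathbb{R}\right)=\det\left(I-K_{\rm Ai}+A\bar P_0\mathcal{S}^g\bar P_0A^*\right),$$ where the Fredholm determinant is computed on $L^2(\mathbb{R})$ and $\mathcal{S}^g$ is the Brownian scattering operator associated to $g$.
   Context: **Airy objects.** $K_{\rm Ai}$ is the integral operator on $L^2(\mathbb{R})$ with kernel $K_{\rm Ai}(x,y)=\int_{-\infty}^0\mathrm{Ai}(x-\lambda)\mathrm{Ai}(y-\lambda)\,d\lambda$. The Airy transform $A$ is the operator on $L^2(\mathbb{R})$ with kernel $A(x,\lambda)=\mathrm{Ai}(x-\lambda)$, and $A^*$ is its adjoint, $A^*(\lambda,x)=\mathrm{Ai}(x-\lambda)$; $AA^*=I$. $\bar P_mf(x)=f(x)\mathbf{1}_{x\le m}$. $H=-\Delta+x$ is the Airy Hamiltonian and $e^{sH}K_{\rm Ai}$ has kernel $\int_{-\infty}^0e^{\lambda s}\mathrm{Ai}(x-\lambda)\mathrm{Ai}(y-\lambda)\,d\lambda$ for $s\in\mathbb{R}$. The Airy$_2$ process $\mathcal{A}$ is the stationary process with continuous paths and finite-dimensional distributions, for $t_1<\dots<t_n$, $$\mathbb{P}(\mathcal{A}(t_1)\le x_1,\dots,\mathcal{A}(t_n)\le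 x_n)=\det\left(I-K_{\rm Ai}+\bar P_{x_1}e^{(t_1-t_2)H}\bar P_{x_2}e^{(t_2-t_3)H}\cdots\bar P_{x_n}e^{(t_n-t_1)H}K_{\rm Ai}\right)_{L^2(\mathbb{R})}.$$ **The class $H^1_{\rm ext}(\mathbb{R})$.** Functions $g:\mathbb{R}\to\mathbb{R}\cup\{\infty\}$ for which there is a finite or infinite collection of intervals $[a,b]$ with $a\le b$ such that $g\in H^1([a,b])$ for each of them (i.e. $g$ is differentiable in $[a,b]$ and both it and its derivative are in $L^2([a,b])$) and $g(x)=\infty$ for $x$ outside the collection of intervals. **Hitting times.** For $f:[0,\infty)\to\mathbb{R}\cup\{\infty\}$, $\tau_f=\inf\{t\ge0:B(t)\ge f(t)\}$ (possibly $\infty$), where under $\mathbb{P}_y$, $B$ is a Brownian motion with diffusion coefficient $2$ (transition density $p(t,x)=(4\pi t)^{-1/2}e^{-x^2/4t}$) started at $y$. **Brownian scattering operator.** For $g$ as in the statement let $g^+(t)=g(t)$, $g^-(t)=g(-t)$ for $t\ge0$, and for $f\in\{g^+,g^-\}$ define the kernel $$\Psi^f(\lambda,y)=\mathrm{Ai}(y-\lambda)-\int_0^\infty\mathbb{P}_y(\tau_f\in dt)\,e^{-2t^3/3-(f(t)-\lambda)t}\,\mathrm{Ai}(f(t)-\lambda+t^2).$$ Then $\mathcal{S}^g=\Psi^{g^-}\bar P_{g(0)}(\Psi^{g^+})^*$, i.e. the operator with kernel $$\mathcal{S}^g(\lambda_1,\lambda_2)=\int_{(-\infty,g(0))}\Psi^{g^-}(\lambda_1,y)\Psi^{g^+}(\lambda_2,y)\,dy$$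 (in general a generalized kernel: the composition is understood as a composition of operators). If $g$ is not continuous at $0$, then $g(0)$ in the formula for $\mathcal{S}^g$ is interpreted as $\min\{g(0),g(0-),g(0+)\}$.
   Formalization: In the kernel Ψ^f the level f(t) at the hitting time is replaced by the Brownian position B(τ_f); they agree when the path meets f from below, but the printed formula fails when f jumps down onto the path, e.g. g finite at a single time t₁>0. *)

theory Defs
  imports "HOL-Probability.Probability" "Jordan_Normal_Form.Determinant"
begin

section \<open>Fredholm determinants on the real line\<close>

text \<open>\<open>has_fredholm_det T d\<close> says that \<open>det (I + T) = d\<close> on \<open>L\<^sup>2(\<real>)\<close> for the operator with integral
  kernel \<open>T\<close>: the Fredholm expansion
  \<open>\<Sum>n. 1/n! \<integral> det [T(x\<^sub>i, x\<^sub>j)]\<^sub>i\<^sub>,\<^sub>j\<^sub><\<^sub>n dx\<^sub>0 \<dots> dx\<^sub>n\<^sub>-\<^sub>1\<close> is well defined and has the value \<open>d\<close>.\<close>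

definition fredholm_minor :: "(real \<Rightarrow> real \<Rightarrow> real) \<Rightarrow> nat \<Rightarrow> (nat \<Rightarrow> real) \<Rightarrow> real" where
  "fredholm_minor T n x = Determinant.det (Matrix.mat n n (\<lambda>(i, j). T (x i) (x j)))"

definition has_fredholm_det :: "(real \<Rightarrow> real \<Rightarrow> real) \<Rightarrow> real \<Rightarrow> bool" where
  "has_fredholm_det T d \<longleftrightarrow>
     (\<forall>n. integrable (Pi\<^sub>M {..<n} (\<lambda>_. lborel)) (fredholm_minor T n)) \<and>
     (\<lambda>n. integral\<^sup>L (Pi\<^sub>M {..<n} (\<lambda>_. lborel)) (fredholm_minor T n) / fact n) sums d"


section \<open>Airy objects\<close>

text \<open>The integral over \<open>[0, \<infinity>)\<close> converges only conditionally.\<close>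

definition Ai :: "real \<Rightarrow> real" where
  "Ai x = Lim at_top (\<lambda>R. (1 / pi) * (LBINT t:{0..R}. cos (t ^ 3 / 3 + x * t)))"

definition K_Ai :: "real \<Rightarrow> real \<Rightarrow> real" where
  "K_Ai x y = (LBINT l:{..0}. Ai (x - l) * Ai (y - l))"

text \<open>The Airy Hamiltonian \<open>H = -\<Delta> + x\<close> has the generalized eigenfunctions \<open>Ai (x - l)\<close>, with eigenvalue
  \<open>l\<close>, and is diagonalized by the Airy transform. Hence \<open>e\<^sup>s\<^sup>H\<close> has the kernel \<open>exp_H s\<close>; the integral
  converges for \<open>s < 0\<close>, which is the only case used. \<open>exp_H_K s\<close> is the kernel of \<open>e\<^sup>s\<^sup>H K\<close>, for
  every real \<open>s\<close>.\<close>

definition exp_H :: "real \<Rightarrow> real \<Rightarrow> real \<Rightarrow> real" where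
  "exp_H s x y = (LBINT l. exp (l * s) * Ai (x - l) * Ai (y - l))"

definition exp_H_K :: "real \<Rightarrow> real \<Rightarrow> real \<Rightarrow> real" where
  "exp_H_K s x y = (LBINT l:{..0}. exp (l * s) * Ai (x - l) * Ai (y - l))"

text \<open>For \<open>ps = [(t\<^sub>1, x\<^sub>1), \<dots>, (t\<^sub>n, x\<^sub>n)]\<close>, \<open>airy_chain t\<^sub>1 ps\<close> is the kernel of the product
  \<open>P\<^bsub>x\<^sub>1\<^esub> exp((t\<^sub>1 - t\<^sub>2)H) P\<^bsub>x\<^sub>2\<^esub> \<dots> P\<^bsub>x\<^sub>n\<^esub> exp((t\<^sub>n - t\<^sub>1)H) K\<close>,
  where \<open>P\<^sub>m\<close> is multiplication by the indicator function of \<open>(-\<infinity>, m]\<close>.\<close>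

fun airy_chain :: "real \<Rightarrow> (real \<times> real) list \<Rightarrow> real \<Rightarrow> real \<Rightarrow> real" where
  "airy_chain t0 [] u v = K_Ai u v"
| "airy_chain t0 [(t, x)] u v = indicator {..x} u * exp_H_K (t - t0) u v"
| "airy_chain t0 ((t, x) # (t', x') # ps) u v =
     indicator {..x} u * (LBINT w. exp_H (t - t') u w * airy_chain t0 ((t', x') # ps) w v)"

definition airy2_process :: "'a measure \<Rightarrow> (real \<Rightarrow> 'a \<Rightarrow> real) \<Rightarrow> bool" where
  "airy2_process M X \<longleftrightarrow>
     prob_space M \<and>
     (\<forall>t. X t \<in> borel_measurable M) \<and>
     (\<forall>\<omega>\<in>space M. continuous_on UNIV (\<lambda>t. X t \<omega>)) \<and>
     (\<forall>h. distr M (Pi\<^sub>M UNIV (\<lambda>_. borel)) (\<lambda>\<omega> t. X (t + h) \<omega>) =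
          distr M (Pi\<^sub>M UNIV (\<lambda>_. borel)) (\<lambda>\<omega> t. X t \<omega>)) \<and>
     (\<forall>ts xs. ts \<noteq> [] \<and> length xs = length ts \<and> sorted_wrt (<) ts \<longrightarrow>
        has_fredholm_det
          (\<lambda>u v. - K_Ai u v + airy_chain (hd ts) (zip ts xs) u v)
          (measure M {\<omega> \<in> space M. \<forall>i<length ts. X (ts ! i) \<omega> \<le> xs ! i}))"


section \<open>The class of barriers\<close>

text \<open>Barriers take values in \<open>\<real> \<union> {\<infinity>}\<close>, represented in \<^typ>\<open>ereal\<close>.\<close>

definition H1_on :: "real \<Rightarrow> real \<Rightarrow> (real \<Rightarrow> ereal) \<Rightarrow> bool" where
  "H1_on a b g \<longleftrightarrow>
     (\<forall>x\<in>{a..b}. \<bar>g x\<bar> \<noteq> \<infinity>) \<and>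
     (\<exists>d. (\<forall>x\<in>{a..b}. ((\<lambda>x. real_of_ereal (g x)) has_real_derivative d x) (at x within {a..b})) \<and>
          set_integrable lborel {a..b} (\<lambda>x. (real_of_ereal (g x))\<^sup>2) \<and>
          set_integrable lborel {a..b} (\<lambda>x. (d x)\<^sup>2))"

definition H1_ext :: "(real \<Rightarrow> ereal) set" where
  "H1_ext = {g. \<exists>I :: (real \<times> real) set.
      (\<forall>(a, b)\<in>I. a \<le> b \<and> H1_on a b g) \<and>
      (\<forall>x. x \<notin> (\<Union>(a, b)\<in>I. {a..b}) \<longrightarrow> g x = \<infinity>)}"


section \<open>Brownian motion and hitting times\<close>

text \<open>Brownian motion with diffusion coefficient 2, i.e. with variance \<open>2 t\<close> at time \<open>t\<close>, started at 0.
  The process \<open>y + W\<close> realizes the law \<open>P\<^sub>y\<close>.\<close>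

definition brownian_motion :: "'b measure \<Rightarrow> (real \<Rightarrow> 'b \<Rightarrow> real) \<Rightarrow> bool" where
  "brownian_motion N W \<longleftrightarrow>
     prob_space N \<and>
     (\<forall>t\<ge>0. W t \<in> borel_measurable N) \<and>
     (\<forall>\<omega>\<in>space N. W 0 \<omega> = 0 \<and> continuous_on {0..} (\<lambda>t. W t \<omega>)) \<and>
     (\<forall>s t. 0 \<le> s \<and> s < t \<longrightarrow>
        distributed N lborel (\<lambda>\<omega>. W t \<omega> - W s \<omega>) (normal_density 0 (sqrt (2 * (t - s))))) \<and>
     (\<forall>(n::nat) t. 0 \<le> t 0 \<and> (\<forall>i<n. t i \<le> t (Suc i)) \<longrightarrow>
        prob_space.indep_vars N (\<lambda>_. borel) (\<lambda>i \<omega>. W (t (Suc i)) \<omega> - W (t i) \<omega>) {..<n})"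

definition hitting_time :: "(real \<Rightarrow> ereal) \<Rightarrow> (real \<Rightarrow> real) \<Rightarrow> ereal" where
  "hitting_time f b = Inf {ereal t |t. 0 \<le> t \<and> ereal (b t) \<ge> f t}"

text \<open>A path that starts below a continuous barrier is on the barrier at the hitting time.\<close>

lemma hitting_time_on_barrier:
  fixes f :: "real \<Rightarrow> ereal" and b :: "real \<Rightarrow> real"
  assumes f: "continuous_on {0..} f" and b: "continuous_on {0..} b"
    and start: "ereal (b 0) < f 0" and hit: "hitting_time f b = ereal s"
  shows "f s = ereal (b s)"
proof -
  define S where "S = {t. 0 \<le> t \<and> ereal (b t) \<ge> f t}"
  have Inf: "Inf (ereal ` S) = ereal s"
    using hit by (simp add: hitting_time_def S_def image_Collect)
  have lower: "s \<le> t" if "t \<in> S" for t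
    using Inf_lower[of "ereal t" "ereal ` S"] that Inf by simp
  have approx: "\<exists>t\<in>S. t < r" if "s < r" for r
  proof -
    have "Inf (ereal ` S) < ereal r" using that Inf by simp
    then show ?thesis unfolding Inf_less_iff by auto
  qed
  have s0: "0 \<le> s"
  proof -
    have "ereal 0 \<le> Inf (ereal ` S)" by (rule Inf_greatest) (auto simp: S_def)
    then show ?thesis using Inf by simp
  qed
  have tf: "(f \<longlongrightarrow> f s) (at s within {0..})"
    using f s0 by (simp add: continuous_on_def)
  have tb: "((\<lambda>t. ereal (b t)) \<longlongrightarrow> ereal (b s)) (at s within {0..})"
    using b s0 by (simp add: continuous_on_def)
  show ?thesis
  proof (rule antisym)
    show "f s \<le> ereal (b s)"
    proof (rule ccontr)
      assume "\<not> f s \<le> ereal (b s)"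
      then obtain m where m: "ereal (b s) < m" "m < f s" using dense[of "ereal (b s)" "f s"] unfolding not_le by blast
      have "eventually (\<lambda>t. ereal (b t) < f t) (at s within {0..})"
        using order_tendstoD(1)[OF tf m(2)] order_tendstoD(2)[OF tb m(1)]
        by eventually_elim (rule less_trans)
      then obtain d where d: "d > 0" "\<And>t. 0 \<le> t \<Longrightarrow> t \<noteq> s \<Longrightarrow> dist t s < d \<Longrightarrow> ereal (b t) < f t"
        unfolding eventually_at by auto
      obtain t where t: "t \<in> S" "t < s + d" using approx[of "s + d"] d(1) by auto
      then have "t = s"
        using d(2)[of t] lower[of t] by (force simp: S_def dist_real_def)
      then show False using t(1) m by (auto simp: S_def)
    qed
    show "ereal (b s) \<le> f s"
    proof (rule ccontr)
      assume *: "\<not> ereal (b s) \<le> f s"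
      then obtain m where m: "f s < m" "m < ereal (b s)" using dense[of "f s" "ereal (b s)"] unfolding not_le by blast
      have "eventually (\<lambda>t. f t < ereal (b t)) (at s within {0..})"
        using order_tendstoD(2)[OF tf m(1)] order_tendstoD(1)[OF tb m(2)]
        by eventually_elim (rule less_trans)
      then obtain d where d: "d > 0" "\<And>t. 0 \<le> t \<Longrightarrow> t \<noteq> s \<Longrightarrow> dist t s < d \<Longrightarrow> f t < ereal (b t)"
        unfolding eventually_at by auto
      have "s \<noteq> 0" using start * by auto
      define t where "t = max 0 (s - d / 2)"
      have "0 \<le> t" "t < s" "dist t s < d"
        using s0 \<open>s \<noteq> 0\<close> d(1) by (auto simp: t_def dist_real_def max_def)
      then have "t \<in> S" using d(2)[of t] by (auto simp: S_def less_imp_le)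
      then show False using lower[of t] \<open>t < s\<close> by simp
    qed
  qed
qed


section \<open>The Brownian scattering operator\<close>

text \<open>The integral of the law \<open>P\<^sub>y(\<tau> \<in> dt)\<close> is written as an expectation, with the level \<open>B(\<tau>)\<close> at which the path
  meets the barrier in the place of \<open>f(\<tau>)\<close>. The two agree when \<open>f\<close> is continuous, by
  \<open>hitting_time_on_barrier\<close>. They differ when \<open>f\<close> drops onto a path that is already above it, for instance at the left
  end of an interval on which \<open>f\<close> is finite; the integrand has to be evaluated at the position of the path
  there, since it is \<open>(t, b) \<mapsto> exp (- 2 t\<^sup>3 / 3 - (b - l) t) Ai (b - l + t\<^sup>2)\<close> that solves the
  backward heat equation and gives a martingale along \<open>B\<close>.
  The completion makes the hitting time measurable for barriers that are not semicontinuous.\<close>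

definition scattering_Psi ::
  "'b measure \<Rightarrow> (real \<Rightarrow> 'b \<Rightarrow> real) \<Rightarrow> (real \<Rightarrow> ereal) \<Rightarrow> real \<Rightarrow> real \<Rightarrow> real" where
  "scattering_Psi N W f l y = Ai (y - l) -
     (LINT \<omega>|completion N.
        (let B = (\<lambda>t. y + W t \<omega>); \<tau> = hitting_time f B; t = real_of_ereal \<tau> in
          if \<tau> < \<infinity> then exp (- 2 * t ^ 3 / 3 - (B t - l) * t) * Ai (B t - l + t\<^sup>2) else 0))"

text \<open>The value \<open>min {g(0), g(0-), g(0+)}\<close>, which is \<open>g 0\<close> if \<open>g\<close> is continuous at 0. Lower limits are used
  because a general \<open>g\<close> need not have one-sided limits.\<close>

definition barrier_at_0 :: "(real \<Rightarrow> ereal) \<Rightarrow> ereal" where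
  "barrier_at_0 g = min (g 0) (min (Liminf (at_left 0) g) (Liminf (at_right 0) g))"

text \<open>The kernel of the Brownian scattering operator is a generalized one, so the operator is given by its bilinear form
  \<open>\<langle>\<phi>, S \<psi>\<rangle> = \<langle>(\<Psi>\<^sup>-)\<^sup>* \<phi>, P (\<Psi>\<^sup>+)\<^sup>* \<psi>\<rangle>\<close>, where \<open>P\<close> restricts to \<open>y < g(0)\<close> and \<open>\<Psi>\<^sup>-\<close>, \<open>\<Psi>\<^sup>+\<close> belong to
  \<open>g(-t)\<close>, \<open>g(t)\<close>. For kernels \<open>a\<close>, \<open>b\<close> the composition \<open>a S b\<close> then
  has the kernel \<open>(x, z) \<mapsto> \<langle>a(x, \<cdot>), S b(\<cdot>, z)\<rangle>\<close>.\<close>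

definition brownian_scattering ::
  "'b measure \<Rightarrow> (real \<Rightarrow> 'b \<Rightarrow> real) \<Rightarrow> (real \<Rightarrow> ereal) \<Rightarrow>
    (real \<Rightarrow> real) \<Rightarrow> (real \<Rightarrow> real) \<Rightarrow> real" where
  "brownian_scattering N W g \<phi> \<psi> =
     (LBINT y:{y. ereal y < barrier_at_0 g}.
        (LBINT l. \<phi> l * scattering_Psi N W (\<lambda>t. g (- t)) l y) *
        (LBINT l. scattering_Psi N W g l y * \<psi> l))"

text \<open>The kernel of \<open>A P\<^sub>0 S P\<^sub>0 A\<^sup>*\<close>.\<close>

definition airy_scattering ::
  "'b measure \<Rightarrow> (real \<Rightarrow> 'b \<Rightarrow> real) \<Rightarrow> (real \<Rightarrow> ereal) \<Rightarrow> real \<Rightarrow> real \<Rightarrow> real" where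
  "airy_scattering N W g x z =
     brownian_scattering N W g
       (\<lambda>l. Ai (x - l) * indicator {..0} l) (\<lambda>l. indicator {..0} l * Ai (z - l))"

end

theory Submission
  imports Defs "HOL-Complex_Analysis.Complex_Analysis"
begin

text \<open>In parabolic coordinates \<open>x = b + t\<^sup>2\<close> the kernel of \<open>exp ((t - t')H)\<close> becomes a heat kernel, and
  \<open>airy_heat t (b - l)\<close> solves the backward heat equation. For a barrier given at finitely many times,
  cyclicity of the Fredholm determinant moves the Airy factors together. What remains is a kernel on \<open>(-\<infinity>, 0)\<close>,
  in which the chain of heat kernels and cut-offs telescopes from time 0 in both directions into the expectations of
  \<open>airy_heat\<close> at the first passage of a Brownian path. For a general barrier \<open>g\<close>, countably
  many times suffice: choose them such that \<open>g\<close> is approximated from above by its values at nearby chosen times. Then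
  both the event for the Airy process and, for all but countably many starting points, the hitting time are limits along
  finite sets of times, and dominated convergence (Hadamard's inequality for the determinants) passes to the limit. The
  assumption \<open>\<kappa> < 3 / 4\<close> makes the expectations decay uniformly in the set of times. Finally \<open>A\<close> is reinserted on
  both sides of the limit kernel by cyclicity once more.\<close>

section \<open>Gaussian integrals\<close>

text \<open>The determinant exists only as its Fredholm expansion, so the role of trace norms is
  played by pointwise bounds \<open>a x * b z\<close> with \<open>a * b\<close> integrable; all
  limits and cyclic exchanges are carried out under bounds of this kind. Two features follow from
  this. The spectral variable \<open>l\<close> is kept on the negative half-line, where the kernels
  have a factor \<open>exp_half\<close> in each variable: \<open>K_Ai\<close> projects onto this
  half-line, and the passage terms decay exponentially there. And the Airy part is never estimated
  alone: as the projection equals its own square, the operator differs from the identity only by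
  products which contain a passage factor. Such a factor decays exponentially in \<open>y\<close> in
  both directions, which an Airy function does not. The telescoping rests on two facts, that the
  heat flow carries \<open>airy_heat\<close> from one time to an earlier one and that the heat
  kernel is symmetric; together they hand one time after another from the forward expectation to the
  backward one. Kernels converge at every point rather than almost everywhere, since the minors
  involve the diagonal.\<close>

definition gauss :: "real \<Rightarrow> real \<Rightarrow> real" where
  "gauss s x = normal_density 0 (sqrt (2 * s)) x"

lemma gauss_eq: "s > 0 \<Longrightarrow> gauss s x = exp (- x\<^sup>2 / (4 * s)) / sqrt (4 * pi * s)"
  by (simp add: gauss_def normal_density_def field_simps)

lemma gauss_nonneg [simp]: "0 \<le> gauss s x"
  by (simp add: gauss_def)

lemma gauss_minus [simp]: "gauss s (- x) = gauss s x"
  by (simp add: gauss_def normal_density_def)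

lemma gauss_measurable [measurable]: "gauss s \<in> borel_measurable borel"
  unfolding gauss_def by measurable

lemma gauss_bochner:
  assumes "s > 0"
  shows integrable_gauss: "integrable lborel (gauss s)" and integral_gauss: "integral\<^sup>L lborel (gauss s) = 1"
  using assms by (auto simp: gauss_def[abs_def])

lemma exp_square_bochner:
  assumes "a > 0"
  shows integrable_exp_square: "integrable lborel (\<lambda>x. exp (- a * x\<^sup>2))"
    and integral_exp_square: "(LBINT x. exp (- a * x\<^sup>2)) = sqrt (pi / a)"
proof -
  have eq: "(\<lambda>x. exp (- a * x\<^sup>2)) = (\<lambda>x. sqrt (pi / a) * gauss (1 / (4 * a)) x)"
    using assms by (simp add: gauss_eq fun_eq_iff real_sqrt_divide)
  show "integrable lborel (\<lambda>x. exp (- a * x\<^sup>2))" "(LBINT x. exp (- a * x\<^sup>2)) = sqrt (pi / a)"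
    using assms gauss_bochner[of "1 / (4 * a)"] unfolding eq by auto
qed

lemma gauss_char:
  assumes "s > 0"
  shows "(CLBINT x. of_real (gauss s x) * exp (\<i> * of_real (k * x))) = exp (- of_real (s * k\<^sup>2))"
proof -
  define r where "r = sqrt (2 * s)"
  have r: "r > 0" "r\<^sup>2 = 2 * s" using assms by (auto simp: r_def)
  have "(CLBINT x. of_real (gauss s x) * exp (\<i> * of_real (k * x)))
      = r *\<^sub>R (CLBINT x. of_real (gauss s (0 + r * x)) * exp (\<i> * of_real (k * (0 + r * x))))"
    using lborel_integral_real_affine[of r "\<lambda>x. of_real (gauss s x) * exp (\<i> * of_real (k * x))" 0] r by simp
  also have "\<dots> = (CLBINT x. of_real (std_normal_density x) * exp (\<i> * of_real ((k * r) * x)))"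
  proof -
    have "r * gauss s (r * x) = std_normal_density x" for x
    proof -
      have "- (r * x)\<^sup>2 / (2 * r\<^sup>2) = - x\<^sup>2 / 2" using r(1) by (simp add: power_mult_distrib)
      moreover have "sqrt (2 * pi * r\<^sup>2) = sqrt (2 * pi) * r" using r(1) by (simp add: real_sqrt_mult)
      ultimately show ?thesis using r(1) unfolding gauss_def normal_density_def r_def[symmetric] by simp
    qed
    then have "r *\<^sub>R (of_real (gauss s (0 + r * x)) * exp (\<i> * of_real (k * (0 + r * x))))
       = complex_of_real (std_normal_density x) * exp (\<i> * of_real ((k * r) * x))" for x
      unfolding scaleR_conv_of_real add_0 by (metis (no_types) mult.assoc of_real_mult)
    then show ?thesis by (simp flip: integral_scaleR_right)
  qed
  also have "\<dots> = char std_normal_distribution (k * r)"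
    unfolding char_def
    by (subst integral_density) (auto simp: scaleR_conv_of_real mult_ac)
  also have "\<dots> = exp (- of_real (s * k\<^sup>2))"
  proof -
    have "exp (- complex_of_real (s * k\<^sup>2)) = of_real (exp (- (s * k\<^sup>2)))"
      by (simp add: exp_of_real flip: of_real_minus of_real_mult of_real_power)
    then show ?thesis by (simp add: char_std_normal_distribution power_mult_distrib r(2) mult_ac)
  qed
  finally show ?thesis .
qed

text \<open>Completing the square: the shift of \<open>x\<close> by \<open>- 2 * s * a\<close>
  removes the real part \<open>a\<close> of \<open>w\<close> and leaves the characteristic function
  at the imaginary part. A complex \<open>w\<close> is needed because the heat flow is later applied
  under a contour integral.\<close>

lemma gauss_mgf_complex:
  assumes "s > 0"
  shows "integrable lborel (\<lambda>x. of_real (gauss s x) * exp (- of_real x * w))" (is ?i)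
    and "(CLBINT x. of_real (gauss s x) * exp (- of_real x * w)) = exp (of_real s * w\<^sup>2)" (is ?e)
proof -
  obtain a k where w: "w = Complex a k" by (cases w)
  have sq: "gauss s (- 2 * s * a + x) * exp (- (- 2 * s * a + x) * a) = exp (s * a\<^sup>2) * gauss s x" for x
  proof -
    have "- (- 2 * s * a + x)\<^sup>2 / (4 * s) + - (- 2 * s * a + x) * a = s * a\<^sup>2 + - x\<^sup>2 / (4 * s)"
      using assms by (simp add: field_simps power2_eq_square)
    then have "exp (- (- 2 * s * a + x)\<^sup>2 / (4 * s)) * exp (- (- 2 * s * a + x) * a) = exp (s * a\<^sup>2) * exp (- x\<^sup>2 / (4 * s))"
      by (simp flip: exp_add)
    then show ?thesis using assms by (simp add: gauss_eq field_simps)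
  qed
  have ex: "exp (- of_real x * w) = of_real (exp (- x * a)) * exp (\<i> * of_real (- k * x))" for x
    unfolding w by (simp add: complex_eq_iff Re_exp Im_exp mult.commute)
  have shift: "of_real (gauss s (- 2 * s * a + x)) * exp (- of_real (- 2 * s * a + x) * w)
     = (of_real (exp (s * a\<^sup>2)) * exp (\<i> * of_real (2 * s * a * k))) * (of_real (gauss s x) * exp (\<i> * of_real (- k * x)))" for x
  proof -
    have "of_real (gauss s (- 2 * s * a + x)) * exp (- of_real (- 2 * s * a + x) * w)
       = of_real (gauss s (- 2 * s * a + x) * exp (- (- 2 * s * a + x) * a)) * exp (\<i> * of_real (- k * (- 2 * s * a + x)))"
      unfolding ex by simp
    also have "\<dots> = of_real (exp (s * a\<^sup>2) * gauss s x) * exp (\<i> * of_real (- k * (- 2 * s * a + x)))"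
      unfolding sq ..
    also have "exp (\<i> * of_real (- k * (- 2 * s * a + x))) = exp (\<i> * of_real (2 * s * a * k)) * exp (\<i> * of_real (- k * x))"
      by (simp add: algebra_simps flip: exp_add)
    finally show ?thesis by simp
  qed
  have i0: "integrable lborel (\<lambda>x. of_real (gauss s x) * exp (\<i> * of_real (- k * x)))"
    by (rule Bochner_Integration.integrable_bound[OF integrable_gauss[OF assms]]) (auto simp: norm_mult)
  have "integrable lborel (\<lambda>x. of_real (gauss s (- 2 * s * a + 1 * x)) * exp (- of_real (- 2 * s * a + 1 * x) * w))"
    using shift i0 by simp
  then show ?i by (subst (asm) lborel_integrable_real_affine_iff) auto
  have "(CLBINT x. of_real (gauss s x) * exp (- of_real x * w))
     = (CLBINT x. of_real (gauss s (- 2 * s * a + x)) * exp (- of_real (- 2 * s * a + x) * w))"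
    by (subst lborel_integral_real_affine[where c = 1 and t = "- 2 * s * a"]) auto
  also have "\<dots> = (of_real (exp (s * a\<^sup>2)) * exp (\<i> * of_real (2 * s * a * k))) * exp (- of_real (s * (- k)\<^sup>2))"
    unfolding shift by (subst integral_mult_right_zero, subst gauss_char[OF assms]) simp
  also have "\<dots> = exp (of_real s * w\<^sup>2)"
    unfolding w by (simp add: complex_eq_iff Re_exp Im_exp power2_eq_square algebra_simps flip: exp_add of_real_exp)
  finally show ?e .
qed

lemma gauss_mgf:
  assumes "s > 0"
  shows integrable_gauss_exp: "integrable lborel (\<lambda>x. gauss s x * exp (A * x))"
    and integral_gauss_exp: "(LBINT x. gauss s x * exp (A * x)) = exp (A\<^sup>2 * s)"
proof -
  have eq: "of_real (gauss s x) * exp (- of_real x * complex_of_real (- A)) = of_real (gauss s x * exp (A * x))" for x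
    by (simp add: exp_of_real mult_ac flip: of_real_mult)
  note m = gauss_mgf_complex[OF assms, of "of_real (- A)", unfolded eq]
  show "integrable lborel (\<lambda>x. gauss s x * exp (A * x))"
    using m(1) by (simp only: complex_of_real_integrable_eq)
  have "exp (complex_of_real s * (of_real (- A))\<^sup>2) = of_real (exp (A\<^sup>2 * s))"
    by (simp add: exp_of_real mult_ac flip: of_real_mult of_real_power)
  with m(2) show "(LBINT x. gauss s x * exp (A * x)) = exp (A\<^sup>2 * s)"
    by (metis (no_types) integral_complex_of_real of_real_eq_iff)
qed

section \<open>The Airy function\<close>

text \<open>The integrand of the contour representation of \<open>Ai\<close> on vertical lines. Its
  modulus is Gaussian in \<open>k\<close> when \<open>Re w > 0\<close>, and constantly 1 on the
  imaginary axis, where the defining integral of \<open>Ai\<close> lives.\<close>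

definition airy_exp :: "real \<Rightarrow> complex \<Rightarrow> complex" where
  "airy_exp x w = exp (w ^ 3 / 3 - of_real x * w)"

lemma norm_airy_exp: "norm (airy_exp x (Complex a k)) = exp (a ^ 3 / 3 - a * x) * exp (- a * k\<^sup>2)"
  by (simp add: airy_exp_def power3_eq_cube power2_eq_square field_simps flip: exp_add)

lemma airy_exp_measurable [measurable]:
  "(\<lambda>k. airy_exp x (Complex a k)) \<in> borel_measurable borel"
proof -
  have "continuous_on UNIV (\<lambda>k. airy_exp x (Complex a k))"
    unfolding airy_exp_def Complex_eq by (intro continuous_intros) auto
  then show ?thesis by (rule borel_measurable_continuous_onI)
qed

lemma integrable_airy_exp: "a > 0 \<Longrightarrow> integrable lborel (\<lambda>k. airy_exp x (Complex a k))"
  by (rule Bochner_Integration.integrable_bound[where f = "\<lambda>k. exp (a ^ 3 / 3 - a * x) * exp (- a * k\<^sup>2)"])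
     (auto simp: norm_airy_exp intro!: integrable_mult_right dest: integrable_exp_square)

text \<open>Cauchy's theorem on tall rectangles, in terms of a primitive \<open>P\<close> of the
  entire integrand: vertical sides are differences of \<open>P\<close>, horizontal sides at height
  \<open>R\<close> are of order \<open>1 / R^2\<close>. So the absolutely convergent integral over
  \<open>Re w = a\<close> equals the conditionally convergent one over the imaginary axis; in
  particular the limit that defines \<open>Ai\<close> exists.\<close>

lemma Ai_contour:
  assumes a: "a > 0"
  shows "complex_of_real (Ai x) = (CLBINT k. airy_exp x (Complex a k)) / (2 * pi)"
proof -
  define J where "J = (CLBINT k. airy_exp x (Complex a k))"
  have "airy_exp x holomorphic_on UNIV"
    unfolding airy_exp_def[abs_def] by (intro holomorphic_intros) auto
  then obtain P where P: "\<And>w. (P has_field_derivative airy_exp x w) (at w)"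
    using holomorphic_convex_primitive'[of UNIV "airy_exp x"] by auto
  have vert: "((\<lambda>k. P (Complex r k)) has_vector_derivative \<i> * airy_exp x (Complex r k)) (at k within S)" for r k S
  proof -
    have "((\<lambda>k. Complex r k) has_vector_derivative \<i>) (at k within S)"
      unfolding Complex_eq by (auto intro!: derivative_eq_intros)
    from field_vector_diff_chain_within[OF this, of P] show ?thesis
      using P by (auto simp: o_def intro: has_field_derivative_at_within)
  qed
  have horiz: "((\<lambda>r. P (Complex r k)) has_vector_derivative airy_exp x (Complex r k)) (at r within S)" for r k S
  proof -
    have "((\<lambda>r. Complex r k) has_vector_derivative 1) (at r within S)"
      unfolding Complex_eq by (auto intro!: derivative_eq_intros)
    from field_vector_diff_chain_within[OF this, of P] show ?thesis
      using P by (auto simp: o_def intro: has_field_derivative_at_within)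
  qed
  have cont: "continuous_on S (\<lambda>k. airy_exp x (Complex r k))" for r S
    unfolding airy_exp_def Complex_eq by (intro continuous_intros) auto
  have contour: "(CLBINT k. indicator {-R..R} k *\<^sub>R (\<i> * airy_exp x (Complex r k))) = P (Complex r R) - P (Complex r (-R))"
    if "R \<ge> 0" for r R
    by (rule integral_FTC_Icc) (use that vert cont in \<open>auto intro!: continuous_intros\<close>)
  have J_lim: "((\<lambda>R. P (Complex a R) - P (Complex a (-R))) \<longlongrightarrow> \<i> * J) at_top"
  proof -
    have "((\<lambda>R. CLBINT k. indicator {-R..R} k *\<^sub>R (\<i> * airy_exp x (Complex a k))) \<longlongrightarrow> (CLBINT k. \<i> * airy_exp x (Complex a k))) at_top"
    proof (rule integral_dominated_convergence_at_top)
      show "integrable lborel (\<lambda>k. norm (airy_exp x (Complex a k)))"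
        using integrable_airy_exp[OF a] by (rule integrable_norm)
      show "\<forall>\<^sub>F R in at_top. AE k in lborel. norm (indicator {-R..R} k *\<^sub>R (\<i> * airy_exp x (Complex a k))) \<le> norm (airy_exp x (Complex a k))"
        by (intro always_eventually allI AE_I2) (auto simp: norm_mult split: split_indicator)
      show "AE k in lborel. ((\<lambda>R. indicator {-R..R} k *\<^sub>R (\<i> * airy_exp x (Complex a k))) \<longlongrightarrow> \<i> * airy_exp x (Complex a k)) at_top"
      proof (intro AE_I2 tendsto_eventually)
        fix k :: real
        show "\<forall>\<^sub>F R in at_top. indicator {-R..R} k *\<^sub>R (\<i> * airy_exp x (Complex a k)) = \<i> * airy_exp x (Complex a k)"
          using eventually_ge_at_top[of "\<bar>k\<bar>"] by eventually_elim (auto split: split_indicator)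
      qed
    qed auto
    then have "((\<lambda>R. CLBINT k. indicator {-R..R} k *\<^sub>R (\<i> * airy_exp x (Complex a k))) \<longlongrightarrow> \<i> * J) at_top"
      by (simp add: J_def)
    then show ?thesis
      by (rule Lim_transform_eventually) (use contour in \<open>auto intro!: eventually_mono[OF eventually_ge_at_top[of 0]]\<close>)
  qed
  \<comment> \<open>The majorant \<open>?C * exp (- r * R\<^sup>2)\<close> has the primitive
    \<open>?\<phi>\<close> in \<open>r\<close>, whose increment is at most
    \<open>?C / R\<^sup>2\<close>.\<close>
  have edge: "norm (P (Complex a R) - P (Complex 0 R)) \<le> exp (a ^ 3 / 3 + a * \<bar>x\<bar>) / R\<^sup>2" if "R \<noteq> 0" for R
  proof -
    let ?C = "exp (a ^ 3 / 3 + a * \<bar>x\<bar>)"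
    let ?\<phi> = "\<lambda>r. - ?C * exp (- r * R\<^sup>2) / R\<^sup>2"
    have "norm (P (Complex a R) - P (Complex 0 R)) \<le> ?\<phi> a - ?\<phi> 0"
    proof (rule differentiable_bound_general[OF a])
      show "continuous_on {0..a} (\<lambda>r. P (Complex r R))"
        using horiz by (auto intro!: continuous_on_vector_derivative)
      show "((\<lambda>r. P (Complex r R)) has_vector_derivative airy_exp x (Complex r R)) (at r)" for r
        by (rule horiz)
      show "(?\<phi> has_vector_derivative ?C * exp (- r * R\<^sup>2)) (at r)" for r
        using that unfolding has_real_derivative_iff_has_vector_derivative[symmetric]
        by (auto intro!: derivative_eq_intros simp: field_simps power2_eq_square)
      show "continuous_on {0..a} ?\<phi>" by (intro continuous_intros) (use that in auto)
      fix r assume r: "0 < r" "r < a"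
      have "r ^ 3 / 3 - r * x \<le> a ^ 3 / 3 + a * \<bar>x\<bar>"
      proof -
        have "r ^ 3 \<le> a ^ 3" using r by (intro power_mono) auto
        moreover have "- r * x \<le> a * \<bar>x\<bar>"
        proof -
          have "- r * x \<le> r * \<bar>x\<bar>" using r by (simp add: mult_left_mono abs_if)
          also have "\<dots> \<le> a * \<bar>x\<bar>" using r by (simp add: mult_right_mono)
          finally show ?thesis .
        qed
        ultimately show ?thesis by simp
      qed
      then show "norm (airy_exp x (Complex r R)) \<le> ?C * exp (- r * R\<^sup>2)"
        unfolding norm_airy_exp by (intro mult_right_mono) auto
    qed
    also have "\<dots> \<le> ?C / R\<^sup>2" using that by (simp add: field_simps)
    finally show ?thesis .
  qed
  have edge_lim: "((\<lambda>R. P (Complex a (s * R)) - P (Complex 0 (s * R))) \<longlongrightarrow> 0) at_top" if "s = 1 \<or> s = -1" for s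
  proof (rule Lim_null_comparison)
    show "\<forall>\<^sub>F R in at_top. norm (P (Complex a (s * R)) - P (Complex 0 (s * R))) \<le> exp (a ^ 3 / 3 + a * \<bar>x\<bar>) / R\<^sup>2"
      using eventually_gt_at_top[of 0]
    proof eventually_elim
      case (elim R)
      then show ?case using edge[of "s * R"] that by auto
    qed
    show "((\<lambda>R. exp (a ^ 3 / 3 + a * \<bar>x\<bar>) / R\<^sup>2) \<longlongrightarrow> 0) at_top"
      by (intro tendsto_divide_0[OF tendsto_const] filterlim_at_top_imp_at_infinity filterlim_pow_at_top filterlim_ident) auto
  qed
  have imag_lim: "((\<lambda>R. P (Complex 0 R) - P (Complex 0 (-R))) \<longlongrightarrow> \<i> * J) at_top"
    using tendsto_add[OF tendsto_diff[OF J_lim edge_lim[of 1]] edge_lim[of "-1"]] by simp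
  \<comment> \<open>The real part of the integrand on the imaginary axis is even in
    \<open>k\<close>, so the integral over \<open>{0..R}\<close> is half of the one over
    \<open>{-R..R}\<close>.\<close>
  define c where "c = (\<lambda>k. cos (k ^ 3 / 3 + x * k))"
  have c: "c = (\<lambda>k. Re (airy_exp x (Complex 0 k)))"
  proof
    fix k
    have "Re (airy_exp x (Complex 0 k)) = cos (- (k ^ 3 / 3 + x * k))"
      by (auto simp add: airy_exp_def Re_exp power3_eq_cube algebra_simps intro!: arg_cong[where f = cos])
    then show "c k = Re (airy_exp x (Complex 0 k))" by (simp only: cos_minus c_def)
  qed
  have contc: "continuous_on S c" for S unfolding c_def by (intro continuous_intros) auto
  have Im_P: "((\<lambda>k. Im (P (Complex 0 k))) has_vector_derivative c k) (at k within S)" for k S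
    using bounded_linear.has_vector_derivative[OF bounded_linear_Im vert[of 0 k S]] by (simp add: c)
  have int_c: "(LBINT k. indicator {p..q} k *\<^sub>R c k) = Im (P (Complex 0 q)) - Im (P (Complex 0 p))" if "p \<le> q" for p q
    by (rule integral_FTC_Icc) (use that Im_P contc in auto)
  have refl: "(LBINT k. indicator {-R..0} k *\<^sub>R c k) = (LBINT k. indicator {0..R} k *\<^sub>R c k)" for R
  proof -
    have "c (- k) = c k" for k
      using cos_minus[of "k ^ 3 / 3 + x * k"] by (simp add: c_def)
    then show ?thesis
      by (subst lborel_integral_real_affine[where c = "-1" and t = 0])
         (auto intro!: Bochner_Integration.integral_cong split: split_indicator)
  qed
  have half: "(LBINT t:{0..R}. cos (t ^ 3 / 3 + x * t)) = Im (P (Complex 0 R) - P (Complex 0 (-R))) / 2" if "R \<ge> 0" for R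
    using int_c[of 0 R] int_c[of "-R" 0] refl[of R] that by (simp add: set_lebesgue_integral_def c_def)
  have "((\<lambda>R. (1 / pi) * (Im (P (Complex 0 R) - P (Complex 0 (-R))) / 2)) \<longlongrightarrow> (1 / pi) * (Im (\<i> * J) / 2)) at_top"
    by (intro tendsto_intros imag_lim) auto
  then have "((\<lambda>R. (1 / pi) * (LBINT t:{0..R}. cos (t ^ 3 / 3 + x * t))) \<longlongrightarrow> (1 / pi) * (Im (\<i> * J) / 2)) at_top"
    by (rule Lim_transform_eventually) (auto intro!: eventually_mono[OF eventually_ge_at_top[of 0]] simp: half)
  then have "Ai x = (1 / pi) * (Im (\<i> * J) / 2)"
    unfolding Ai_def by (intro tendsto_Lim) auto
  \<comment> \<open>Conjugation corresponds to \<open>k\<close> going to \<open>- k\<close>, so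
    \<open>J\<close> is real and is determined by the imaginary part of
    \<open>\<i> * J\<close>.\<close>
  moreover have "Im J = 0"
  proof -
    have cnj: "airy_exp x (cnj w) = cnj (airy_exp x w)" for w by (simp add: airy_exp_def exp_cnj)
    have "J = (CLBINT k. airy_exp x (Complex a (- k)))"
      unfolding J_def by (subst lborel_integral_real_affine[where c = "-1" and t = 0]) auto
    also have "\<dots> = (CLBINT k. cnj (airy_exp x (Complex a k)))"
      using cnj[of "Complex a k" for k] by (simp add: complex_cnj)
    also have "\<dots> = cnj J"
      unfolding J_def by (rule integral_bounded_linear'[OF bounded_linear_cnj bounded_linear_cnj]) simp
    finally show ?thesis by (simp add: complex_eq_iff)
  qed
  ultimately show ?thesis
    unfolding J_def[symmetric] by (simp add: complex_eq_iff)
qed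

text \<open>The triangle inequality on the contour \<open>Re w = a\<close>. The rate
  \<open>a\<close> stays free: a small one serves for negative \<open>x\<close>, a large one for
  positive \<open>x\<close>.\<close>

lemma abs_Ai_le:
  assumes a: "a > 0"
  shows "\<bar>Ai x\<bar> \<le> exp (a ^ 3 / 3 - a * x) / (2 * sqrt (pi * a))"
proof -
  have "\<bar>Ai x\<bar> = norm (CLBINT k. airy_exp x (Complex a k)) / (2 * pi)"
    using arg_cong[OF Ai_contour[OF a, of x], of norm] by (simp add: norm_divide)
  also have "\<dots> \<le> (LBINT k. norm (airy_exp x (Complex a k))) / (2 * pi)"
    by (intro divide_right_mono integral_norm_bound) auto
  also have "\<dots> = exp (a ^ 3 / 3 - a * x) * sqrt (pi / a) / (2 * pi)"
    unfolding norm_airy_exp using integral_exp_square[OF a] by simp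
  also have "\<dots> = exp (a ^ 3 / 3 - a * x) / (2 * sqrt (pi * a))"
  proof -
    have "sqrt (pi / a) = pi / sqrt (pi * a)"
      using a by (simp add: real_sqrt_divide real_sqrt_mult field_simps)
    then show ?thesis using a by (simp add: field_simps)
  qed
  finally show ?thesis .
qed

lemma continuous_Ai: "continuous_on UNIV Ai"
proof -
  have "continuous_on UNIV (\<lambda>x. (CLBINT k. airy_exp x (Complex 1 k)))"
  proof (rule continuous_at_imp_continuous_on, intro ballI, unfold isCont_def, rule tendsto_at_iff_sequentially[THEN iffD2], intro allI impI)
    fix x :: real and X :: "nat \<Rightarrow> real" assume X: "\<forall>i. X i \<in> UNIV - {x}" "X \<longlonglongrightarrow> x"
    obtain B where B: "\<And>i. \<bar>X i\<bar> \<le> B"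
      using convergent_imp_Bseq[of X] X(2) by (auto simp: convergent_def Bseq_def)
    show "((\<lambda>x. (CLBINT k. airy_exp x (Complex 1 k))) \<circ> X) \<longlonglongrightarrow> (CLBINT k. airy_exp x (Complex 1 k))"
      unfolding o_def
    proof (rule integral_dominated_convergence[where w = "\<lambda>k. exp (1 / 3 + B) * exp (- 1 * k\<^sup>2)"])
      show "integrable lborel (\<lambda>k. exp (1 / 3 + B) * exp (- 1 * k\<^sup>2))"
        by (intro integrable_mult_right integrable_exp_square) auto
      show "AE k in lborel. (\<lambda>i. airy_exp (X i) (Complex 1 k)) \<longlonglongrightarrow> airy_exp x (Complex 1 k)"
        unfolding airy_exp_def by (intro AE_I2 tendsto_intros X(2))
      show "AE k in lborel. norm (airy_exp (X i) (Complex 1 k)) \<le> exp (1 / 3 + B) * exp (- 1 * k\<^sup>2)" for i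
        using B[of i] by (auto simp: norm_airy_exp intro!: mult_right_mono)
    qed auto
  qed
  then have "continuous_on UNIV (\<lambda>x. Re ((CLBINT k. airy_exp x (Complex 1 k)) / (2 * pi)))"
    by (intro continuous_intros) auto
  moreover have "(\<lambda>x. Re ((CLBINT k. airy_exp x (Complex 1 k)) / (2 * pi))) = Ai"
    using Ai_contour[of 1] by (simp add: fun_eq_iff complex_eq_iff)
  ultimately show ?thesis by (simp only:)
qed

lemma Ai_measurable [measurable]: "Ai \<in> borel_measurable borel"
  by (rule borel_measurable_continuous_onI[OF continuous_Ai])

section \<open>Dominated integrals and exponential tails\<close>

lemma
  fixes f :: "'a \<Rightarrow> 'b::{banach, second_countable_topology}" and g :: "'a \<Rightarrow> real"
  assumes f: "f \<in> borel_measurable M" and g: "integrable M g" and bound: "\<And>x. norm (f x) \<le> g x"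
  shows integrable_dominated: "integrable M f"
    and norm_integral_dominated: "norm (integral\<^sup>L M f) \<le> integral\<^sup>L M g"
proof -
  show i: "integrable M f"
    by (rule Bochner_Integration.integrable_bound[OF g f]) (use bound in \<open>auto intro: order_trans[OF _ abs_ge_self]\<close>)
  show "norm (integral\<^sup>L M f) \<le> integral\<^sup>L M g"
    by (rule order_trans[OF integral_norm_bound integral_mono[OF integrable_norm[OF i] g]]) (rule bound)
qed

lemma integrable_pair_dominated:
  fixes f :: "'a \<Rightarrow> 'b \<Rightarrow> 'c::{banach, second_countable_topology}" and p :: "'a \<Rightarrow> real" and q :: "'b \<Rightarrow> real"
  assumes "pair_sigma_finite M1 M2"
    and f: "case_prod f \<in> borel_measurable (M1 \<Otimes>\<^sub>M M2)"
    and p: "integrable M1 p" and q: "integrable M2 q"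
    and bound: "\<And>x y. norm (f x y) \<le> p x * q y"
  shows "integrable (M1 \<Otimes>\<^sub>M M2) (case_prod f)"
proof -
  interpret pair_sigma_finite M1 M2 by fact
  have [measurable]: "p \<in> borel_measurable M1" "q \<in> borel_measurable M2" using p q by auto
  have "integrable (M1 \<Otimes>\<^sub>M M2) (\<lambda>(x, y). p x * q y)"
    by (rule Fubini_integrable) (use p q in \<open>auto simp: abs_mult\<close>)
  then show ?thesis
  proof (rule Bochner_Integration.integrable_bound)
    show "AE z in M1 \<Otimes>\<^sub>M M2. norm (case_prod f z) \<le> norm (case z of (x, y) \<Rightarrow> p x * q y)"
      using bound by (intro AE_I2) (auto simp: split_beta intro: order_trans[OF _ abs_ge_self])
  qed fact
qed

lemma Fubini_dominated:
  fixes f :: "'a \<Rightarrow> 'b \<Rightarrow> 'c::{banach, second_countable_topology}" and p :: "'a \<Rightarrow> real" and q :: "'b \<Rightarrow> real"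
  assumes "pair_sigma_finite M1 M2"
    and f: "case_prod f \<in> borel_measurable (M1 \<Otimes>\<^sub>M M2)"
    and p: "integrable M1 p" and q: "integrable M2 q"
    and bound: "\<And>x y. norm (f x y) \<le> p x * q y"
  shows "(\<integral>x. (\<integral>y. f x y \<partial>M2) \<partial>M1) = (\<integral>y. (\<integral>x. f x y \<partial>M1) \<partial>M2)"
  using pair_sigma_finite.Fubini_integral[OF assms(1) integrable_pair_dominated[OF assms]] by simp

lemmas lborel_pair_sigma_finite = lborel_pair.pair_sigma_finite_axioms

lemma integrable_exp_abs:
  assumes "c > 0"
  shows "integrable lborel (\<lambda>x::real. exp (- c * \<bar>x\<bar>))"
proof -
  have "integrable lborel (exponential_density c)"
  proof (rule integrableI_nonneg)
    interpret prob_space "density lborel (exponential_density c)"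
      using assms by (rule prob_space_exponential_density)
    have "emeasure (density lborel (exponential_density c)) UNIV = 1"
      using emeasure_space_1 by simp
    then show "(\<integral>\<^sup>+x. ennreal (exponential_density c x) \<partial>lborel) < \<infinity>"
      by (subst (asm) emeasure_density) auto
  qed (use assms in \<open>auto simp: exponential_density_nonneg\<close>)
  then have 1: "integrable lborel (\<lambda>x. exponential_density c x / c)" by simp
  then have "integrable lborel (\<lambda>x. exponential_density c (0 + (-1) * x) / c)"
    by (rule lborel_integrable_real_affine) simp
  from Bochner_Integration.integrable_add[OF 1 this] show ?thesis
    by (rule Bochner_Integration.integrable_bound) (use assms in \<open>auto simp: exponential_density_def\<close>)
qed

lemma integrable_exp_bound:
  fixes f :: "real \<Rightarrow> 'a::{banach, second_countable_topology}"
  assumes [measurable]: "f \<in> borel_measurable borel" and "0 < p" "0 < q"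
    and "\<And>x. x \<le> 0 \<Longrightarrow> norm (f x) \<le> C * exp (p * x)" and "\<And>x. 0 \<le> x \<Longrightarrow> norm (f x) \<le> D * exp (- q * x)"
  shows "integrable lborel f"
proof (rule Bochner_Integration.integrable_bound)
  show "integrable lborel (\<lambda>x. max \<bar>C\<bar> \<bar>D\<bar> * exp (- min p q * \<bar>x\<bar>))"
    by (intro integrable_mult_right integrable_exp_abs) (use assms in auto)
  show "AE x in lborel. norm (f x) \<le> norm (max \<bar>C\<bar> \<bar>D\<bar> * exp (- min p q * \<bar>x\<bar>))"
  proof (intro AE_I2)
    fix x :: real
    have "norm (f x) \<le> max \<bar>C\<bar> \<bar>D\<bar> * exp (- min p q * \<bar>x\<bar>)"
    proof (cases "x \<le> 0")
      case True
      have "norm (f x) \<le> C * exp (p * x)" by (rule assms) fact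
      also have "\<dots> \<le> max \<bar>C\<bar> \<bar>D\<bar> * exp (- min p q * \<bar>x\<bar>)"
        by (intro mult_mono) (use True in \<open>auto simp: min_def mult_right_mono_neg\<close>)
      finally show ?thesis .
    next
      case False
      then have "norm (f x) \<le> D * exp (- q * x)" by (intro assms) auto
      also have "\<dots> \<le> max \<bar>C\<bar> \<bar>D\<bar> * exp (- min p q * \<bar>x\<bar>)"
        by (intro mult_mono) (use False in \<open>auto simp: min_def mult_right_mono\<close>)
      finally show ?thesis .
    qed
    then show "norm (f x) \<le> norm (max \<bar>C\<bar> \<bar>D\<bar> * exp (- min p q * \<bar>x\<bar>))" by simp
  qed
qed simp

section \<open>Gaussian approximate identities\<close>

lemma gauss_rescale:
  fixes f :: "real \<Rightarrow> 'a::{banach, second_countable_topology}"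
  assumes "s > 0"
  shows "(LBINT x. gauss s x *\<^sub>R f x) = (LBINT x. std_normal_density x *\<^sub>R f (sqrt (2 * s) * x))"
proof -
  define r where "r = sqrt (2 * s)"
  have r: "r > 0" "r\<^sup>2 = 2 * s" using assms by (auto simp: r_def)
  have "r * gauss s (r * x) = std_normal_density x" for x
  proof -
    have "- (r * x)\<^sup>2 / (2 * r\<^sup>2) = - x\<^sup>2 / 2" using r(1) by (simp add: power_mult_distrib)
    moreover have "sqrt (2 * pi * r\<^sup>2) = sqrt (2 * pi) * r" using r(1) by (simp add: real_sqrt_mult)
    ultimately show ?thesis using r(1) unfolding gauss_def normal_density_def r_def[symmetric] by simp
  qed
  then show ?thesis
    by (subst lborel_integral_real_affine[where c = r and t = 0])
      (use r in \<open>auto simp: r_def[symmetric] simp flip: integral_scaleR_right\<close>)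
qed

text \<open>Rescaling to the standard normal density puts the shrinking width into the argument of
  \<open>f n\<close>, where dominated convergence applies. The functions may vary with
  \<open>n\<close> because the kernel \<open>smear\<close> has a factor that depends on its
  parameter.\<close>

lemma gauss_approximate_identity_seq:
  fixes f :: "nat \<Rightarrow> real \<Rightarrow> 'a::{banach, second_countable_topology}"
  assumes [measurable]: "\<And>n. f n \<in> borel_measurable borel" and bound: "\<And>n x. norm (f n x) \<le> B"
    and lim: "\<And>X. X \<longlonglongrightarrow> x \<Longrightarrow> (\<lambda>n. f n (X n)) \<longlonglongrightarrow> L"
    and e: "e \<longlonglongrightarrow> 0" "\<And>n. e n > (0::real)"
  shows "(\<lambda>n. LBINT v. gauss (e n) v *\<^sub>R f n (x + v)) \<longlonglongrightarrow> L"
proof -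
  have "(\<lambda>n. LBINT v. std_normal_density v *\<^sub>R f n (x + sqrt (2 * e n) * v)) \<longlonglongrightarrow> (LBINT v. std_normal_density v *\<^sub>R L)"
  proof (rule integral_dominated_convergence[where w = "\<lambda>v. std_normal_density v * B"])
    show "AE v in lborel. (\<lambda>n. std_normal_density v *\<^sub>R f n (x + sqrt (2 * e n) * v)) \<longlonglongrightarrow> std_normal_density v *\<^sub>R L"
    proof (intro AE_I2 tendsto_scaleR tendsto_const)
      fix v
      have "(\<lambda>n. x + sqrt (2 * e n) * v) \<longlonglongrightarrow> x + sqrt (2 * 0) * v" by (intro tendsto_intros e)
      then show "(\<lambda>n. f n (x + sqrt (2 * e n) * v)) \<longlonglongrightarrow> L"
        by (intro lim) simp
    qed
    show "AE v in lborel. norm (std_normal_density v *\<^sub>R f n (x + sqrt (2 * e n) * v)) \<le> std_normal_density v * B" for n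
      using bound by (auto intro!: mult_left_mono)
  qed auto
  then show ?thesis
    using e(2) by (simp add: gauss_rescale)
qed

lemma gauss_approximate_identity:
  fixes f :: "real \<Rightarrow> 'a::{banach, second_countable_topology}"
  assumes "f \<in> borel_measurable borel" and "\<And>x. norm (f x) \<le> B"
    and "isCont f x" and "e \<longlonglongrightarrow> 0" "\<And>n. e n > (0::real)"
  shows "(\<lambda>n. LBINT v. gauss (e n) v *\<^sub>R f (x + v)) \<longlonglongrightarrow> f x"
  using assms by (intro gauss_approximate_identity_seq) (auto intro: isCont_tendsto_compose)

lemma exp_square_char:
  assumes "e > 0"
  shows "(CLBINT m. of_real (exp (- e * m\<^sup>2)) * exp (\<i> * of_real (k * m))) = of_real (2 * pi * gauss e k)"
proof -
  have "exp (- e * m\<^sup>2) = sqrt (pi / e) * gauss (1 / (4 * e)) m" for m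
    using assms by (simp add: gauss_eq real_sqrt_divide)
  then have "(CLBINT m. of_real (exp (- e * m\<^sup>2)) * exp (\<i> * of_real (k * m)))
    = of_real (sqrt (pi / e)) * (CLBINT m. of_real (gauss (1 / (4 * e)) m) * exp (\<i> * of_real (k * m)))"
    by (simp add: mult.assoc)
  also have "\<dots> = of_real (sqrt (pi / e)) * exp (- of_real (1 / (4 * e) * k\<^sup>2))"
    using assms by (subst gauss_char) auto
  also have "\<dots> = of_real (sqrt (pi / e) * exp (- (1 / (4 * e) * k\<^sup>2)))"
    by (simp only: of_real_mult exp_of_real[symmetric] of_real_minus)
  also have "sqrt (pi / e) * exp (- (1 / (4 * e) * k\<^sup>2)) = 2 * pi * gauss e k"
  proof -
    have "sqrt (pi / e) = 2 * pi / sqrt (4 * pi * e)"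
      using assms by (simp add: real_sqrt_divide real_sqrt_mult field_simps)
    then show ?thesis using assms by (simp add: gauss_eq)
  qed
  finally show ?thesis .
qed

section \<open>The Laplace transform of a product of two Airy functions\<close>

definition airy_const :: "real \<Rightarrow> real" where
  "airy_const a = exp (a ^ 3 / 3) / (2 * sqrt (pi * a))"

lemma Ai_exp_bound: "a > 0 \<Longrightarrow> \<bar>Ai x\<bar> \<le> airy_const a * exp (- a * x)"
  using abs_Ai_le[of a x] by (simp add: airy_const_def diff_conv_add_uminus exp_add del: add_uminus_conv_diff)

lemma airy_const_pos: "a > 0 \<Longrightarrow> airy_const a > 0"
  by (simp add: airy_const_def)

text \<open>The rate \<open>a\<close> in both Airy bounds leads to the exponent
  \<open>(s - 2 * a) * m\<close>. It is integrable at minus infinity for \<open>a = s / 4\<close>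
  and at plus infinity for \<open>a = s\<close>.\<close>

lemma integrable_exp_Ai_Ai:
  assumes s: "s > 0"
  shows "integrable lborel (\<lambda>m. exp (s * m) * Ai (x + m) * Ai (y + m))"
proof (rule integrable_exp_bound)
  have *: "norm (exp (s * m) * Ai (x + m) * Ai (y + m)) \<le> (airy_const a)\<^sup>2 * exp (- a * (x + y)) * exp ((s - 2 * a) * m)"
    if "a > 0" for a m
  proof -
    have "norm (exp (s * m) * Ai (x + m) * Ai (y + m)) = exp (s * m) * (\<bar>Ai (x + m)\<bar> * \<bar>Ai (y + m)\<bar>)"
      by (simp add: abs_mult)
    also have "\<dots> \<le> exp (s * m) * ((airy_const a * exp (- a * (x + m))) * (airy_const a * exp (- a * (y + m))))"
      using that airy_const_pos[of a] by (intro mult_left_mono mult_mono Ai_exp_bound) auto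
    also have "\<dots> = (airy_const a)\<^sup>2 * exp (- a * (x + y)) * exp ((s - 2 * a) * m)"
      by (simp add: power2_eq_square algebra_simps flip: exp_add)
    finally show ?thesis .
  qed
  show "norm (exp (s * m) * Ai (x + m) * Ai (y + m)) \<le> (airy_const (s/4))\<^sup>2 * exp (- (s/4) * (x + y)) * exp ((s/2) * m)" for m
    using *[of "s/4" m] s by simp
  show "norm (exp (s * m) * Ai (x + m) * Ai (y + m)) \<le> (airy_const s)\<^sup>2 * exp (- s * (x + y)) * exp (- s * m)" for m
    using *[of s m] s by (simp add: algebra_simps)
qed (use s in auto)

lemma airy_exp_add: "airy_exp (x + m) w = airy_exp x w * exp (- of_real m * w)"
  by (simp add: airy_exp_def algebra_simps flip: exp_add)

text \<open>A Parseval argument: half of the weight \<open>exp (s * m)\<close> goes to each Airy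
  factor and makes it the Fourier transform of an integrable function, \<open>F\<close> or
  \<open>G\<close>. The extra factor \<open>exp (- e n * m\<^sup>2)\<close> permits the exchange of
  integrals; its own transform is a heat kernel which concentrates at \<open>j = - k\<close> as
  \<open>e n\<close> tends to 0. The remaining integral of \<open>F k * G (- k)\<close> is
  Gaussian.\<close>

lemma integral_exp_Ai_Ai:
  assumes s: "s > 0"
  shows "(LBINT m. exp (s * m) * Ai (x + m) * Ai (y + m)) = gauss s (x - y) * exp (s ^ 3 / 12 - s * (x + y) / 2)"
proof -
  \<comment> \<open>On the contour with this abscissa the factor \<open>exp (a * m)\<close> cancels
    the decay of \<open>airy_exp (x + m)\<close> in \<open>m\<close> and leaves the pure oscillation
    \<open>osc\<close>.\<close>
  define a where "a = s / 2"
  have a: "a > 0" using s by (simp add: a_def)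
  define F where "F = (\<lambda>k. airy_exp x (Complex a k))"
  define G where "G = (\<lambda>k. airy_exp y (Complex a k))"
  have [measurable]: "F \<in> borel_measurable borel" "G \<in> borel_measurable borel"
    unfolding F_def G_def by measurable
  have FG: "integrable lborel F" "integrable lborel G"
    unfolding F_def G_def by (rule integrable_airy_exp[OF a])+
  note FGn = FG[THEN integrable_norm]
  have G_le: "norm (G k) \<le> exp (a ^ 3 / 3 - a * y)" for k
    using a by (simp add: G_def norm_airy_exp)
  have contG: "isCont G k" for k
  proof -
    have "continuous_on UNIV G" unfolding G_def airy_exp_def Complex_eq by (intro continuous_intros) auto
    then show ?thesis by (simp add: continuous_on_eq_continuous_at)
  qed
  define e where "e = (\<lambda>n. 1 / real (Suc n))"
  have e: "e \<longlonglongrightarrow> 0" "\<And>n. e n > 0"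
    using LIMSEQ_Suc[OF lim_const_over_n[of "1::real"]] by (auto simp: e_def)
  define osc where "osc = (\<lambda>k m. exp (- \<i> * of_real (k * m)))"
  have osc_norm: "norm (osc k m) = 1" for k m by (simp add: osc_def)
  have [measurable]: "case_prod osc \<in> borel_measurable (borel \<Otimes>\<^sub>M borel)" unfolding osc_def by measurable
  have Ai_F: "\<And>m. of_real (exp (a * m) * Ai (x + m)) = (CLBINT k. F k * osc k m) / (2 * pi)"
    and Ai_G: "\<And>m. of_real (exp (a * m) * Ai (y + m)) = (CLBINT k. G k * osc k m) / (2 * pi)"
  proof -
    fix m
    have *: "of_real (exp (a * m)) * airy_exp (z + m) (Complex a k) = airy_exp z (Complex a k) * osc k m" for z k
    proof -
      have "of_real (a * m) + (- of_real m * Complex a k) = - \<i> * of_real (k * m)"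
        by (simp add: complex_eq_iff)
      then have "of_real (exp (a * m)) * exp (- of_real m * Complex a k) = osc k m"
        unfolding osc_def by (simp only: exp_of_real[symmetric] exp_add[symmetric])
      then show ?thesis unfolding airy_exp_add by (metis mult.left_commute)
    qed
    have "of_real (exp (a * m) * Ai (z + m)) = (CLBINT k. airy_exp z (Complex a k) * osc k m) / (2 * pi)" for z
      unfolding of_real_mult Ai_contour[OF a] times_divide_eq_right
      by (subst integral_mult_right_zero[symmetric]) (simp only: *)
    then show "of_real (exp (a * m) * Ai (x + m)) = (CLBINT k. F k * osc k m) / (2 * pi)"
      "of_real (exp (a * m) * Ai (y + m)) = (CLBINT k. G k * osc k m) / (2 * pi)"
      by (auto simp: F_def G_def)
  qed
  define L where "L = (\<lambda>n. LBINT m. exp (- e n * m\<^sup>2) * (exp (s * m) * Ai (x + m) * Ai (y + m)))"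
  have L_lim: "L \<longlonglongrightarrow> (LBINT m. exp (s * m) * Ai (x + m) * Ai (y + m))"
    unfolding L_def
  proof (rule integral_dominated_convergence[where w = "\<lambda>m. norm (exp (s * m) * Ai (x + m) * Ai (y + m))"])
    show "integrable lborel (\<lambda>m. norm (exp (s * m) * Ai (x + m) * Ai (y + m)))"
      using integrable_exp_Ai_Ai[OF s] by (rule integrable_norm)
    show "AE m in lborel. (\<lambda>n. exp (- e n * m\<^sup>2) * (exp (s * m) * Ai (x + m) * Ai (y + m))) \<longlonglongrightarrow> exp (s * m) * Ai (x + m) * Ai (y + m)"
    proof (intro AE_I2)
      fix m :: real
      have "(\<lambda>n. exp (- e n * m\<^sup>2) * (exp (s * m) * Ai (x + m) * Ai (y + m))) \<longlonglongrightarrow> exp (- 0 * m\<^sup>2) * (exp (s * m) * Ai (x + m) * Ai (y + m))"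
        by (intro tendsto_intros e)
      then show "(\<lambda>n. exp (- e n * m\<^sup>2) * (exp (s * m) * Ai (x + m) * Ai (y + m))) \<longlonglongrightarrow> exp (s * m) * Ai (x + m) * Ai (y + m)" by simp
    qed
    show "AE m in lborel. norm (exp (- e n * m\<^sup>2) * (exp (s * m) * Ai (x + m) * Ai (y + m))) \<le> norm (exp (s * m) * Ai (x + m) * Ai (y + m))" for n
      using less_imp_le[OF e(2)[of n]] by (auto simp: abs_mult intro!: mult_left_le_one_le)
  qed auto
  define R where "R = (\<lambda>n. CLBINT k. F k * (CLBINT v. gauss (e n) v *\<^sub>R G (- k + v)))"
  have L_eq: "of_real (L n) = R n / (2 * pi)" for n
  proof -
    have ge: "integrable lborel (\<lambda>m. exp (- e n * m\<^sup>2))" by (rule integrable_exp_square[OF e(2)])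
    define Gh where "Gh = (\<lambda>m. CLBINT k. G k * osc k m)"
    have [measurable]: "Gh \<in> borel_measurable borel" unfolding Gh_def by measurable
    have Gh_le: "norm (Gh m) \<le> (LBINT k. norm (G k))" for m
      unfolding Gh_def using integral_norm_bound[of lborel "\<lambda>k. G k * osc k m"] by (simp add: norm_mult osc_norm)
    define Fh where "Fh = (\<lambda>m. CLBINT k. F k * osc k m)"
    define V where "V = (\<lambda>m. complex_of_real (exp (- e n * m\<^sup>2)))"
    have [measurable]: "V \<in> borel_measurable borel" unfolding V_def by measurable
    have V_norm: "norm (V m) = exp (- e n * m\<^sup>2)" for m by (simp add: V_def)
    have inner: "(CLBINT m. V m * Gh m * (F k * osc k m)) = 2 * pi * (F k * (CLBINT v. gauss (e n) v *\<^sub>R G (- k + v)))" for k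
    proof -
      have "(CLBINT m. V m * Gh m * (F k * osc k m)) = (CLBINT m. F k * (V m * osc k m * Gh m))"
        by (simp only: mult_ac)
      also have "\<dots> = F k * (CLBINT m. V m * osc k m * Gh m)"
        by (rule integral_mult_right_zero)
      also have "(CLBINT m. V m * osc k m * Gh m) = (CLBINT m. (CLBINT j. V m * osc k m * (G j * osc j m)))"
        by (simp add: Gh_def)
      also have "\<dots> = (CLBINT j. (CLBINT m. V m * osc k m * (G j * osc j m)))"
      proof (rule Fubini_dominated[OF lborel_pair_sigma_finite])
        show "norm (V m * osc k m * (G j * osc j m)) \<le> exp (- e n * m\<^sup>2) * norm (G j)" for m j
          by (simp add: norm_mult osc_norm V_norm)
      qed (use FGn ge in measurable)
      also have "\<dots> = (CLBINT j. G j * of_real (2 * pi * gauss (e n) (k + j)))"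
      proof (intro Bochner_Integration.integral_cong refl)
        fix j
        have "osc k m * osc j m = exp (\<i> * of_real ((- (k + j)) * m))" for m
          by (simp add: osc_def algebra_simps flip: exp_add)
        then have "V m * osc k m * (G j * osc j m) = G j * (V m * exp (\<i> * of_real ((- (k + j)) * m)))" for m
          by (metis (no_types) mult.assoc mult.commute)
        then have "(CLBINT m. V m * osc k m * (G j * osc j m)) = G j * (CLBINT m. V m * exp (\<i> * of_real ((- (k + j)) * m)))"
          by (simp only: integral_mult_right_zero)
        then show "(CLBINT m. V m * osc k m * (G j * osc j m)) = G j * of_real (2 * pi * gauss (e n) (k + j))"
          unfolding V_def exp_square_char[OF e(2), of n "- (k + j)"] gauss_minus .
      qed
      also have "\<dots> = (CLBINT v. G (- k + v) * of_real (2 * pi * gauss (e n) v))"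
        by (subst lborel_integral_real_affine[where c = 1 and t = "- k"]) auto
      also have "\<dots> = (CLBINT v. of_real (2 * pi) * (gauss (e n) v *\<^sub>R G (- k + v)))"
        by (simp add: scaleR_conv_of_real mult_ac)
      also have "\<dots> = of_real (2 * pi) * (CLBINT v. gauss (e n) v *\<^sub>R G (- k + v))"
        by (rule integral_mult_right_zero)
      finally show ?thesis by (simp add: mult_ac)
    qed
    have "of_real (L n) = (CLBINT m. V m * (of_real (exp (a * m) * Ai (x + m)) * of_real (exp (a * m) * Ai (y + m))))"
      unfolding L_def V_def integral_complex_of_real[symmetric]
      by (intro Bochner_Integration.integral_cong refl)
        (simp add: a_def mult_ac flip: of_real_mult exp_add)
    also have "\<dots> = (CLBINT m. (V m * Gh m * Fh m) / (2 * pi)\<^sup>2)"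
    proof -
      have "of_real (exp (a * m) * Ai (x + m)) = Fh m / (2 * pi)" "of_real (exp (a * m) * Ai (y + m)) = Gh m / (2 * pi)" for m
        unfolding Fh_def Gh_def by (rule Ai_F Ai_G)+
      then show ?thesis by (simp only:) (simp add: power2_eq_square mult_ac)
    qed
    also have "\<dots> = (CLBINT m. V m * Gh m * Fh m) / (2 * pi)\<^sup>2"
      by (rule integral_divide_zero)
    also have "(CLBINT m. V m * Gh m * Fh m) = (CLBINT m. (CLBINT k. V m * Gh m * (F k * osc k m)))"
      by (simp add: Fh_def)
    also have "\<dots> = (CLBINT k. (CLBINT m. V m * Gh m * (F k * osc k m)))"
    proof (rule Fubini_dominated[OF lborel_pair_sigma_finite])
      show "integrable lborel (\<lambda>m. exp (- e n * m\<^sup>2) * (LBINT k. norm (G k)))" using ge by simp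
      show "norm (V m * Gh m * (F k * osc k m)) \<le> exp (- e n * m\<^sup>2) * (LBINT k. norm (G k)) * norm (F k)" for m k
        using Gh_le[of m] by (auto simp: norm_mult osc_norm V_norm intro!: mult_right_mono)
    qed (use FGn in measurable)
    also have "\<dots> = 2 * pi * R n"
      unfolding R_def inner by (rule integral_mult_right_zero)
    finally show ?thesis by (simp add: power2_eq_square)
  qed
  have "R \<longlonglongrightarrow> (CLBINT k. F k * G (- k))"
    unfolding R_def
  proof (rule integral_dominated_convergence[where w = "\<lambda>k. norm (F k) * exp (a ^ 3 / 3 - a * y)"])
    show "AE k in lborel. (\<lambda>n. F k * (CLBINT v. gauss (e n) v *\<^sub>R G (- k + v))) \<longlonglongrightarrow> F k * G (- k)"
      by (intro AE_I2 tendsto_mult tendsto_const gauss_approximate_identity[OF _ G_le contG e]) measurable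
    show "AE k in lborel. norm (F k * (CLBINT v. gauss (e n) v *\<^sub>R G (- k + v))) \<le> norm (F k) * exp (a ^ 3 / 3 - a * y)" for n
    proof (intro AE_I2)
      fix k
      have "norm (CLBINT v. gauss (e n) v *\<^sub>R G (- k + v)) \<le> (LBINT v. gauss (e n) v * exp (a ^ 3 / 3 - a * y))"
        using integrable_gauss[OF e(2), of n] G_le by (intro norm_integral_dominated) (auto intro!: mult_left_mono)
      then show "norm (F k * (CLBINT v. gauss (e n) v *\<^sub>R G (- k + v))) \<le> norm (F k) * exp (a ^ 3 / 3 - a * y)"
        using integral_gauss[OF e(2)] by (simp add: norm_mult mult_left_mono)
    qed
  qed (use FGn in auto)
  then have "(\<lambda>n. complex_of_real (L n)) \<longlonglongrightarrow> (CLBINT k. F k * G (- k)) / (2 * pi)"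
    unfolding L_eq by (intro tendsto_intros) auto
  then have "complex_of_real (LBINT m. exp (s * m) * Ai (x + m) * Ai (y + m)) = (CLBINT k. F k * G (- k)) / (2 * pi)"
    by (rule LIMSEQ_unique[OF tendsto_of_real[OF L_lim]])
  \<comment> \<open>The points \<open>Complex a k\<close> and \<open>Complex a (- k)\<close> are
    conjugate, so the odd powers of \<open>k\<close> in the cubes cancel; their contribution is
    \<open>s ^ 3 / 12 - s * k\<^sup>2\<close>.\<close>
  also have "(CLBINT k. F k * G (- k)) = (CLBINT k. of_real (exp (s ^ 3 / 12 - s * (x + y) / 2)) * (of_real (exp (- s * k\<^sup>2)) * exp (\<i> * of_real ((y - x) * k))))"
  proof (intro Bochner_Integration.integral_cong refl)
    fix k
    have "(Complex a k) ^ 3 / 3 - of_real x * Complex a k + ((Complex a (- k)) ^ 3 / 3 - of_real y * Complex a (- k))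
      = of_real (s ^ 3 / 12 - s * (x + y) / 2) + (of_real (- s * k\<^sup>2) + \<i> * of_real ((y - x) * k))"
      by (simp add: complex_eq_iff a_def power3_eq_cube power2_eq_square field_simps)
    then show "F k * G (- k) = of_real (exp (s ^ 3 / 12 - s * (x + y) / 2)) * (of_real (exp (- s * k\<^sup>2)) * exp (\<i> * of_real ((y - x) * k)))"
      unfolding F_def G_def airy_exp_def by (simp only: exp_of_real[symmetric] exp_add[symmetric])
  qed
  also have "\<dots> = of_real (exp (s ^ 3 / 12 - s * (x + y) / 2)) * of_real (2 * pi * gauss s (y - x))"
    by (subst integral_mult_right_zero, subst exp_square_char[OF s]) simp
  finally have "complex_of_real (LBINT m. exp (s * m) * Ai (x + m) * Ai (y + m)) = of_real (exp (s ^ 3 / 12 - s * (x + y) / 2) * gauss s (y - x))"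
    by simp
  moreover have "gauss s (y - x) = gauss s (x - y)"
    using gauss_minus[of s "x - y"] by simp
  ultimately show ?thesis
    by (simp only: of_real_eq_iff mult.commute)
qed

section \<open>The backward heat solution\<close>

definition airy_heat :: "real \<Rightarrow> real \<Rightarrow> real" where
  "airy_heat t z = exp (- 2 * t ^ 3 / 3 - z * t) * Ai (z + t\<^sup>2)"

text \<open>For fixed \<open>w\<close> the factor \<open>exp (- t w^2 - z w)\<close> is annihilated
  by d/dt + d^2/dz^2. Shifting the contour variable of \<open>Ai\<close> by \<open>t\<close> writes
  \<open>airy_heat\<close> as a superposition of these waves.\<close>

definition heat_exp :: "real \<Rightarrow> real \<Rightarrow> complex \<Rightarrow> complex" where
  "heat_exp t z w = exp (w ^ 3 / 3 - of_real t * w\<^sup>2 - of_real z * w)"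

lemma heat_exp_airy_exp:
  "of_real (exp (- 2 * t ^ 3 / 3 - z * t)) * airy_exp (z + t\<^sup>2) (w - of_real t) = heat_exp t z w"
proof -
  have "of_real (- 2 * t ^ 3 / 3 - z * t) + ((w - of_real t) ^ 3 / 3 - of_real (z + t\<^sup>2) * (w - of_real t))
     = w ^ 3 / 3 - of_real t * w\<^sup>2 - of_real z * w"
    by (simp add: power3_eq_cube power2_eq_square field_simps)
  then show ?thesis
    unfolding heat_exp_def airy_exp_def by (simp only: exp_of_real[symmetric] exp_add[symmetric])
qed

lemma heat_exp_airy_exp_Complex:
  "heat_exp t z (Complex a k) = of_real (exp (- 2 * t ^ 3 / 3 - z * t)) * airy_exp (z + t\<^sup>2) (Complex (a - t) k)"
proof -
  have "Complex (a - t) k = Complex a k - of_real t" by (simp add: complex_eq_iff)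
  then show ?thesis by (simp only: heat_exp_airy_exp)
qed

lemma airy_heat_contour:
  assumes "a > t"
  shows "complex_of_real (airy_heat t z) = (CLBINT k. heat_exp t z (Complex a k)) / (2 * pi)"
  using Ai_contour[of "a - t" "z + t\<^sup>2"] assms
  by (simp add: airy_heat_def heat_exp_airy_exp_Complex)

lemma integrable_heat_exp: "a > t \<Longrightarrow> integrable lborel (\<lambda>k. heat_exp t z (Complex a k))"
  unfolding heat_exp_airy_exp_Complex by (intro integrable_mult_right integrable_airy_exp) auto

definition heat_const :: "real \<Rightarrow> real \<Rightarrow> real" where
  "heat_const t a = exp (a ^ 3 / 3 - t * a\<^sup>2) / (2 * sqrt (pi * (a - t)))"

text \<open>The rate \<open>a\<close> is the abscissa of the shifted contour. For negative
  \<open>t\<close> it may be negative too, so one estimate covers both decay and growth in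
  \<open>z\<close>.\<close>

lemma airy_heat_exp_bound:
  assumes "a > t"
  shows "\<bar>airy_heat t z\<bar> \<le> heat_const t a * exp (- a * z)"
proof -
  have "\<bar>airy_heat t z\<bar> = exp (- 2 * t ^ 3 / 3 - z * t) * \<bar>Ai (z + t\<^sup>2)\<bar>"
    by (simp add: airy_heat_def abs_mult)
  also have "\<dots> \<le> exp (- 2 * t ^ 3 / 3 - z * t) * (exp ((a - t) ^ 3 / 3 - (a - t) * (z + t\<^sup>2)) / (2 * sqrt (pi * (a - t))))"
    using assms by (intro mult_left_mono abs_Ai_le) auto
  also have "\<dots> = exp (- 2 * t ^ 3 / 3 - z * t + ((a - t) ^ 3 / 3 - (a - t) * (z + t\<^sup>2))) / (2 * sqrt (pi * (a - t)))"
    by (simp add: exp_add)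
  also have "- 2 * t ^ 3 / 3 - z * t + ((a - t) ^ 3 / 3 - (a - t) * (z + t\<^sup>2)) = (a ^ 3 / 3 - t * a\<^sup>2) + (- a * z)"
    by (simp add: power3_eq_cube power2_eq_square field_simps)
  finally show ?thesis unfolding exp_add heat_const_def by simp
qed

lemma heat_const_pos: "a > t \<Longrightarrow> heat_const t a > 0"
  by (simp add: heat_const_def)

lemma continuous_airy_heat: "continuous_on UNIV (\<lambda>(t, z). airy_heat t z)"
  unfolding airy_heat_def split_beta
  by (intro continuous_intros continuous_on_compose2[OF continuous_Ai]) auto

lemma airy_heat_measurable [measurable (raw)]:
  assumes [measurable]: "f \<in> borel_measurable M" "g \<in> borel_measurable M"
  shows "(\<lambda>z. airy_heat (f z) (g z)) \<in> borel_measurable M"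
  unfolding airy_heat_def by measurable

lemma airy_heat_0 [simp]: "airy_heat 0 z = Ai z"
  by (simp add: airy_heat_def)

lemma heat_exp_add: "heat_exp t (z + x) w = exp (- of_real x * w) * heat_exp t z w"
  by (simp add: heat_exp_def algebra_simps flip: exp_add)

text \<open>The heat flow over time \<open>s\<close> multiplies the wave with parameter
  \<open>w\<close> by \<open>exp (s w^2)\<close>, which is the quotient of the waves at times
  \<open>t\<close> and \<open>t + s\<close>. One contour to the right of \<open>t + s\<close>
  represents both sides. Along a Brownian path this is the martingale property of
  \<open>airy_heat\<close>.\<close>

lemma airy_heat_semigroup:
  assumes s: "s > 0"
  shows "(LBINT x. gauss s x * airy_heat (t + s) (z + x)) = airy_heat t z"
proof -
  define a where "a = t + s + 1"
  have a: "a > t + s" "a > t" using s by (auto simp: a_def)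
  let ?H = "\<lambda>k. heat_exp (t + s) z (Complex a k)"
  have "complex_of_real (LBINT x. gauss s x * airy_heat (t + s) (z + x))
      = (CLBINT x. (CLBINT k. of_real (gauss s x) * exp (- of_real x * Complex a k) * ?H k)) / (2 * pi)"
    unfolding integral_complex_of_real[symmetric] of_real_mult airy_heat_contour[OF a(1)]
    by (simp add: heat_exp_add mult_ac flip: integral_mult_right_zero)
  also have "(CLBINT x. (CLBINT k. of_real (gauss s x) * exp (- of_real x * Complex a k) * ?H k))
      = (CLBINT k. (CLBINT x. of_real (gauss s x) * exp (- of_real x * Complex a k) * ?H k))"
  proof (rule Fubini_dominated[OF lborel_pair_sigma_finite])
    show "integrable lborel (\<lambda>x. gauss s x * exp ((- a) * x))" by (rule integrable_gauss_exp[OF s])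
    show "integrable lborel (\<lambda>k. norm (?H k))" using integrable_heat_exp[OF a(1)] by (rule integrable_norm)
    show "norm (of_real (gauss s x) * exp (- of_real x * Complex a k) * ?H k) \<le> gauss s x * exp ((- a) * x) * norm (?H k)" for x k
      by (simp add: norm_mult mult.commute)
    show "(\<lambda>(x, k). of_real (gauss s x) * exp (- of_real x * Complex a k) * ?H k) \<in> borel_measurable (lborel \<Otimes>\<^sub>M lborel)"
      unfolding heat_exp_def Complex_eq by measurable
  qed
  also have "\<dots> = (CLBINT k. heat_exp t z (Complex a k))"
  proof (intro Bochner_Integration.integral_cong refl)
    fix k
    have "(CLBINT x. of_real (gauss s x) * exp (- of_real x * Complex a k) * ?H k) = exp (of_real s * (Complex a k)\<^sup>2) * ?H k"
      by (simp only: integral_mult_left_zero gauss_mgf_complex(2)[OF s])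
    also have "\<dots> = heat_exp t z (Complex a k)"
      by (simp add: heat_exp_def algebra_simps flip: exp_add)
    finally show "(CLBINT x. of_real (gauss s x) * exp (- of_real x * Complex a k) * ?H k) = heat_exp t z (Complex a k)" .
  qed
  finally have "complex_of_real (LBINT x. gauss s x * airy_heat (t + s) (z + x)) = of_real (airy_heat t z)"
    by (simp only: airy_heat_contour[OF a(2)])
  then show ?thesis by (simp only: of_real_eq_iff)
qed

section \<open>Fredholm determinants\<close>

lemma reflection_norm:
  fixes b v :: "nat \<Rightarrow> real" and m :: nat
  defines "d \<equiv> (\<Sum>k<m. v k * v k)"
  shows "(\<Sum>j<m. (b j - 2 * (\<Sum>k<m. b k * v k) * v j / d)\<^sup>2) = (\<Sum>j<m. (b j)\<^sup>2)"
proof (cases "d = 0")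
  case False
  define p where "p = (\<Sum>k<m. b k * v k)"
  define c where "c = 2 * p / d"
  have "(\<Sum>j<m. (b j - 2 * p * v j / d)\<^sup>2) = (\<Sum>j<m. (b j)\<^sup>2 - 2 * c * (b j * v j) + c * c * (v j * v j))"
    by (intro sum.cong refl) (simp add: c_def power2_eq_square algebra_simps)
  also have "\<dots> = (\<Sum>j<m. (b j)\<^sup>2) - 2 * c * p + c * c * d"
    unfolding d_def p_def by (simp only: sum.distrib sum_subtractf sum_distrib_left)
  also have "c * c * d = 2 * c * p"
    using False by (simp add: c_def)
  finally show ?thesis by (simp add: p_def)
qed simp

text \<open>Induction on the size by a Householder reflection \<open>Q\<close>, which sends the
  first row to \<open>(s, 0, ..., 0)\<close> with \<open>s\<close> its Euclidean length. The squared
  determinant and the lengths of all rows are preserved, so up to sign the determinant is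
  \<open>s\<close> times a minor, whose rows have merely lost their first entry.\<close>

lemma Hadamard_inequality:
  fixes A :: "real mat"
  assumes "A \<in> carrier_mat n n"
  shows "(Determinant.det A)\<^sup>2 \<le> (\<Prod>i<n. \<Sum>j<n. (A $$ (i, j))\<^sup>2)"
  using assms
proof (induction n arbitrary: A)
  case (Suc n)
  let ?m = "Suc n"
  define a where "a = (\<lambda>j. A $$ (0, j))"
  define s where "s = sqrt (\<Sum>j<?m. (a j)\<^sup>2)"
  have ss: "s * s = (\<Sum>j<?m. a j * a j)" unfolding s_def by (simp add: sum_nonneg power2_eq_square)
  \<comment> \<open>The reflection in the hyperplane orthogonal to \<open>a - s e_0\<close>
    exchanges \<open>a\<close> with \<open>s e_0\<close>, both being of length
    \<open>s\<close>.\<close>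
  define v where "v = (\<lambda>j. a j - (if j = 0 then s else 0))"
  define d where "d = (\<Sum>k<?m. v k * v k)"
  have av: "(\<Sum>k<?m. a k * v k) = s * s - s * a 0"
    unfolding v_def ss by (simp add: algebra_simps sum_subtractf sum.lessThan_Suc_shift del: sum.lessThan_Suc)
  have d: "d = 2 * (\<Sum>k<?m. a k * v k)"
    unfolding av unfolding d_def v_def ss by (simp add: algebra_simps sum.lessThan_Suc_shift del: sum.lessThan_Suc)
      (simp add: ss[unfolded sum.lessThan_Suc_shift] algebra_simps)
  define Q where "Q = mat ?m ?m (\<lambda>(i, j). (if i = j then 1 else 0) - 2 * v i * v j / d)"
  define B where "B = mat ?m ?m (\<lambda>(i, j). A $$ (i, j) - 2 * (\<Sum>k<?m. A $$ (i, k) * v k) * v j / d)"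
  have Q: "Q \<in> carrier_mat ?m ?m" and B: "B \<in> carrier_mat ?m ?m" by (auto simp: Q_def B_def)
  have mult: "(\<Sum>k<?m. b k * Q $$ (k, j)) = b j - 2 * (\<Sum>k<?m. b k * v k) * v j / d" if "j < ?m" for b j
  proof -
    have "(\<Sum>k<?m. b k * Q $$ (k, j)) = (\<Sum>k<?m. (if k = j then b k else 0) - 2 * (b k * v k) * v j / d)"
      by (intro sum.cong refl) (use that in \<open>auto simp: Q_def algebra_simps\<close>)
    also have "\<dots> = b j - 2 * (\<Sum>k<?m. b k * v k) * v j / d"
      using that by (simp add: sum_subtractf sum_distrib_left sum_distrib_right sum_divide_distrib del: sum.lessThan_Suc)
    finally show ?thesis .
  qed
  have "A * Q = B"
    using Suc.prems Q B mult
    by (intro eq_matI) (auto simp: scalar_prod_def B_def atLeast0LessThan simp del: sum.lessThan_Suc)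
  moreover have "Q * Q = 1\<^sub>m ?m"
  proof (rule eq_matI)
    fix i j assume ij: "i < dim_row (1\<^sub>m ?m)" "j < dim_col (1\<^sub>m ?m)"
    have "(Q * Q) $$ (i, j) = (\<Sum>k<?m. Q $$ (i, k) * Q $$ (k, j))"
      using Q ij by (simp add: scalar_prod_def atLeast0LessThan del: sum.lessThan_Suc)
    also have "\<dots> = Q $$ (i, j) - 2 * (\<Sum>k<?m. Q $$ (i, k) * v k) * v j / d"
      using ij by (intro mult) auto
    also have "(\<Sum>k<?m. Q $$ (i, k) * v k) = v i - 2 * d * v i / d"
    proof -
      have "(\<Sum>k<?m. Q $$ (i, k) * v k) = (\<Sum>k<?m. v k * Q $$ (k, i))"
        using ij by (intro sum.cong refl) (auto simp: Q_def)
      then show ?thesis using mult[of i v] ij by (simp add: d_def)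
    qed
    also have "Q $$ (i, j) - 2 * (v i - 2 * d * v i / d) * v j / d = 1\<^sub>m ?m $$ (i, j)"
      using ij by (simp add: Q_def)
    finally show "(Q * Q) $$ (i, j) = 1\<^sub>m ?m $$ (i, j)" .
  qed (use Q in auto)
  ultimately have "Determinant.det B = Determinant.det A * Determinant.det Q" "(Determinant.det Q)\<^sup>2 = 1"
    using det_mult[OF Suc.prems Q] det_mult[OF Q Q] by (auto simp: power2_eq_square)
  then have "(Determinant.det B)\<^sup>2 = (Determinant.det A)\<^sup>2"
    by (simp add: power_mult_distrib)
  moreover have "B $$ (0, j) = (if j = 0 then s else 0)" if "j < ?m" for j
  \<comment> \<open>If \<open>v\<close> vanishes, the first row already has the desired form, and
    division by zero turns \<open>Q\<close> into the identity.\<close>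
  proof (cases "d = 0")
    case True
    then have "v j = 0" using that by (auto simp: d_def sum_nonneg_eq_0_iff simp del: sum.lessThan_Suc)
    then show ?thesis using that True by (simp add: B_def v_def a_def del: sum.lessThan_Suc)
  next
    case False
    have "B $$ (0, j) = a j - d * v j / d" using that by (simp add: B_def d a_def del: sum.lessThan_Suc)
    then show ?thesis using False by (simp add: v_def)
  qed
  then have "Determinant.det B = (\<Sum>j<?m. (if j = 0 then s else 0) * cofactor B 0 j)"
    by (subst laplace_expansion_row[OF B, of 0]) (auto simp del: sum.lessThan_Suc)
  then have "Determinant.det B = s * Determinant.det (mat_delete B 0 0)"
    by (simp add: cofactor_def sum.lessThan_Suc_shift del: sum.lessThan_Suc)
  ultimately have "(Determinant.det A)\<^sup>2 = s * s * (Determinant.det (mat_delete B 0 0))\<^sup>2"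
    by (simp add: power2_eq_square mult_ac)
  also have "\<dots> \<le> s * s * (\<Prod>i<n. \<Sum>j<n. (mat_delete B 0 0 $$ (i, j))\<^sup>2)"
    by (intro mult_left_mono Suc.IH) (use B mat_delete_carrier[OF B] in auto)
  also have "\<dots> \<le> s * s * (\<Prod>i<n. \<Sum>j<?m. (A $$ (Suc i, j))\<^sup>2)"
  proof (intro mult_left_mono prod_mono conjI sum_nonneg)
    fix i assume i: "i \<in> {..<n}"
    have "(\<Sum>j<n. (mat_delete B 0 0 $$ (i, j))\<^sup>2) = (\<Sum>j<n. (B $$ (Suc i, Suc j))\<^sup>2)"
      using B i by (intro sum.cong refl) (auto simp: mat_delete_def)
    also have "\<dots> \<le> (\<Sum>j<?m. (B $$ (Suc i, j))\<^sup>2)"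
      by (simp add: sum.lessThan_Suc_shift del: sum.lessThan_Suc)
    also have "\<dots> = (\<Sum>j<?m. (A $$ (Suc i, j))\<^sup>2)"
      using reflection_norm[where b = "\<lambda>j. A $$ (Suc i, j)" and v = v and m = ?m] i
      unfolding d_def[symmetric] by (simp add: B_def del: sum.lessThan_Suc)
    finally show "(\<Sum>j<n. (mat_delete B 0 0 $$ (i, j))\<^sup>2) \<le> (\<Sum>j<?m. (A $$ (Suc i, j))\<^sup>2)" .
  qed auto
  also have "\<dots> = (\<Prod>i<?m. \<Sum>j<?m. (A $$ (i, j))\<^sup>2)"
    by (subst prod.lessThan_Suc_shift) (simp add: ss a_def power2_eq_square del: sum.lessThan_Suc)
  finally show ?case .
qed simp

lemma det_mat_leibniz:
  "Determinant.det (mat n n (\<lambda>(i, j). T i j)) = (\<Sum>p | p permutes {..<n}. signof p * (\<Prod>i<n. T i (p i)))"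
proof -
  have "p i < n" if "p permutes {..<n}" "i < n" for p i using permutes_in_image[OF that(1), of i] that(2) by auto
  then show ?thesis
    by (subst det_def'[of _ n]) (auto simp: atLeast0LessThan intro!: sum.cong prod.cong)
qed

lemma det_mat_leibniz_transpose:
  "Determinant.det (mat n n (\<lambda>(i, j). T i j)) = (\<Sum>p | p permutes {..<n}. signof p * (\<Prod>i<n. T (p i) i))"
proof -
  have "Determinant.det (mat n n (\<lambda>(i, j). T i j)) = Determinant.det (transpose_mat (mat n n (\<lambda>(i, j). T i j)))"
    by (subst det_transpose[of _ n]) auto
  also have "transpose_mat (mat n n (\<lambda>(i, j). T i j)) = mat n n (\<lambda>(i, j). T j i)"
    by (rule eq_matI) auto
  finally show ?thesis by (simp only: det_mat_leibniz)
qed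

lemma det_mat_scale:
  fixes T :: "nat \<Rightarrow> nat \<Rightarrow> real"
  shows "Determinant.det (mat n n (\<lambda>(i, j). a i * T i j * b j)) = (\<Prod>i<n. a i * b i) * Determinant.det (mat n n (\<lambda>(i, j). T i j))"
proof -
  have "(\<Prod>i<n. b (p i)) = (\<Prod>i<n. b i)" if "p permutes {..<n}" for p
    using prod.permute[OF that, of b] by (simp add: o_def)
  then show ?thesis
    unfolding det_mat_leibniz sum_distrib_left
    by (intro sum.cong refl) (auto simp: prod.distrib mult_ac)
qed

text \<open>The factors \<open>a i\<close> of the rows and \<open>b j\<close> of the columns come
  out of the determinant. The remaining entries are at most 1 in modulus, so every row has length at
  most \<open>sqrt n\<close>.\<close>

lemma abs_det_mat_le:
  fixes T :: "nat \<Rightarrow> nat \<Rightarrow> real"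
  assumes "\<And>i j. \<bar>T i j\<bar> \<le> a i * b j" and a: "\<And>i. 0 \<le> a i" and b: "\<And>i. 0 \<le> b i"
  shows "\<bar>Determinant.det (mat n n (\<lambda>(i, j). T i j))\<bar> \<le> sqrt (real n ^ n) * (\<Prod>i<n. a i * b i)"
proof -
  \<comment> \<open>Where \<open>a i * b j\<close> is 0, \<open>T i j\<close> is 0 as well, and so
    is the quotient by convention.\<close>
  define S where "S = (\<lambda>i j. T i j / (a i * b j))"
  have T: "T i j = a i * S i j * b j" for i j
    using assms(1)[of i j] by (cases "a i * b j = 0") (auto simp: S_def)
  have S: "(S i j)\<^sup>2 \<le> 1" for i j
  proof -
    have "\<bar>T i j / (a i * b j)\<bar> \<le> 1"
      using assms(1)[of i j] a[of i] b[of j] unfolding abs_divide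
      by (cases "a i * b j = 0") (auto simp: abs_mult divide_le_eq_1)
    then show ?thesis unfolding S_def by (simp add: abs_square_le_1)
  qed
  have "(Determinant.det (mat n n (\<lambda>(i, j). S i j)))\<^sup>2 \<le> (\<Prod>i<n. \<Sum>j<n. (mat n n (\<lambda>(i, j). S i j) $$ (i, j))\<^sup>2)"
    by (rule Hadamard_inequality) auto
  also have "\<dots> \<le> (\<Prod>i<n. real n)"
  proof (intro prod_mono conjI sum_nonneg zero_le_power2)
    fix i assume "i \<in> {..<n}"
    then have "(\<Sum>j<n. (mat n n (\<lambda>(i, j). S i j) $$ (i, j))\<^sup>2) \<le> (\<Sum>j<n. 1)"
      using S by (intro sum_mono) auto
    then show "(\<Sum>j<n. (mat n n (\<lambda>(i, j). S i j) $$ (i, j))\<^sup>2) \<le> real n" by simp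
  qed
  finally have "\<bar>Determinant.det (mat n n (\<lambda>(i, j). S i j))\<bar> \<le> sqrt (real n ^ n)"
    by (intro real_le_rsqrt) simp
  then show ?thesis
    unfolding T det_mat_scale abs_mult using a b
    by (subst mult.commute) (auto simp: abs_prod abs_mult intro!: mult_right_mono prod_nonneg)
qed

section \<open>The Fredholm expansion under a product bound\<close>

interpretation lborel_product: product_sigma_finite "\<lambda>_. lborel :: real measure" ..

abbreviation lborel_power :: "nat \<Rightarrow> (nat \<Rightarrow> real) measure" where
  "lborel_power n \<equiv> Pi\<^sub>M {..<n} (\<lambda>_. lborel)"

lemma fredholm_minor_measurable [measurable]:
  assumes [measurable]: "case_prod T \<in> borel_measurable (borel \<Otimes>\<^sub>M borel)"
  shows "fredholm_minor T n \<in> borel_measurable (lborel_power n)"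
proof -
  have "p i \<in> {..<n}" if "p permutes {..<n}" "i < n" for p i using permutes_in_image[OF that(1), of i] that(2) by auto
  moreover have [measurable]: "(\<lambda>z. z i) \<in> borel_measurable (lborel_power n)" if "i < n" for i
    using measurable_component_singleton[of i "{..<n}" "\<lambda>_. lborel"] that by simp
  moreover have "(\<lambda>x. T (x i) (x j)) \<in> borel_measurable (lborel_power n)" if "i < n" "j < n" for i j
    using that by measurable
  ultimately have "(\<lambda>x. T (x i) (x (p i))) \<in> borel_measurable (lborel_power n)" if "p permutes {..<n}" "i < n" for p i
    using that by auto
  then show ?thesis
    unfolding fredholm_minor_def[abs_def] det_mat_leibniz by (intro borel_measurable_sum borel_measurable_times borel_measurable_prod) auto
qed

lemma abs_fredholm_minor_le:
  assumes "\<And>x z. \<bar>T x z\<bar> \<le> a x * b z" "\<And>x. 0 \<le> a x" "\<And>x. 0 \<le> b x"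
  shows "\<bar>fredholm_minor T n x\<bar> \<le> sqrt (real n ^ n) * (\<Prod>i<n. a (x i) * b (x i))"
  unfolding fredholm_minor_def by (rule abs_det_mat_le) (use assms in auto)

lemma
  fixes f :: "real \<Rightarrow> real"
  assumes "integrable lborel f"
  shows integrable_prod_power: "integrable (lborel_power n) (\<lambda>x. \<Prod>i<n. f (x i))"
    and integral_prod_power: "(\<integral>x. (\<Prod>i<n. f (x i)) \<partial>lborel_power n) = (LBINT x. f x) ^ n"
  using lborel_product.product_integrable_prod[of "{..<n}" "\<lambda>_. f"] lborel_product.product_integral_prod[of "{..<n}" "\<lambda>_. f"] assms
  by auto

text \<open>By \<open>n^n / n! \<le> e^n\<close> the term is at most
  \<open>(e |B| / sqrt n)^n\<close>, and this is at most \<open>2^(-n)\<close> as soon as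
  \<open>n \<ge> (2 e |B|)^2\<close>.\<close>

lemma summable_hadamard: "summable (\<lambda>n. sqrt (real n ^ n) * B ^ n / fact n)"
proof (rule summable_comparison_test_ev)
  show "summable (\<lambda>n. (1 / 2 :: real) ^ n)" by (rule summable_geometric) simp
  have "\<forall>\<^sub>F n in sequentially. (2 * exp 1 * \<bar>B\<bar>)\<^sup>2 \<le> real n"
    using filterlim_real_sequentially by (simp add: filterlim_at_top)
  then show "\<forall>\<^sub>F n in sequentially. norm (sqrt (real n ^ n) * B ^ n / fact n) \<le> (1 / 2) ^ n"
    using eventually_gt_at_top[of 0]
  proof eventually_elim
    case (elim n)
    have n: "0 < sqrt (real n)" using elim by simp
    have "2 * exp 1 * \<bar>B\<bar> \<le> sqrt (real n)" using elim by (intro real_le_rsqrt)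
    then have *: "exp 1 * \<bar>B\<bar> / sqrt (real n) \<le> 1 / 2" using n by (simp add: field_simps)
    have e: "real n ^ n / fact n \<le> exp 1 ^ n"
    proof -
      have "(\<Sum>k\<in>{n}. real n ^ k / fact k) \<le> (\<Sum>k. real n ^ k /\<^sub>R fact k)"
        using sum_le_suminf[OF summable_exp_generic[of "real n"], of "{n}"] by (simp add: divide_inverse mult.commute)
      also have "\<dots> = exp 1 ^ n" using exp_of_nat_mult[of n "1::real"] by (simp add: exp_def)
      finally show ?thesis by simp
    qed
    have "norm (sqrt (real n ^ n) * B ^ n / fact n) = (real n ^ n / fact n) * (\<bar>B\<bar> / sqrt (real n)) ^ n"
    proof -
      have "real n ^ n = sqrt (real n) ^ n * sqrt (real n) ^ n"
        by (simp flip: power_mult_distrib)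
      then show ?thesis using n by (simp add: real_sqrt_power abs_mult power_abs power_divide field_simps)
    qed
    also have "\<dots> \<le> exp 1 ^ n * (\<bar>B\<bar> / sqrt (real n)) ^ n"
      by (intro mult_right_mono e) (use n in auto)
    also have "\<dots> = (exp 1 * \<bar>B\<bar> / sqrt (real n)) ^ n"
      by (simp add: power_mult_distrib power_divide)
    also have "\<dots> \<le> (1 / 2) ^ n"
      by (intro power_mono *) (use n in auto)
    finally show ?case .
  qed
qed

lemma
  assumes T: "case_prod T \<in> borel_measurable (borel \<Otimes>\<^sub>M borel)"
    and bound: "\<And>x z. \<bar>T x z\<bar> \<le> a x * b z" "\<And>x. 0 \<le> a x" "\<And>x. 0 \<le> b x"
    and ab: "integrable lborel (\<lambda>x. a x * b x)"
  shows integrable_fredholm_minor: "integrable (lborel_power n) (fredholm_minor T n)"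
    and integral_fredholm_minor_le:
      "\<bar>integral\<^sup>L (lborel_power n) (fredholm_minor T n)\<bar> \<le> sqrt (real n ^ n) * (LBINT x. a x * b x) ^ n"
proof -
  have *: "integrable (lborel_power n) (\<lambda>x. sqrt (real n ^ n) * (\<Prod>i<n. a (x i) * b (x i)))"
    by (intro integrable_mult_right integrable_prod_power ab)
  note m = fredholm_minor_measurable[OF T, of n]
  have le: "norm (fredholm_minor T n x) \<le> sqrt (real n ^ n) * (\<Prod>i<n. a (x i) * b (x i))" for x
    using abs_fredholm_minor_le[of T a b n x] bound by simp
  show "integrable (lborel_power n) (fredholm_minor T n)"
    by (rule integrable_dominated[OF m * le])
  have "\<bar>integral\<^sup>L (lborel_power n) (fredholm_minor T n)\<bar> \<le> (\<integral>x. sqrt (real n ^ n) * (\<Prod>i<n. a (x i) * b (x i)) \<partial>lborel_power n)"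
    using norm_integral_dominated[OF m * le] by simp
  then show "\<bar>integral\<^sup>L (lborel_power n) (fredholm_minor T n)\<bar> \<le> sqrt (real n ^ n) * (LBINT x. a x * b x) ^ n"
    using integral_prod_power[OF ab, of n] by simp
qed

lemma fredholm_det_exists:
  assumes "case_prod T \<in> borel_measurable (borel \<Otimes>\<^sub>M borel)"
    and "\<And>x z. \<bar>T x z\<bar> \<le> a x * b z" "\<And>x. 0 \<le> a x" "\<And>x. 0 \<le> b x"
    and "integrable lborel (\<lambda>x. a x * b x)"
  obtains d where "has_fredholm_det T d"
proof -
  have "summable (\<lambda>n. integral\<^sup>L (lborel_power n) (fredholm_minor T n) / fact n)"
    by (rule summable_comparison_test_ev[OF always_eventually summable_hadamard[of "LBINT x. a x * b x"]])
      (use integral_fredholm_minor_le[OF assms] in \<open>auto intro!: divide_right_mono\<close>)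
  then show ?thesis
    using integrable_fredholm_minor[OF assms] that by (auto simp: has_fredholm_det_def summable_def)
qed

lemma has_fredholm_det_unique: "has_fredholm_det T d \<Longrightarrow> has_fredholm_det T d' \<Longrightarrow> d = d'"
  unfolding has_fredholm_det_def using sums_unique2 by blast

text \<open>Dominated convergence twice: in each minor with the Hadamard majorant, and in the series
  by Tannery's theorem with the integrals of these majorants. Convergence of the kernels at every
  point gives convergence of the minors, diagonal entries included.\<close>

lemma fredholm_det_tendsto:
  assumes meas: "\<And>m. case_prod (T m) \<in> borel_measurable (borel \<Otimes>\<^sub>M borel)"
    and bound: "\<And>m x z. \<bar>T m x z\<bar> \<le> a x * b z" "\<And>x. 0 \<le> a x" "\<And>x. 0 \<le> b x"
    and ab: "integrable lborel (\<lambda>x. a x * b x)"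
    and lim: "\<And>x z. (\<lambda>m. T m x z) \<longlonglongrightarrow> S x z"
    and det: "\<And>m. has_fredholm_det (T m) (d m)"
  obtains d' where "d \<longlonglongrightarrow> d'" "has_fredholm_det S d'"
proof -
  have S_meas: "case_prod S \<in> borel_measurable (borel \<Otimes>\<^sub>M borel)"
    by (rule borel_measurable_LIMSEQ_real[OF _ meas]) (auto intro: lim)
  have S_bound: "\<bar>S x z\<bar> \<le> a x * b z" for x z
    by (rule LIMSEQ_le_const2[OF tendsto_rabs[OF lim]]) (use bound in auto)
  obtain d' where d': "has_fredholm_det S d'"
    by (rule fredholm_det_exists[OF S_meas S_bound bound(2,3) ab])
  have minor: "(\<lambda>m. fredholm_minor (T m) n x) \<longlonglongrightarrow> fredholm_minor S n x" for n x
    unfolding fredholm_minor_def det_mat_leibniz by (intro tendsto_intros lim)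
  have "(\<lambda>m. integral\<^sup>L (lborel_power n) (fredholm_minor (T m) n)) \<longlonglongrightarrow> integral\<^sup>L (lborel_power n) (fredholm_minor S n)" for n
  proof (rule integral_dominated_convergence[where w = "\<lambda>x. sqrt (real n ^ n) * (\<Prod>i<n. a (x i) * b (x i))"])
    show "integrable (lborel_power n) (\<lambda>x. sqrt (real n ^ n) * (\<Prod>i<n. a (x i) * b (x i)))"
      by (intro integrable_mult_right integrable_prod_power ab)
    show "AE x in lborel_power n. norm (fredholm_minor (T m) n x) \<le> sqrt (real n ^ n) * (\<Prod>i<n. a (x i) * b (x i))" for m
      using abs_fredholm_minor_le[of "T m" a b n] bound by (intro AE_I2) simp
  qed (use minor fredholm_minor_measurable meas S_meas in auto)
  note minors = this
  have "(\<lambda>m. (\<Sum>n. integral\<^sup>L (lborel_power n) (fredholm_minor (T m) n) / fact n)) \<longlonglongrightarrow> (\<Sum>n. integral\<^sup>L (lborel_power n) (fredholm_minor S n) / fact n)"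
    by (intro tannerys_theorem[where M = "\<lambda>n. sqrt (real n ^ n) * (LBINT x. a x * b x) ^ n / fact n", THEN conjunct2, THEN conjunct2] tendsto_divide tendsto_const)
      (auto intro!: always_eventually divide_right_mono summable_hadamard integral_fredholm_minor_le[OF meas bound ab] minors)
  then have "d \<longlonglongrightarrow> d'"
    using det d' by (simp add: has_fredholm_det_def sums_iff)
  then show ?thesis using d' that by blast
qed

lemma has_fredholm_det_conjugate:
  assumes "\<And>x. w x \<noteq> 0"
  shows "has_fredholm_det (\<lambda>x z. w x * T x z / w z) d \<longleftrightarrow> has_fredholm_det T d"
proof -
  have "fredholm_minor (\<lambda>x z. w x * T x z / w z) n x = fredholm_minor T n x" for n x
    unfolding fredholm_minor_def
    using det_mat_scale[where n = n and a = "\<lambda>i. w (x i)" and b = "\<lambda>i. inverse (w (x i))" and T = "\<lambda>i j. T (x i) (x j)"] assms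
    by (simp add: divide_inverse)
  then have "fredholm_minor (\<lambda>x z. w x * T x z / w z) = fredholm_minor T" by blast
  then show ?thesis unfolding has_fredholm_det_def by (simp only:)
qed

text \<open>Expanding one determinant by rows and the other by columns, both \<open>n\<close>-th minors integrate to
  \<open>\<integral>\<integral> \<Prod>\<^sub>i F(x\<^sub>i, l\<^sub>i) det [G(l\<^sub>i, x\<^sub>j)] dx dl\<close>.\<close>

lemma has_fredholm_det_cyclic:
  assumes F [measurable]: "case_prod F \<in> borel_measurable (borel \<Otimes>\<^sub>M borel)"
    and G [measurable]: "case_prod G \<in> borel_measurable (borel \<Otimes>\<^sub>M borel)"
    and F_le: "\<And>x l. \<bar>F x l\<bar> \<le> a x * b l" and G_le: "\<And>l x. \<bar>G l x\<bar> \<le> b' l * a' x"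
    and nonneg: "\<And>x. 0 \<le> a x" "\<And>x. 0 \<le> b x" "\<And>x. 0 \<le> a' x" "\<And>x. 0 \<le> b' x"
    and aa: "integrable lborel (\<lambda>x. a x * a' x)" and bb: "integrable lborel (\<lambda>l. b l * b' l)"
  shows "has_fredholm_det (\<lambda>x z. LBINT l. F x l * G l z) d \<longleftrightarrow> has_fredholm_det (\<lambda>l m. LBINT x. G l x * F x m) d"
proof -
  define FG where "FG = (\<lambda>x z. LBINT l. F x l * G l z)"
  define GF where "GF = (\<lambda>l m. LBINT x. G l x * F x m)"
  have FG_le: "\<bar>F x l * G l z\<bar> \<le> (a x * a' z) * (b l * b' l)" for x z l
    using mult_mono[OF F_le[of x l] G_le[of l z]] nonneg by (simp add: abs_mult mult_ac)
  have GF_le: "\<bar>G l x * F x m\<bar> \<le> (b' l * b m) * (a x * a' x)" for x l m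
    using mult_mono[OF F_le[of x m] G_le[of l x]] nonneg by (simp add: abs_mult mult_ac)
  have i1: "integrable lborel (\<lambda>l. F x l * G l z)" for x z
    by (rule integrable_dominated[where g = "\<lambda>l. (a x * a' z) * (b l * b' l)"]) (use FG_le bb in auto)
  have i2: "integrable lborel (\<lambda>x. G l x * F x m)" for l m
    by (rule integrable_dominated[where g = "\<lambda>x. (b' l * b m) * (a x * a' x)"]) (use GF_le aa in auto)
  have FG_bound: "\<bar>FG x z\<bar> \<le> a x * ((LBINT l. b l * b' l) * a' z)" for x z
  proof -
    have "norm (FG x z) \<le> (LBINT l. (a x * a' z) * (b l * b' l))"
      unfolding FG_def by (rule norm_integral_dominated) (use FG_le bb in auto)
    then show ?thesis by (simp only: integral_mult_right_zero real_norm_def) (simp add: mult_ac)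
  qed
  have GF_bound: "\<bar>GF l m\<bar> \<le> b' l * ((LBINT x. a x * a' x) * b m)" for l m
  proof -
    have "norm (GF l m) \<le> (LBINT x. (b' l * b m) * (a x * a' x))"
      unfolding GF_def by (rule norm_integral_dominated) (use GF_le aa in auto)
    then show ?thesis by (simp only: integral_mult_right_zero real_norm_def) (simp add: mult_ac)
  qed
  have FG_int: "integrable (lborel_power n) (fredholm_minor FG n)" for n
  proof (rule integrable_fredholm_minor[OF _ FG_bound])
    show "case_prod FG \<in> borel_measurable (borel \<Otimes>\<^sub>M borel)" unfolding FG_def by measurable
    show "integrable lborel (\<lambda>x. a x * ((LBINT l. b l * b' l) * a' x))"
      using integrable_mult_right[OF aa, of "LBINT l. b l * b' l"] by (simp add: mult.left_commute)
  qed (use nonneg in \<open>auto intro!: mult_nonneg_nonneg integral_nonneg\<close>)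
  have GF_int: "integrable (lborel_power n) (fredholm_minor GF n)" for n
  proof (rule integrable_fredholm_minor[OF _ GF_bound])
    show "case_prod GF \<in> borel_measurable (borel \<Otimes>\<^sub>M borel)" unfolding GF_def by measurable
    show "integrable lborel (\<lambda>l. b' l * ((LBINT x. a x * a' x) * b l))"
      using integrable_mult_right[OF bb, of "LBINT x. a x * a' x"] by (simp add: mult_ac)
  qed (use nonneg in \<open>auto intro!: mult_nonneg_nonneg integral_nonneg\<close>)
  have eq: "integral\<^sup>L (lborel_power n) (fredholm_minor FG n) = integral\<^sup>L (lborel_power n) (fredholm_minor GF n)" for n
  proof -
    define D where "D = (\<lambda>l x. Determinant.det (mat n n (\<lambda>(i, j). G (l i) (x j :: real))))"
    define H where "H = (\<lambda>x l. (\<Prod>i<n. F (x i) (l i)) * D l x)"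
    have FG_eq: "fredholm_minor FG n x = (\<integral>l. H x l \<partial>lborel_power n)" for x
    proof -
      have "fredholm_minor FG n x = (\<Sum>p | p permutes {..<n}. signof p * (\<integral>l. (\<Prod>i<n. F (x i) (l i) * G (l i) (x (p i))) \<partial>lborel_power n))"
        unfolding fredholm_minor_def det_mat_leibniz FG_def
        by (simp only: lborel_product.product_integral_prod[OF finite_lessThan i1])
      also have "\<dots> = (\<integral>l. (\<Sum>p | p permutes {..<n}. signof p * (\<Prod>i<n. F (x i) (l i) * G (l i) (x (p i)))) \<partial>lborel_power n)"
      proof -
        have "integrable (lborel_power n) (\<lambda>l. signof p * (\<Prod>i<n. F (x i) (l i) * G (l i) (x (p i))))" for p
          by (intro integrable_mult_right lborel_product.product_integrable_prod finite_lessThan i1)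
        from Bochner_Integration.integral_sum[where I = "{p. p permutes {..<n}}", OF this] show ?thesis
          by (simp only: integral_mult_right_zero)
      qed
      also have "\<dots> = (\<integral>l. H x l \<partial>lborel_power n)"
        unfolding H_def D_def det_mat_leibniz by (simp only: prod.distrib sum_distrib_left mult.left_commute)
      finally show ?thesis .
    qed
    have GF_eq: "fredholm_minor GF n l = (\<integral>x. H x l \<partial>lborel_power n)" for l
    proof -
      have "fredholm_minor GF n l = (\<Sum>p | p permutes {..<n}. signof p * (\<integral>x. (\<Prod>i<n. G (l (p i)) (x i) * F (x i) (l i)) \<partial>lborel_power n))"
        unfolding fredholm_minor_def det_mat_leibniz_transpose GF_def
        by (simp only: lborel_product.product_integral_prod[OF finite_lessThan i2])
      also have "\<dots> = (\<integral>x. (\<Sum>p | p permutes {..<n}. signof p * (\<Prod>i<n. G (l (p i)) (x i) * F (x i) (l i))) \<partial>lborel_power n)"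
      proof -
        have "integrable (lborel_power n) (\<lambda>x. signof p * (\<Prod>i<n. G (l (p i)) (x i) * F (x i) (l i)))" for p
          by (intro integrable_mult_right lborel_product.product_integrable_prod finite_lessThan i2)
        from Bochner_Integration.integral_sum[where I = "{p. p permutes {..<n}}", OF this] show ?thesis
          by (simp only: integral_mult_right_zero)
      qed
      also have "\<dots> = (\<integral>x. H x l \<partial>lborel_power n)"
        unfolding H_def D_def det_mat_leibniz_transpose by (simp only: prod.distrib sum_distrib_left mult_ac)
      finally show ?thesis .
    qed
    have "(\<integral>x. (\<integral>l. H x l \<partial>lborel_power n) \<partial>lborel_power n) = (\<integral>l. (\<integral>x. H x l \<partial>lborel_power n) \<partial>lborel_power n)"
    proof (rule Fubini_dominated)
      show "pair_sigma_finite (lborel_power n) (lborel_power n)"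
        by (intro pair_sigma_finite.intro lborel_product.sigma_finite) auto
      have comp: "(\<lambda>z. z i) \<in> borel_measurable (lborel_power n)" if "i < n" for i
        using measurable_component_singleton[of i "{..<n}" "\<lambda>_. lborel"] that by simp
      note comp1 = measurable_compose[OF measurable_fst comp] and comp2 = measurable_compose[OF measurable_snd comp]
      have perm: "p i < n" if "p permutes {..<n}" "i < n" for p i using permutes_in_image[OF that(1), of i] that(2) by auto
      have mF: "(\<lambda>z. F (fst z i) (snd z i)) \<in> borel_measurable (lborel_power n \<Otimes>\<^sub>M lborel_power n)" if "i < n" for i
        using measurable_compose[OF measurable_Pair[OF comp1 comp2] F, OF that that] by simp
      have mG: "(\<lambda>z. G (snd z i) (fst z j)) \<in> borel_measurable (lborel_power n \<Otimes>\<^sub>M lborel_power n)" if "i < n" "j < n" for i j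
        using measurable_compose[OF measurable_Pair[OF comp2 comp1] G, OF that] by simp
      show "case_prod H \<in> borel_measurable (lborel_power n \<Otimes>\<^sub>M lborel_power n)"
        unfolding H_def D_def det_mat_leibniz split_beta
        by (intro borel_measurable_sum borel_measurable_times borel_measurable_prod mF mG) (auto intro: perm)
      show "integrable (lborel_power n) (\<lambda>x. sqrt (real n ^ n) * (\<Prod>i<n. a (x i) * a' (x i)))"
        by (intro integrable_mult_right integrable_prod_power aa)
      show "integrable (lborel_power n) (\<lambda>l. \<Prod>i<n. b (l i) * b' (l i))"
        by (intro integrable_prod_power bb)
      show "norm (H x l) \<le> sqrt (real n ^ n) * (\<Prod>i<n. a (x i) * a' (x i)) * (\<Prod>i<n. b (l i) * b' (l i))" for x l
      proof -
        have "norm (H x l) \<le> (\<Prod>i<n. a (x i) * b (l i)) * (sqrt (real n ^ n) * (\<Prod>i<n. b' (l i) * a' (x i)))"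
          unfolding H_def D_def real_norm_def abs_mult abs_prod
          by (intro mult_mono prod_mono abs_det_mat_le conjI prod_nonneg) (use F_le G_le nonneg in auto)
        then show ?thesis by (simp add: prod.distrib mult_ac)
      qed
    qed
    then show ?thesis by (simp add: FG_eq[abs_def] GF_eq[abs_def])
  qed
  show ?thesis
    unfolding FG_def[symmetric] GF_def[symmetric] has_fredholm_det_def
    using FG_int GF_int eq by simp
qed

section \<open>The Airy transform on the negative half-line\<close>

text \<open>A weight that records at once the support in \<open>l < 0\<close> and an exponential
  decay there. Being integrable and at most 1, it serves as a factor in product bounds and as a
  majorant for integrals.\<close>

definition exp_half :: "real \<Rightarrow> real" where
  "exp_half l = indicator {..<0} l * exp l"

lemma exp_half_nonneg [simp]: "0 \<le> exp_half l"
  by (simp add: exp_half_def)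

lemma exp_half_le_1: "exp_half l \<le> 1"
  by (auto simp: exp_half_def split: split_indicator)

lemma exp_half_measurable [measurable]: "exp_half \<in> borel_measurable borel"
  unfolding exp_half_def by measurable

lemma integrable_exp_half: "integrable lborel exp_half"
  by (rule integrable_exp_bound[where p = 1 and q = 1 and C = 1 and D = 0])
    (auto simp: exp_half_def split: split_indicator)

abbreviation exp_half_mass :: real where
  "exp_half_mass \<equiv> integral\<^sup>L lborel exp_half"

lemma exp_half_mass_nonneg: "0 \<le> exp_half_mass"
  by (rule Bochner_Integration.integral_nonneg) simp

definition airy_transform :: "(real \<Rightarrow> real) \<Rightarrow> real \<Rightarrow> real" where
  "airy_transform f x = (LBINT l. Ai (x - l) * f l)"

lemma airy_transform_measurable [measurable (raw)]:
  assumes [measurable]: "(\<lambda>(z, l). f z l) \<in> borel_measurable (M \<Otimes>\<^sub>M borel)" "g \<in> borel_measurable M"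
  shows "(\<lambda>z. airy_transform (f z) (g z)) \<in> borel_measurable M"
  unfolding airy_transform_def by measurable

text \<open>The rates \<open>s / 4\<close> and \<open>s\<close> lie on either side of the critical
  rate \<open>s / 2\<close>, so that \<open>exp (s * x)\<close> times the square of this bound is
  integrable at both ends.\<close>

definition airy_env :: "real \<Rightarrow> real \<Rightarrow> real" where
  "airy_env s x = min (airy_const (s / 4) * exp (- (s / 4) * x)) (airy_const s * exp (- s * x))"

lemma airy_env_measurable [measurable]: "airy_env s \<in> borel_measurable borel"
  unfolding airy_env_def by measurable

lemma airy_env_nonneg: "s > 0 \<Longrightarrow> 0 \<le> airy_env s x"
  unfolding airy_env_def using airy_const_pos[of s] airy_const_pos[of "s / 4"] by auto

lemma Ai_le_exp:
  assumes "a > 0" "l \<le> 0"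
  shows "\<bar>Ai (x - l)\<bar> \<le> airy_const a * exp (- a * x)"
proof -
  have "\<bar>Ai (x - l)\<bar> \<le> airy_const a * exp (- a * (x - l))" by (rule Ai_exp_bound) fact
  also have "\<dots> \<le> airy_const a * exp (- a * x)"
    using assms airy_const_pos[of a] by (intro mult_left_mono) (auto simp: algebra_simps mult_nonneg_nonpos)
  finally show ?thesis .
qed

lemma Ai_le_env: "s > 0 \<Longrightarrow> l \<le> 0 \<Longrightarrow> \<bar>Ai (x - l)\<bar> \<le> airy_env s x"
  unfolding airy_env_def using Ai_le_exp[of s l x] Ai_le_exp[of "s / 4" l x] by auto

lemma integrable_exp_env:
  assumes "s > 0"
  shows "integrable lborel (\<lambda>x. exp (s * x) * (airy_env s x)\<^sup>2)"
proof (rule integrable_exp_bound)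
  have *: "norm (exp (s * x) * (airy_env s x)\<^sup>2) \<le> (airy_const a)\<^sup>2 * exp ((s - 2 * a) * x)" if "a = s / 4 \<or> a = s" for a x
  proof -
    have "airy_env s x \<le> airy_const a * exp (- a * x)" using that by (auto simp: airy_env_def)
    then have "norm (exp (s * x) * (airy_env s x)\<^sup>2) \<le> exp (s * x) * (airy_const a * exp (- a * x))\<^sup>2"
      using airy_env_nonneg[OF assms, of x] by (simp add: power_mono)
    also have "\<dots> = (airy_const a)\<^sup>2 * exp ((s - 2 * a) * x)"
      by (simp add: power2_eq_square algebra_simps flip: exp_add)
    finally show ?thesis .
  qed
  show "norm (exp (s * x) * (airy_env s x)\<^sup>2) \<le> (airy_const (s/4))\<^sup>2 * exp ((s/2) * x)" for x
    using *[of "s/4" x] by simp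
  show "norm (exp (s * x) * (airy_env s x)\<^sup>2) \<le> (airy_const s)\<^sup>2 * exp (- s * x)" for x
    using *[of s x] by simp
qed (use assms in auto)

text \<open>The kernel of the Airy transform followed by the weight \<open>exp (s * x)\<close> and
  the adjoint transform. It is the heat kernel at time \<open>s\<close> times a factor that tends to
  1 with \<open>s\<close> tending to 0, hence an approximate identity; this is how the orthogonality
  of the Airy functions enters.\<close>

definition smear :: "real \<Rightarrow> real \<Rightarrow> real \<Rightarrow> real" where
  "smear s l m = gauss s (l - m) * exp (s ^ 3 / 12 + s * (l + m) / 2)"

lemma smear_measurable [measurable (raw)]:
  assumes [measurable]: "f \<in> borel_measurable M" "g \<in> borel_measurable M"
  shows "(\<lambda>z. smear s (f z) (g z)) \<in> borel_measurable M"
  unfolding smear_def by measurable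

lemma integral_exp_Ai_Ai_smear:
  assumes "s > 0"
  shows "(LBINT x. exp (s * x) * Ai (x - l) * Ai (x - m)) = smear s l m"
proof -
  have "(LBINT x. exp (s * x) * Ai (x - l) * Ai (x - m)) = gauss s (- l - - m) * exp (s ^ 3 / 12 - s * (- l + - m) / 2)"
    using integral_exp_Ai_Ai[OF assms, of "- l" "- m"] by simp
  also have "gauss s (- l - - m) = gauss s (l - m)" using gauss_minus[of s "l - m"] by simp
  also have "s ^ 3 / 12 - s * (- l + - m) / 2 = s ^ 3 / 12 + s * (l + m) / 2" by (simp add: field_simps)
  finally show ?thesis by (simp only: smear_def)
qed

section \<open>Airy transforms of decaying functions on the negative half-line\<close>

context
  fixes f :: "real \<Rightarrow> real" and B :: real
  assumes f_meas [measurable]: "f \<in> borel_measurable borel" and f_le: "\<And>l. \<bar>f l\<bar> \<le> B * exp_half l"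
begin

lemma half_line_bound_nonneg: "0 \<le> B"
proof -
  have "0 \<le> B * exp_half (-1)" by (rule order_trans[OF abs_ge_zero f_le])
  then show ?thesis by (simp add: exp_half_def zero_le_mult_iff)
qed

lemma half_line_support: "0 \<le> l \<Longrightarrow> f l = 0"
  using f_le[of l] by (simp add: exp_half_def)

lemma airy_transform_integrand_le: "s > 0 \<Longrightarrow> \<bar>Ai (x - l) * f l\<bar> \<le> airy_env s x * (B * exp_half l)"
  unfolding abs_mult using f_le[of l] Ai_le_env[of s l x] airy_env_nonneg[of s x] half_line_support[of l]
  by (cases "l \<le> 0") (auto intro!: mult_mono mult_nonneg_nonneg simp: half_line_bound_nonneg)

lemma integrable_airy_transform: "integrable lborel (\<lambda>l. Ai (x - l) * f l)"
  by (rule integrable_dominated[where g = "\<lambda>l. airy_env 1 x * (B * exp_half l)"])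
    (use airy_transform_integrand_le[of 1] integrable_exp_half in auto)

lemma abs_airy_transform_le: "s > 0 \<Longrightarrow> \<bar>airy_transform f x\<bar> \<le> airy_env s x * (B * exp_half_mass)"
  unfolding airy_transform_def
  using norm_integral_dominated[of "\<lambda>l. Ai (x - l) * f l" lborel "\<lambda>l. airy_env s x * (B * exp_half l)"]
    airy_transform_integrand_le[of s x] integrable_exp_half by simp

lemma integral_exp_Ai_airy_transform:
  assumes s: "s > 0" and l: "l \<le> 0"
  shows "(LBINT x. exp (s * x) * Ai (x - l) * airy_transform f x) = (LBINT m. f m * smear s l m)"
proof -
  have "(LBINT x. exp (s * x) * Ai (x - l) * airy_transform f x)
      = (LBINT x. (LBINT m. exp (s * x) * Ai (x - l) * (Ai (x - m) * f m)))"
    by (simp add: airy_transform_def)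
  also have "\<dots> = (LBINT m. (LBINT x. exp (s * x) * Ai (x - l) * (Ai (x - m) * f m)))"
  proof (rule Fubini_dominated[OF lborel_pair_sigma_finite])
    show "integrable lborel (\<lambda>x. exp (s * x) * (airy_env s x)\<^sup>2)" by (rule integrable_exp_env) fact
    show "integrable lborel (\<lambda>m. B * exp_half m)" using integrable_exp_half by simp
    show "norm (exp (s * x) * Ai (x - l) * (Ai (x - m) * f m)) \<le> exp (s * x) * (airy_env s x)\<^sup>2 * (B * exp_half m)" for x m
    proof -
      have "\<bar>Ai (x - l)\<bar> * \<bar>Ai (x - m) * f m\<bar> \<le> airy_env s x * (airy_env s x * (B * exp_half m))"
        using airy_env_nonneg[OF s, of x]
        by (intro mult_mono Ai_le_env airy_transform_integrand_le s l) auto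
      then show ?thesis by (simp add: abs_mult power2_eq_square mult.assoc)
    qed
  qed measurable
  also have "\<dots> = (LBINT m. f m * smear s l m)"
  proof (intro Bochner_Integration.integral_cong refl)
    fix m
    have "(LBINT x. exp (s * x) * Ai (x - l) * (Ai (x - m) * f m)) = (LBINT x. f m * (exp (s * x) * Ai (x - l) * Ai (x - m)))"
      by (simp only: mult_ac)
    then show "(LBINT x. exp (s * x) * Ai (x - l) * (Ai (x - m) * f m)) = f m * smear s l m"
      by (simp only: integral_mult_right_zero integral_exp_Ai_Ai_smear[OF s])
  qed
  finally show ?thesis .
qed

lemma smear_half_line_eq:
  "(LBINT m. f m * smear s l m) = (LBINT v. gauss s v *\<^sub>R (f (l + v) * exp (s ^ 3 / 12 + s * (l + (l + v)) / 2)))"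
  by (subst lborel_integral_real_affine[where c = 1 and t = l]) (auto simp: smear_def mult_ac)

text \<open>On the support \<open>l + v < 0\<close> the exponent
  \<open>s * (l + (l + v)) / 2\<close> is not positive and \<open>s ^ 3 / 12\<close> is below 1,
  which costs a factor \<open>exp 1\<close>. The Gaussian average of \<open>exp (l + v)\<close> is
  \<open>exp l * exp s\<close>, at most \<open>exp l * exp 2\<close>. Together this is
  \<open>exp 3 * exp l\<close>.\<close>

lemma smear_half_line_le:
  assumes "0 < s" "s \<le> 2" "l \<le> 0"
  shows "\<bar>LBINT m. f m * smear s l m\<bar> \<le> B * exp 3 * exp l" and "\<bar>LBINT m. f m * smear s l m\<bar> \<le> B * exp 3"
proof -
  have e: "f (l + v) * exp (s ^ 3 / 12 + s * (l + (l + v)) / 2) = 0 \<or> exp (s ^ 3 / 12 + s * (l + (l + v)) / 2) \<le> exp 1" for v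
  proof (cases "l + v < 0")
    case True
    have "s ^ 3 \<le> 2 ^ 3" using assms by (intro power_mono) auto
    moreover have "s * (l + (l + v)) \<le> 0" using assms True by (intro mult_nonneg_nonpos) auto
    ultimately show ?thesis by auto
  qed (use half_line_support[of "l + v"] in auto)
  have le: "norm (gauss s v *\<^sub>R (f (l + v) * exp (s ^ 3 / 12 + s * (l + (l + v)) / 2))) \<le> gauss s v * (B * exp_half (l + v) * exp 1)" for v
  proof -
    have "\<bar>f (l + v)\<bar> * exp (s ^ 3 / 12 + s * (l + (l + v)) / 2) \<le> (B * exp_half (l + v)) * exp 1"
    proof (cases "f (l + v) = 0")
      case False
      then show ?thesis using e[of v] half_line_bound_nonneg by (intro mult_mono f_le) auto
    qed (use half_line_bound_nonneg in simp)
    then show ?thesis by (simp add: abs_mult mult_left_mono)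
  qed
  have "norm (LBINT m. f m * smear s l m) \<le> (LBINT v. B * exp 1 * exp l * (gauss s v * exp (1 * v)))"
    unfolding smear_half_line_eq
  proof (rule norm_integral_dominated)
    show "integrable lborel (\<lambda>v. B * exp 1 * exp l * (gauss s v * exp (1 * v)))"
      by (intro integrable_mult_right integrable_gauss_exp assms)
    show "norm (gauss s v *\<^sub>R (f (l + v) * exp (s ^ 3 / 12 + s * (l + (l + v)) / 2))) \<le> B * exp 1 * exp l * (gauss s v * exp (1 * v))" for v
    proof (rule order_trans[OF le])
      have "exp_half (l + v) \<le> exp l * exp v" by (auto simp: exp_half_def exp_add split: split_indicator)
      then have "gauss s v * (B * exp_half (l + v) * exp 1) \<le> gauss s v * (B * (exp l * exp v) * exp 1)"
        using half_line_bound_nonneg by (intro mult_left_mono mult_right_mono) auto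
      then show "gauss s v * (B * exp_half (l + v) * exp 1) \<le> B * exp 1 * exp l * (gauss s v * exp (1 * v))"
        by (simp add: mult_ac)
    qed
  qed measurable
  also have "\<dots> = B * exp 1 * exp l * exp s"
    using integral_gauss_exp[OF assms(1), of 1] by simp
  also have "\<dots> \<le> B * exp 1 * exp l * exp 2"
    using assms half_line_bound_nonneg by (intro mult_left_mono) auto
  also have "\<dots> = B * exp 3 * exp l" by (simp add: mult_ac flip: exp_add)
  finally show *: "\<bar>LBINT m. f m * smear s l m\<bar> \<le> B * exp 3 * exp l" by simp
  also have "\<dots> \<le> B * exp 3" using assms half_line_bound_nonneg by (simp add: mult_left_le)
  finally show "\<bar>LBINT m. f m * smear s l m\<bar> \<le> B * exp 3" .
qed

lemma smear_tendsto:
  assumes e: "e \<longlonglongrightarrow> 0" "\<And>n. e n > 0" "\<And>n. e n \<le> 2" and l: "l < 0" and cont: "isCont f l"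
  shows "(\<lambda>n. LBINT m. f m * smear (e n) l m) \<longlonglongrightarrow> f l"
  unfolding smear_half_line_eq
proof (rule gauss_approximate_identity_seq[where f = "\<lambda>n m. f m * exp (e n ^ 3 / 12 + e n * (l + m) / 2)" and e = e and x = l and B = "B * exp 1"])
  show "norm (f m * exp (e n ^ 3 / 12 + e n * (l + m) / 2)) \<le> B * exp 1" for n m
  proof (cases "m < 0")
    case True
    have "e n ^ 3 \<le> 2 ^ 3" using e(2,3)[of n] by (intro power_mono) auto
    moreover have "e n * (l + m) \<le> 0" using e(2)[of n] True l by (intro mult_nonneg_nonpos) auto
    moreover have "\<bar>f m\<bar> \<le> B" using f_le[of m] exp_half_le_1[of m] half_line_bound_nonneg
      by (meson mult_left_le order_trans)
    ultimately show ?thesis using half_line_bound_nonneg by (auto simp: abs_mult intro!: mult_mono)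
  qed (use half_line_support[of m] half_line_bound_nonneg in auto)
  show "(\<lambda>n. f (X n) * exp (e n ^ 3 / 12 + e n * (l + X n) / 2)) \<longlonglongrightarrow> f l" if "X \<longlonglongrightarrow> l" for X
  proof -
    have "(\<lambda>n. f (X n) * exp (e n ^ 3 / 12 + e n * (l + X n) / 2)) \<longlonglongrightarrow> f l * exp (0 ^ 3 / 12 + 0 * (l + l) / 2)"
      by (intro tendsto_intros isCont_tendsto_compose[OF cont] e that) auto
    then show ?thesis by simp
  qed
qed (use e in auto)

end

lemma integral_exp_airy_transform_airy_transform:
  assumes f [measurable]: "f \<in> borel_measurable borel" "\<And>l. \<bar>f l\<bar> \<le> B * exp_half l"
    and g [measurable]: "g \<in> borel_measurable borel" "\<And>l. \<bar>g l\<bar> \<le> C * exp_half l" and s: "s > 0"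
  shows "integrable lborel (\<lambda>x. exp (s * x) * airy_transform f x * airy_transform g x)"
    and "(LBINT x. exp (s * x) * airy_transform f x * airy_transform g x) = (LBINT l. f l * (LBINT m. g m * smear s l m))"
proof -
  note fB = half_line_bound_nonneg[OF f] and gC = half_line_bound_nonneg[OF g]
  have g_le: "\<bar>airy_transform g x\<bar> \<le> airy_env s x * (C * exp_half_mass)" for x
    by (rule abs_airy_transform_le[OF g s])
  have int: "integrable lborel (\<lambda>x. (C * exp_half_mass) * (exp (s * x) * (airy_env s x)\<^sup>2))"
    by (intro integrable_mult_right integrable_exp_env s)
  have le: "norm (exp (s * x) * airy_transform g x * (Ai (x - l) * f l)) \<le> (C * exp_half_mass) * (exp (s * x) * (airy_env s x)\<^sup>2) * (B * exp_half l)" for x l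
  proof -
    have "\<bar>airy_transform g x\<bar> * \<bar>Ai (x - l) * f l\<bar> \<le> (airy_env s x * (C * exp_half_mass)) * (airy_env s x * (B * exp_half l))"
      using airy_env_nonneg[OF s, of x] exp_half_mass_nonneg gC by (intro mult_mono g_le airy_transform_integrand_le[OF f] s) auto
    then have "exp (s * x) * (\<bar>airy_transform g x\<bar> * \<bar>Ai (x - l) * f l\<bar>) \<le> exp (s * x) * ((airy_env s x * (C * exp_half_mass)) * (airy_env s x * (B * exp_half l)))"
      by (rule mult_left_mono) simp
    then show ?thesis by (simp add: abs_mult power2_eq_square mult_ac)
  qed
  have [measurable]: "airy_transform f \<in> borel_measurable borel" "airy_transform g \<in> borel_measurable borel"
    by measurable
  show "integrable lborel (\<lambda>x. exp (s * x) * airy_transform f x * airy_transform g x)"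
  proof (rule integrable_dominated[where g = "\<lambda>x. (B * exp_half_mass) * ((C * exp_half_mass) * (exp (s * x) * (airy_env s x)\<^sup>2))"])
    show "norm (exp (s * x) * airy_transform f x * airy_transform g x) \<le> (B * exp_half_mass) * ((C * exp_half_mass) * (exp (s * x) * (airy_env s x)\<^sup>2))" for x
    proof -
      have "\<bar>airy_transform f x\<bar> * \<bar>airy_transform g x\<bar> \<le> (airy_env s x * (B * exp_half_mass)) * (airy_env s x * (C * exp_half_mass))"
        using airy_env_nonneg[OF s, of x] exp_half_mass_nonneg fB gC by (intro mult_mono g_le abs_airy_transform_le[OF f] s) auto
      then have "exp (s * x) * (\<bar>airy_transform f x\<bar> * \<bar>airy_transform g x\<bar>) \<le> exp (s * x) * ((airy_env s x * (B * exp_half_mass)) * (airy_env s x * (C * exp_half_mass)))"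
        by (rule mult_left_mono) simp
      then show ?thesis by (simp add: abs_mult power2_eq_square mult_ac)
    qed
  qed (use int in auto)
  have "(LBINT x. exp (s * x) * airy_transform f x * airy_transform g x) = (LBINT x. (LBINT l. exp (s * x) * airy_transform g x * (Ai (x - l) * f l)))"
    by (simp only: airy_transform_def[of f] integral_mult_right_zero) (simp only: mult_ac)
  also have "\<dots> = (LBINT l. (LBINT x. exp (s * x) * airy_transform g x * (Ai (x - l) * f l)))"
    by (rule Fubini_dominated[OF lborel_pair_sigma_finite _ int _ le]) (use integrable_exp_half in auto)
  also have "\<dots> = (LBINT l. f l * (LBINT m. g m * smear s l m))"
  proof (intro Bochner_Integration.integral_cong refl)
    fix l
    show "(LBINT x. exp (s * x) * airy_transform g x * (Ai (x - l) * f l)) = f l * (LBINT m. g m * smear s l m)"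
    proof (cases "l \<le> 0")
      case True
      have "(LBINT x. exp (s * x) * airy_transform g x * (Ai (x - l) * f l)) = (LBINT x. f l * (exp (s * x) * Ai (x - l) * airy_transform g x))"
        by (simp only: mult_ac)
      then show ?thesis by (simp only: integral_mult_right_zero integral_exp_Ai_airy_transform[OF g s True])
    qed (use half_line_support[OF f, of l] in auto)
  qed
  finally show "(LBINT x. exp (s * x) * airy_transform f x * airy_transform g x) = (LBINT l. f l * (LBINT m. g m * smear s l m))" .
qed

definition plancherel_const :: real where
  "plancherel_const = exp 3 * exp_half_mass"

text \<open>The bound is uniform in \<open>s\<close>, so that \<open>s\<close> can tend to 0
  afterwards. The range reaches up to 2 in order to cover the weight \<open>exp (2 * x)\<close> of
  \<open>weighted_airy_transform_norm\<close>.\<close>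

lemma airy_transform_square_exp_le:
  assumes f [measurable]: "f \<in> borel_measurable borel" "\<And>l. \<bar>f l\<bar> \<le> B * exp_half l" and s: "0 < s" "s \<le> 2"
  shows "(\<integral>\<^sup>+x. exp (s * x) * (airy_transform f x)\<^sup>2 \<partial>lborel) \<le> plancherel_const * B\<^sup>2"
proof -
  note B = half_line_bound_nonneg[OF f]
  have "(\<integral>\<^sup>+x. exp (s * x) * (airy_transform f x)\<^sup>2 \<partial>lborel) = ennreal (LBINT x. exp (s * x) * (airy_transform f x)\<^sup>2)"
    using integral_exp_airy_transform_airy_transform(1)[OF f f s(1)]
    by (intro nn_integral_eq_integral) (auto simp: power2_eq_square mult.assoc)
  also have "(LBINT x. exp (s * x) * (airy_transform f x)\<^sup>2) = (LBINT l. f l * (LBINT m. f m * smear s l m))"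
    using integral_exp_airy_transform_airy_transform(2)[OF f f s(1)] by (simp add: power2_eq_square mult.assoc)
  also have "\<dots> \<le> (LBINT l. B * exp 3 * (B * exp_half l))"
  proof -
    have "norm (f l * (LBINT m. f m * smear s l m)) \<le> B * exp 3 * (B * exp_half l)" for l
    proof (cases "l \<le> 0")
      case True
      show ?thesis unfolding real_norm_def abs_mult
        by (subst mult.commute) (intro mult_mono f smear_half_line_le(2)[OF f s True]; use B in auto)
    qed (use half_line_support[OF f, of l] B in auto)
    then have "norm (LBINT l. f l * (LBINT m. f m * smear s l m)) \<le> (LBINT l. B * exp 3 * (B * exp_half l))"
      using integrable_exp_half by (intro norm_integral_dominated) auto
    then show ?thesis by (simp only: real_norm_def abs_le_iff)
  qed
  also have "\<dots> = plancherel_const * B\<^sup>2" by (simp add: plancherel_const_def power2_eq_square)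
  finally show ?thesis by (simp add: ennreal_leI)
qed

lemma inverse_Suc_seq:
  shows "(\<lambda>n. 1 / real (Suc n)) \<longlonglongrightarrow> 0" "0 < 1 / real (Suc n)" "1 / real (Suc n) \<le> 2"
  using LIMSEQ_Suc[OF lim_const_over_n[of "1::real"]] by (auto simp: field_simps)

text \<open>Fatou's lemma along the weights \<open>exp (x / (n + 1))\<close>, which tend to
  1.\<close>

lemma airy_transform_square_le:
  assumes f [measurable]: "f \<in> borel_measurable borel" "\<And>l. \<bar>f l\<bar> \<le> B * exp_half l"
  shows "(\<integral>\<^sup>+x. (airy_transform f x)\<^sup>2 \<partial>lborel) \<le> plancherel_const * B\<^sup>2"
proof -
  have [measurable]: "airy_transform f \<in> borel_measurable borel" by measurable
  have "(\<integral>\<^sup>+x. (airy_transform f x)\<^sup>2 \<partial>lborel) = (\<integral>\<^sup>+x. liminf (\<lambda>n. ennreal (exp (1 / real (Suc n) * x) * (airy_transform f x)\<^sup>2)) \<partial>lborel)"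
  proof (intro nn_integral_cong)
    fix x
    have "(\<lambda>n. ennreal (exp (1 / real (Suc n) * x) * (airy_transform f x)\<^sup>2)) \<longlonglongrightarrow> ennreal (exp (0 * x) * (airy_transform f x)\<^sup>2)"
      by (intro tendsto_intros inverse_Suc_seq)
    from lim_imp_Liminf[OF _ this] show "ennreal ((airy_transform f x)\<^sup>2) = liminf (\<lambda>n. ennreal (exp (1 / real (Suc n) * x) * (airy_transform f x)\<^sup>2))"
      by simp
  qed
  also have "\<dots> \<le> liminf (\<lambda>n. \<integral>\<^sup>+x. exp (1 / real (Suc n) * x) * (airy_transform f x)\<^sup>2 \<partial>lborel)"
    by (rule nn_integral_liminf) measurable
  also have "\<dots> \<le> plancherel_const * B\<^sup>2"
  proof (rule Liminf_le)
    show "\<forall>\<^sub>F n in sequentially. (\<integral>\<^sup>+x. exp (1 / real (Suc n) * x) * (airy_transform f x)\<^sup>2 \<partial>lborel) \<le> plancherel_const * B\<^sup>2"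
      by (intro always_eventually allI airy_transform_square_exp_le[OF f inverse_Suc_seq(2,3)])
  qed simp
  finally show ?thesis .
qed

lemma integrable_airy_transform_square:
  assumes f [measurable]: "f \<in> borel_measurable borel" "\<And>l. \<bar>f l\<bar> \<le> B * exp_half l"
  shows "integrable lborel (\<lambda>x. (airy_transform f x)\<^sup>2)"
    and "integrable lborel (\<lambda>x. exp x * (airy_transform f x)\<^sup>2)"
proof -
  have [measurable]: "airy_transform f \<in> borel_measurable borel" by measurable
  show "integrable lborel (\<lambda>x. (airy_transform f x)\<^sup>2)"
    by (rule integrableI_nonneg) (use airy_transform_square_le[OF f] in \<open>auto intro: le_less_trans\<close>)
  show "integrable lborel (\<lambda>x. exp x * (airy_transform f x)\<^sup>2)"
    using integral_exp_airy_transform_airy_transform(1)[OF f f, of 1] by (simp add: power2_eq_square mult.assoc)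
qed

text \<open>The weighted identity is passed to the weight 1. On the left all weights
  \<open>exp (s * x)\<close> with \<open>s\<close> between 0 and 1 lie below
  \<open>1 + exp x\<close>, against which the squares of both transforms are integrable. On the
  right the Gaussian smearing of \<open>g\<close> converges at the points of continuity, hence at
  every \<open>l < 0\<close>.\<close>

lemma airy_transform_isometry:
  assumes f [measurable]: "f \<in> borel_measurable borel" "\<And>l. \<bar>f l\<bar> \<le> B * exp_half l"
    and g [measurable]: "g \<in> borel_measurable borel" "\<And>l. \<bar>g l\<bar> \<le> C * exp_half l"
    and cont: "\<And>l. l < 0 \<Longrightarrow> isCont g l"
  shows "integrable lborel (\<lambda>x. airy_transform f x * airy_transform g x)"
    and "(LBINT x. airy_transform f x * airy_transform g x) = (LBINT l. f l * g l)"
proof -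
  have [measurable]: "airy_transform f \<in> borel_measurable borel" "airy_transform g \<in> borel_measurable borel"
    by measurable
  let ?w = "\<lambda>x. (1 + exp x) * ((airy_transform f x)\<^sup>2 + (airy_transform g x)\<^sup>2)"
  have w: "integrable lborel ?w"
    using integrable_airy_transform_square[OF f] integrable_airy_transform_square[OF g]
    by (simp add: algebra_simps)
  have amgm: "\<bar>airy_transform f x * airy_transform g x\<bar> \<le> (airy_transform f x)\<^sup>2 + (airy_transform g x)\<^sup>2" for x
  proof -
    have "2 * (\<bar>airy_transform f x\<bar> * \<bar>airy_transform g x\<bar>) \<le> (airy_transform f x)\<^sup>2 + (airy_transform g x)\<^sup>2"
      using sum_squares_bound[of "\<bar>airy_transform f x\<bar>" "\<bar>airy_transform g x\<bar>"] by (simp add: mult.assoc)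
    moreover have "0 \<le> \<bar>airy_transform f x\<bar> * \<bar>airy_transform g x\<bar>" by simp
    ultimately show ?thesis unfolding abs_mult by linarith
  qed
  have le: "\<bar>exp (s * x) * airy_transform f x * airy_transform g x\<bar> \<le> ?w x" if "0 \<le> s" "s \<le> 1" for s x
  proof -
    have "exp (s * x) \<le> 1 + exp x"
    proof (cases "x \<ge> 0")
      case True
      then have "s * x \<le> 1 * x" using that by (intro mult_right_mono) auto
      then have "exp (s * x) \<le> exp x" by simp
      then show ?thesis by linarith
    next
      case False
      then have "exp (s * x) \<le> 1" using that by (simp add: mult_nonneg_nonpos)
      then show ?thesis using exp_gt_zero[of x] by linarith
    qed
    then show ?thesis using amgm[of x] unfolding mult.assoc abs_mult[of "exp (s * x)"]
      by (intro mult_mono) auto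
  qed
  show "integrable lborel (\<lambda>x. airy_transform f x * airy_transform g x)"
    by (rule integrable_dominated[OF _ w]) (use le[of 0] in auto)
  let ?e = "\<lambda>n. 1 / real (Suc n)"
  have "(\<lambda>n. LBINT x. exp (?e n * x) * airy_transform f x * airy_transform g x) \<longlonglongrightarrow> (LBINT x. airy_transform f x * airy_transform g x)"
  proof (rule integral_dominated_convergence[OF _ _ w])
    show "AE x in lborel. norm (exp (?e n * x) * airy_transform f x * airy_transform g x) \<le> ?w x" for n
      using le[of "?e n"] by (intro AE_I2) (simp del: of_nat_Suc)
    show "AE x in lborel. (\<lambda>n. exp (?e n * x) * airy_transform f x * airy_transform g x) \<longlonglongrightarrow> airy_transform f x * airy_transform g x"
    proof (intro AE_I2)
      fix x
      have "(\<lambda>n. exp (?e n * x) * airy_transform f x * airy_transform g x) \<longlonglongrightarrow> exp (0 * x) * airy_transform f x * airy_transform g x"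
        by (intro tendsto_intros inverse_Suc_seq)
      then show "(\<lambda>n. exp (?e n * x) * airy_transform f x * airy_transform g x) \<longlonglongrightarrow> airy_transform f x * airy_transform g x" by simp
    qed
  qed measurable
  moreover have "(\<lambda>n. LBINT l. f l * (LBINT m. g m * smear (?e n) l m)) \<longlonglongrightarrow> (LBINT l. f l * g l)"
  proof (rule integral_dominated_convergence[where w = "\<lambda>l. C * exp 3 * (B * exp_half l)"])
    show "AE l in lborel. (\<lambda>n. f l * (LBINT m. g m * smear (?e n) l m)) \<longlonglongrightarrow> f l * g l"
    proof (intro AE_I2)
      fix l
      show "(\<lambda>n. f l * (LBINT m. g m * smear (?e n) l m)) \<longlonglongrightarrow> f l * g l"
      proof (cases "l < 0")
        case True
        show ?thesis
          by (intro tendsto_mult tendsto_const smear_tendsto[OF g] inverse_Suc_seq cont True)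
      qed (use half_line_support[OF f, of l] in auto)
    qed
    show "AE l in lborel. norm (f l * (LBINT m. g m * smear (?e n) l m)) \<le> C * exp 3 * (B * exp_half l)" for n
    proof (intro AE_I2)
      fix l
      show "norm (f l * (LBINT m. g m * smear (?e n) l m)) \<le> C * exp 3 * (B * exp_half l)"
      proof (cases "l \<le> 0")
        case True
        show ?thesis unfolding real_norm_def abs_mult
          by (subst mult.commute)
            (intro mult_mono f smear_half_line_le(2)[OF g inverse_Suc_seq(2,3) True]; use half_line_bound_nonneg[OF g] in auto)
      qed (use half_line_support[OF f, of l] half_line_bound_nonneg[OF f] half_line_bound_nonneg[OF g] in auto)
    qed
  qed (use integrable_exp_half in auto)
  ultimately show "(LBINT x. airy_transform f x * airy_transform g x) = (LBINT l. f l * g l)"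
    using integral_exp_airy_transform_airy_transform(2)[OF f g inverse_Suc_seq(2)] LIMSEQ_unique by simp
qed

section \<open>Square integrability and the Airy kernel as a projection\<close>

lemma abs_integral_mult_le_sqrt:
  fixes f g :: "'a \<Rightarrow> real"
  assumes [measurable]: "f \<in> borel_measurable M" "g \<in> borel_measurable M"
    and f: "integrable M (\<lambda>x. (f x)\<^sup>2)" and g: "integrable M (\<lambda>x. (g x)\<^sup>2)"
  shows "integrable M (\<lambda>x. f x * g x)"
    and "\<bar>\<integral>x. f x * g x \<partial>M\<bar> \<le> sqrt (\<integral>x. (f x)\<^sup>2 \<partial>M) * sqrt (\<integral>x. (g x)\<^sup>2 \<partial>M)"
proof -
  have fg: "integrable M (\<lambda>x. \<bar>f x\<bar> * \<bar>g x\<bar>)"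
  proof (rule integrable_dominated[where g = "\<lambda>x. (f x)\<^sup>2 + (g x)\<^sup>2"])
    show "norm (\<bar>f x\<bar> * \<bar>g x\<bar>) \<le> (f x)\<^sup>2 + (g x)\<^sup>2" for x
    proof -
      have "2 * (\<bar>f x\<bar> * \<bar>g x\<bar>) \<le> (f x)\<^sup>2 + (g x)\<^sup>2"
        using sum_squares_bound[of "\<bar>f x\<bar>" "\<bar>g x\<bar>"] by (simp add: mult.assoc)
      moreover have "0 \<le> \<bar>f x\<bar> * \<bar>g x\<bar>" by simp
      ultimately show ?thesis unfolding real_norm_def abs_mult abs_abs by linarith
    qed
  qed (use f g in auto)
  show "integrable M (\<lambda>x. f x * g x)"
    by (rule integrable_dominated[OF _ fg]) (auto simp: abs_mult)
  have "(\<integral>\<^sup>+x. ennreal \<bar>f x\<bar> * ennreal \<bar>g x\<bar> \<partial>M)\<^sup>2 \<le> (\<integral>\<^sup>+x. (ennreal \<bar>f x\<bar>)\<^sup>2 \<partial>M) * (\<integral>\<^sup>+x. (ennreal \<bar>g x\<bar>)\<^sup>2 \<partial>M)"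
    by (rule Cauchy_Schwarz_nn_integral) auto
  moreover have "(\<integral>\<^sup>+x. ennreal \<bar>f x\<bar> * ennreal \<bar>g x\<bar> \<partial>M) = ennreal (\<integral>x. \<bar>f x\<bar> * \<bar>g x\<bar> \<partial>M)"
    using fg by (subst nn_integral_eq_integral[symmetric]) (auto simp: ennreal_mult)
  moreover have "(\<integral>\<^sup>+x. (ennreal \<bar>f x\<bar>)\<^sup>2 \<partial>M) = ennreal (\<integral>x. (f x)\<^sup>2 \<partial>M)"
    using f by (subst nn_integral_eq_integral[symmetric]) (auto simp: ennreal_power)
  moreover have "(\<integral>\<^sup>+x. (ennreal \<bar>g x\<bar>)\<^sup>2 \<partial>M) = ennreal (\<integral>x. (g x)\<^sup>2 \<partial>M)"
    using g by (subst nn_integral_eq_integral[symmetric]) (auto simp: ennreal_power)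
  ultimately have "(\<integral>x. \<bar>f x\<bar> * \<bar>g x\<bar> \<partial>M)\<^sup>2 \<le> (\<integral>x. (f x)\<^sup>2 \<partial>M) * (\<integral>x. (g x)\<^sup>2 \<partial>M)"
    by (simp add: ennreal_power Bochner_Integration.integral_nonneg flip: ennreal_mult)
  then have "(\<integral>x. \<bar>f x\<bar> * \<bar>g x\<bar> \<partial>M) \<le> sqrt ((\<integral>x. (f x)\<^sup>2 \<partial>M) * (\<integral>x. (g x)\<^sup>2 \<partial>M))"
    by (rule real_le_rsqrt)
  moreover have "norm (\<integral>x. f x * g x \<partial>M) \<le> (\<integral>x. \<bar>f x\<bar> * \<bar>g x\<bar> \<partial>M)"
    by (rule norm_integral_dominated[OF _ fg]) (auto simp: abs_mult)
  ultimately show "\<bar>\<integral>x. f x * g x \<partial>M\<bar> \<le> sqrt (\<integral>x. (f x)\<^sup>2 \<partial>M) * sqrt (\<integral>x. (g x)\<^sup>2 \<partial>M)"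
    by (simp add: real_sqrt_mult)
qed

text \<open>Cutting off at \<open>l < 0\<close> instead of \<open>l \<le> 0\<close> leaves the
  integrals unchanged and makes the bound by \<open>exp_half\<close> hold at every point.\<close>

definition airy_neg :: "real \<Rightarrow> real \<Rightarrow> real" where
  "airy_neg y l = indicator {..<0} l * Ai (y - l)"

lemma airy_neg_measurable [measurable (raw)]:
  assumes [measurable]: "f \<in> borel_measurable M" "g \<in> borel_measurable M"
  shows "(\<lambda>z. airy_neg (f z) (g z)) \<in> borel_measurable M"
  unfolding airy_neg_def by measurable

lemma airy_neg_le: "1 \<le> a \<Longrightarrow> \<bar>airy_neg y l\<bar> \<le> airy_const a * exp (- a * y) * exp_half l"
proof (cases "l < 0")
  case True
  assume a: "1 \<le> a"
  have "\<bar>Ai (y - l)\<bar> \<le> airy_const a * exp (- a * (y - l))" by (rule Ai_exp_bound) (use a in simp)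
  also have "\<dots> = airy_const a * exp (- a * y) * exp (a * l)" by (simp add: algebra_simps flip: exp_add)
  also have "\<dots> \<le> airy_const a * exp (- a * y) * exp l"
    using a True airy_const_pos[of a] by (intro mult_left_mono) auto
  finally show ?thesis using True by (simp add: airy_neg_def exp_half_def)
qed (simp add: airy_neg_def exp_half_def)

lemma isCont_airy_neg: "l < 0 \<Longrightarrow> isCont (airy_neg y) l"
proof -
  assume l: "l < 0"
  have "continuous_on {..<0} (\<lambda>l. Ai (y - l))"
    by (intro continuous_on_compose2[OF continuous_Ai] continuous_intros) auto
  moreover have "continuous_on {..<0} (airy_neg y) \<longleftrightarrow> continuous_on {..<0} (\<lambda>l. Ai (y - l))"
    by (rule continuous_on_cong) (auto simp: airy_neg_def)
  ultimately show ?thesis using l by (simp add: continuous_on_eq_continuous_at)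
qed

lemma airy_transform_airy_neg_commute: "airy_transform (airy_neg y) x = airy_transform (airy_neg x) y"
  by (simp add: airy_transform_def airy_neg_def mult_ac)

lemma K_Ai_eq: "K_Ai x y = airy_transform (airy_neg y) x"
  unfolding K_Ai_def airy_transform_def set_lebesgue_integral_def
proof (rule integral_cong_AE)
  show "AE l in lborel. indicator {..0} l *\<^sub>R (Ai (x - l) * Ai (y - l)) = Ai (x - l) * airy_neg y l"
    using AE_lborel_singleton[of 0] by eventually_elim (auto simp: airy_neg_def split: split_indicator)
qed measurable

text \<open>By symmetry \<open>K_Ai x\<close> is the Airy transform of \<open>airy_neg x\<close>, so
  the isometry turns the integral over \<open>y\<close> into one over \<open>l < 0\<close>.\<close>

lemma
  shows integrable_K_Ai_K_Ai: "integrable lborel (\<lambda>y. K_Ai x y * K_Ai z y)"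
    and integral_K_Ai_K_Ai: "(LBINT y. K_Ai x y * K_Ai z y) = K_Ai x z"
proof -
  have m: "airy_neg x \<in> borel_measurable borel" for x by measurable
  have le: "\<bar>airy_neg x l\<bar> \<le> airy_const 1 * exp (- 1 * x) * exp_half l" for x l by (rule airy_neg_le) simp
  note iso = airy_transform_isometry[OF m le m le isCont_airy_neg, of x z]
  have eq: "(\<lambda>y. K_Ai x y * K_Ai z y) = (\<lambda>y. airy_transform (airy_neg x) y * airy_transform (airy_neg z) y)"
    by (simp add: K_Ai_eq airy_transform_airy_neg_commute[of _ x] airy_transform_airy_neg_commute[of _ z])
  show "integrable lborel (\<lambda>y. K_Ai x y * K_Ai z y)" unfolding eq by (rule iso(1)) simp
  have "(LBINT l. airy_neg x l * airy_neg z l) = airy_transform (airy_neg z) x"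
    unfolding airy_transform_def by (intro Bochner_Integration.integral_cong) (auto simp: airy_neg_def split: split_indicator)
  then show "(LBINT y. K_Ai x y * K_Ai z y) = K_Ai x z" unfolding eq using iso(2) by (simp add: K_Ai_eq)
qed

text \<open>For fixed \<open>y\<close> the transform is square integrable in \<open>x\<close>, with
  and without the weight \<open>exp (2 * x)\<close>, and Tonelli's theorem exchanges the integrals.
  So \<open>n\<close> is the partial norm of a Hilbert-Schmidt kernel. The weight leaves room for
  the factors \<open>exp (e n * x / 2)\<close> that are inserted when the Airy transform is brought
  back.\<close>

lemma weighted_airy_transform_norm:
  fixes k :: "real \<Rightarrow> real \<Rightarrow> real" and w \<beta> :: "real \<Rightarrow> real"
  assumes k [measurable]: "case_prod k \<in> borel_measurable (borel \<Otimes>\<^sub>M borel)"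
    and [measurable]: "w \<in> borel_measurable borel" "\<beta> \<in> borel_measurable borel"
    and k_le: "\<And>l y. \<bar>k l y\<bar> \<le> \<beta> y * exp_half l" and w: "\<And>y. 0 \<le> w y"
    and int: "integrable lborel (\<lambda>y. w y * (\<beta> y)\<^sup>2)"
  defines "n \<equiv> \<lambda>x. LBINT y. w y * (airy_transform (\<lambda>l. k l y) x)\<^sup>2"
  shows "integrable lborel (\<lambda>y. w y * (airy_transform (\<lambda>l. k l y) x)\<^sup>2)"
    and "n \<in> borel_measurable borel" and "\<And>x. 0 \<le> n x"
    and "integrable lborel (\<lambda>x. (1 + exp (2 * x)) * n x)"
proof -
  have km: "(\<lambda>l. k l y) \<in> borel_measurable borel" for y by measurable
  have sw: "(\<lambda>(y, l). k l y) \<in> borel_measurable (borel \<Otimes>\<^sub>M borel)" by measurable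
  have [measurable]: "(\<lambda>z. airy_transform (\<lambda>l. k l (fst z)) (snd z)) \<in> borel_measurable (borel \<Otimes>\<^sub>M borel)"
    "(\<lambda>z. airy_transform (\<lambda>l. k l (snd z)) (fst z)) \<in> borel_measurable (borel \<Otimes>\<^sub>M borel)"
    by measurable
  have [measurable]: "(\<lambda>y. airy_transform (\<lambda>l. k l y) x) \<in> borel_measurable borel" for x by measurable
  have \<beta>: "0 \<le> \<beta> y" for y by (rule half_line_bound_nonneg[OF km k_le])
  show i: "integrable lborel (\<lambda>y. w y * (airy_transform (\<lambda>l. k l y) x)\<^sup>2)" for x
  proof (rule integrable_dominated[where g = "\<lambda>y. (airy_env 1 x * exp_half_mass)\<^sup>2 * (w y * (\<beta> y)\<^sup>2)"])
    show "norm (w y * (airy_transform (\<lambda>l. k l y) x)\<^sup>2) \<le> (airy_env 1 x * exp_half_mass)\<^sup>2 * (w y * (\<beta> y)\<^sup>2)" for y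
    proof -
      have "\<bar>airy_transform (\<lambda>l. k l y) x\<bar>\<^sup>2 \<le> (airy_env 1 x * (\<beta> y * exp_half_mass))\<^sup>2"
        by (intro power_mono abs_airy_transform_le[OF km k_le]) auto
      from mult_left_mono[OF this w[of y]] show ?thesis using w[of y] by (simp add: power_mult_distrib mult_ac)
    qed
  qed (use int in auto)
  show [measurable]: "n \<in> borel_measurable borel" unfolding n_def by measurable
  show n0: "0 \<le> n x" for x unfolding n_def using w by (intro Bochner_Integration.integral_nonneg) auto
  show "integrable lborel (\<lambda>x. (1 + exp (2 * x)) * n x)"
  proof (rule integrableI_nonneg)
    have "(\<integral>\<^sup>+x. ennreal ((1 + exp (2 * x)) * n x) \<partial>lborel)
        = (\<integral>\<^sup>+x. (\<integral>\<^sup>+y. ennreal ((1 + exp (2 * x)) * (w y * (airy_transform (\<lambda>l. k l y) x)\<^sup>2)) \<partial>lborel) \<partial>lborel)"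
    proof (intro nn_integral_cong)
      fix x
      have "ennreal ((1 + exp (2 * x)) * n x) = ennreal (LBINT y. (1 + exp (2 * x)) * (w y * (airy_transform (\<lambda>l. k l y) x)\<^sup>2))"
        by (simp add: n_def)
      also have "\<dots> = (\<integral>\<^sup>+y. ennreal ((1 + exp (2 * x)) * (w y * (airy_transform (\<lambda>l. k l y) x)\<^sup>2)) \<partial>lborel)"
        using i w by (intro nn_integral_eq_integral[symmetric] integrable_mult_right) (auto intro!: AE_I2 mult_nonneg_nonneg add_nonneg_nonneg)
      finally show "ennreal ((1 + exp (2 * x)) * n x) = \<dots>" .
    qed
    also have "\<dots> = (\<integral>\<^sup>+y. (\<integral>\<^sup>+x. ennreal ((1 + exp (2 * x)) * (w y * (airy_transform (\<lambda>l. k l y) x)\<^sup>2)) \<partial>lborel) \<partial>lborel)"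
      by (rule lborel_pair.Fubini'[symmetric]) measurable
    also have "\<dots> \<le> (\<integral>\<^sup>+y. ennreal (2 * plancherel_const * (w y * (\<beta> y)\<^sup>2)) \<partial>lborel)"
    proof (intro nn_integral_mono)
      fix y
      have [measurable]: "airy_transform (\<lambda>l. k l y) \<in> borel_measurable borel" by measurable
      have "(\<integral>\<^sup>+x. ennreal ((1 + exp (2 * x)) * (w y * (airy_transform (\<lambda>l. k l y) x)\<^sup>2)) \<partial>lborel)
         = (\<integral>\<^sup>+x. ennreal (w y) * (ennreal ((airy_transform (\<lambda>l. k l y) x)\<^sup>2) + ennreal (exp (2 * x) * (airy_transform (\<lambda>l. k l y) x)\<^sup>2)) \<partial>lborel)"
        using w[of y] by (intro nn_integral_cong) (auto simp: algebra_simps simp flip: ennreal_mult ennreal_plus)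
      also have "\<dots> = ennreal (w y) * ((\<integral>\<^sup>+x. ennreal ((airy_transform (\<lambda>l. k l y) x)\<^sup>2) \<partial>lborel) + (\<integral>\<^sup>+x. ennreal (exp (2 * x) * (airy_transform (\<lambda>l. k l y) x)\<^sup>2) \<partial>lborel))"
        by (simp add: nn_integral_cmult nn_integral_add)
      also have "\<dots> \<le> ennreal (w y) * (ennreal (plancherel_const * (\<beta> y)\<^sup>2) + ennreal (plancherel_const * (\<beta> y)\<^sup>2))"
        by (intro mult_left_mono add_mono airy_transform_square_le[OF km k_le] airy_transform_square_exp_le[OF km k_le]) auto
      also have "\<dots> = ennreal (2 * plancherel_const * (w y * (\<beta> y)\<^sup>2))"
        using w[of y] exp_half_mass_nonneg by (simp add: plancherel_const_def mult_ac flip: ennreal_mult ennreal_plus)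
      finally show "(\<integral>\<^sup>+x. ennreal ((1 + exp (2 * x)) * (w y * (airy_transform (\<lambda>l. k l y) x)\<^sup>2)) \<partial>lborel) \<le> \<dots>" .
    qed
    also have "\<dots> < \<infinity>"
      using integrable_mult_right[OF int, of "2 * plancherel_const"]
      by (subst nn_integral_eq_integral) (auto intro!: AE_I2 mult_nonneg_nonneg w exp_half_mass_nonneg simp: plancherel_const_def)
    finally show "(\<integral>\<^sup>+x. ennreal ((1 + exp (2 * x)) * n x) \<partial>lborel) < \<infinity>" .
  qed (use n0 in \<open>auto intro!: AE_I2 mult_nonneg_nonneg add_nonneg_nonneg\<close>)
qed

text \<open>\<open>hm\<close> and \<open>hp\<close> are the hitting terms of \<open>\<Psi>\<^sup>-\<close> and \<open>\<Psi>\<^sup>+\<close>, cut off to \<open>l < 0\<close>. A path that starts above the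
  barrier hits it at time 0, so that one of \<open>\<Psi>\<^sup>-\<close> and \<open>\<Psi>\<^sup>+\<close> vanishes there and the cut-off \<open>y < g(0)\<close> is automatic.\<close>

locale scattering_pair =
  fixes hm hp :: "real \<Rightarrow> real \<Rightarrow> real" and C :: real
  assumes hm [measurable]: "case_prod hm \<in> borel_measurable (borel \<Otimes>\<^sub>M borel)"
    and hp [measurable]: "case_prod hp \<in> borel_measurable (borel \<Otimes>\<^sub>M borel)"
    and hm_le: "\<And>l y. \<bar>hm l y\<bar> \<le> C * exp (- 2 * \<bar>y\<bar>) * exp_half l"
    and hp_le: "\<And>l y. \<bar>hp l y\<bar> \<le> C * exp (- 2 * \<bar>y\<bar>) * exp_half l"
begin

lemma C_nonneg: "0 \<le> C"
proof -
  have "0 \<le> C * exp (- 2 * \<bar>0\<bar>)" by (rule half_line_bound_nonneg[OF _ hm_le]) measurable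
  then show ?thesis by simp
qed

definition Hm :: "real \<Rightarrow> real \<Rightarrow> real" where "Hm x y = airy_transform (\<lambda>l. hm l y) x"
definition Hp :: "real \<Rightarrow> real \<Rightarrow> real" where "Hp x y = airy_transform (\<lambda>l. hp l y) x"

text \<open>Equal to \<open>airy_neg y l * airy_neg y m - (airy_neg y l - hm l y) * (airy_neg y m -
  hp m y)\<close>. After expansion every product contains a hitting term, which decays like
  \<open>exp (- 2 * \<bar>y\<bar>)\<close>, so the integral over \<open>y\<close> converges
  absolutely.\<close>

definition deficit :: "real \<Rightarrow> real \<Rightarrow> real \<Rightarrow> real" where
  "deficit l m y = airy_neg y l * hp m y + hm l y * airy_neg y m - hm l y * hp m y"

definition half_kernel :: "real \<Rightarrow> real \<Rightarrow> real" where
  "half_kernel l m = - (LBINT y. deficit l m y)"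

definition full_kernel :: "real \<Rightarrow> real \<Rightarrow> real" where
  "full_kernel x z = - K_Ai x z + (LBINT y. (K_Ai x y - Hm x y) * (K_Ai z y - Hp z y))"

definition deficit_const :: real where
  "deficit_const = 2 * airy_const 1 * C + C\<^sup>2"

definition half_const :: real where
  "half_const = deficit_const * (LBINT y. exp (- 1 * \<bar>y\<bar>))"

lemma deficit_const_nonneg: "0 \<le> deficit_const"
  using C_nonneg airy_const_pos[of 1] by (simp add: deficit_const_def)

lemma half_const_nonneg: "0 \<le> half_const"
  unfolding half_const_def using deficit_const_nonneg by (intro mult_nonneg_nonneg Bochner_Integration.integral_nonneg) auto

lemma deficit_measurable [measurable (raw)]:
  assumes [measurable]: "f \<in> borel_measurable M" "g \<in> borel_measurable M" "h \<in> borel_measurable M"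
  shows "(\<lambda>z. deficit (f z) (g z) (h z)) \<in> borel_measurable M"
  unfolding deficit_def by measurable

lemma exp_minus_y_le: "exp (- y) * exp (- 2 * \<bar>y\<bar>) \<le> exp (- 1 * \<bar>y :: real\<bar>)"
  by (simp flip: exp_add)

lemma exp_minus_2y_le: "exp (- 2 * \<bar>y\<bar>) * exp (- 2 * \<bar>y\<bar>) \<le> exp (- 1 * \<bar>y :: real\<bar>)"
  by (simp flip: exp_add)

text \<open>Stated for numbers, because the same three products occur with the Airy transform
  applied in none, one or both of the spectral variables.\<close>

lemma products_le:
  assumes "\<bar>k\<bar> \<le> airy_const 1 * exp (- y) * p" "\<bar>k'\<bar> \<le> airy_const 1 * exp (- y) * q"
    and "\<bar>a\<bar> \<le> C * exp (- 2 * \<bar>y\<bar>) * p" "\<bar>b\<bar> \<le> C * exp (- 2 * \<bar>y\<bar>) * q"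
    and "0 \<le> p" "0 \<le> q"
  shows "\<bar>k * b + a * k' - a * b\<bar> \<le> deficit_const * exp (- 1 * \<bar>y\<bar>) * (p * q)"
proof -
  have A: "0 \<le> airy_const 1" using airy_const_pos[of 1] by simp
  have "\<bar>k * b\<bar> \<le> (airy_const 1 * exp (- y) * p) * (C * exp (- 2 * \<bar>y\<bar>) * q)"
    unfolding abs_mult using assms A C_nonneg by (intro mult_mono) auto
  also have "\<dots> = airy_const 1 * C * (p * q) * (exp (- y) * exp (- 2 * \<bar>y\<bar>))" by (simp add: mult_ac)
  also have "\<dots> \<le> airy_const 1 * C * (p * q) * exp (- 1 * \<bar>y\<bar>)"
    using assms A C_nonneg by (intro mult_left_mono exp_minus_y_le) auto
  finally have 1: "\<bar>k * b\<bar> \<le> airy_const 1 * C * (p * q) * exp (- 1 * \<bar>y\<bar>)" .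
  have "\<bar>a * k'\<bar> \<le> (C * exp (- 2 * \<bar>y\<bar>) * p) * (airy_const 1 * exp (- y) * q)"
    unfolding abs_mult using assms A C_nonneg by (intro mult_mono) auto
  also have "\<dots> = airy_const 1 * C * (p * q) * (exp (- y) * exp (- 2 * \<bar>y\<bar>))" by (simp add: mult_ac)
  also have "\<dots> \<le> airy_const 1 * C * (p * q) * exp (- 1 * \<bar>y\<bar>)"
    using assms A C_nonneg by (intro mult_left_mono exp_minus_y_le) auto
  finally have 2: "\<bar>a * k'\<bar> \<le> airy_const 1 * C * (p * q) * exp (- 1 * \<bar>y\<bar>)" .
  have "\<bar>a * b\<bar> \<le> (C * exp (- 2 * \<bar>y\<bar>) * p) * (C * exp (- 2 * \<bar>y\<bar>) * q)"
    unfolding abs_mult using assms C_nonneg by (intro mult_mono) auto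
  also have "\<dots> = C\<^sup>2 * (p * q) * (exp (- 2 * \<bar>y\<bar>) * exp (- 2 * \<bar>y\<bar>))" by (simp add: power2_eq_square mult_ac)
  also have "\<dots> \<le> C\<^sup>2 * (p * q) * exp (- 1 * \<bar>y\<bar>)"
    using assms by (intro mult_left_mono exp_minus_2y_le) auto
  finally have 3: "\<bar>a * b\<bar> \<le> C\<^sup>2 * (p * q) * exp (- 1 * \<bar>y\<bar>)" .
  have "deficit_const * exp (- 1 * \<bar>y\<bar>) * (p * q)
    = airy_const 1 * C * (p * q) * exp (- 1 * \<bar>y\<bar>) + airy_const 1 * C * (p * q) * exp (- 1 * \<bar>y\<bar>) + C\<^sup>2 * (p * q) * exp (- 1 * \<bar>y\<bar>)"
    by (simp add: deficit_const_def algebra_simps)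
  with 1 2 3 show ?thesis by linarith
qed

lemma deficit_le: "\<bar>deficit l m y\<bar> \<le> deficit_const * exp (- 1 * \<bar>y\<bar>) * (exp_half l * exp_half m)"
  unfolding deficit_def using airy_neg_le[of 1 y l] airy_neg_le[of 1 y m] hm_le[of l y] hp_le[of m y]
  by (intro products_le) auto

lemma integrable_deficit: "integrable lborel (deficit l m)"
  by (rule integrable_dominated[where g = "\<lambda>y. (deficit_const * (exp_half l * exp_half m)) * exp (- 1 * \<bar>y\<bar>)"])
    (use deficit_le[of l m] integrable_exp_abs[of 1] in \<open>auto simp: mult_ac\<close>)

lemma half_kernel_measurable [measurable]: "case_prod half_kernel \<in> borel_measurable (borel \<Otimes>\<^sub>M borel)"
  unfolding half_kernel_def by measurable

lemma half_kernel_le: "\<bar>half_kernel l m\<bar> \<le> (half_const * exp_half l) * exp_half m"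
proof -
  have "norm (LBINT y. deficit l m y) \<le> (LBINT y. (deficit_const * (exp_half l * exp_half m)) * exp (- 1 * \<bar>y\<bar>))"
    by (rule norm_integral_dominated) (use deficit_le[of l m] integrable_exp_abs[of 1] in \<open>auto simp: mult_ac\<close>)
  then show ?thesis
    by (simp only: integral_mult_right_zero half_kernel_def half_const_def real_norm_def abs_minus_cancel) (simp add: mult_ac)
qed

lemma half_kernel_row_measurable [measurable]: "half_kernel l \<in> borel_measurable borel"
  by measurable

text \<open>Continuity in the second variable makes the smeared kernels converge at every
  \<open>m < 0\<close>, as the limit theorem for determinants demands.\<close>

lemma half_kernel_cont:
  assumes hp_cont: "\<And>y m. m < 0 \<Longrightarrow> isCont (\<lambda>m. hp m y) m" and m: "m < 0"
  shows "isCont (half_kernel l) m"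
proof -
  have "((\<lambda>n. LBINT y. deficit l n y) \<longlongrightarrow> (LBINT y. deficit l m y)) (at m)"
  proof (rule tendsto_at_iff_sequentially[THEN iffD2], intro allI impI)
    fix X :: "nat \<Rightarrow> real" assume X: "X \<longlonglongrightarrow> m"
    show "((\<lambda>n. LBINT y. deficit l n y) \<circ> X) \<longlonglongrightarrow> (LBINT y. deficit l m y)"
      unfolding o_def
    proof (rule integral_dominated_convergence[where w = "\<lambda>y. (deficit_const * exp_half l) * exp (- 1 * \<bar>y\<bar>)"])
      show "AE y in lborel. (\<lambda>i. deficit l (X i) y) \<longlonglongrightarrow> deficit l m y"
        unfolding deficit_def
        by (intro AE_I2 tendsto_intros isCont_tendsto_compose[OF hp_cont[OF m] X] isCont_tendsto_compose[OF isCont_airy_neg[OF m] X])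
      show "AE y in lborel. norm (deficit l (X i) y) \<le> (deficit_const * exp_half l) * exp (- 1 * \<bar>y\<bar>)" for i
      proof (intro AE_I2)
        fix y
        have "\<bar>deficit l (X i) y\<bar> \<le> deficit_const * exp (- 1 * \<bar>y\<bar>) * (exp_half l * 1)"
          using deficit_const_nonneg exp_half_le_1[of "X i"]
          by (intro order_trans[OF deficit_le] mult_left_mono) auto
        then show "norm (deficit l (X i) y) \<le> (deficit_const * exp_half l) * exp (- 1 * \<bar>y\<bar>)" by (simp add: mult_ac)
      qed
      show "integrable lborel (\<lambda>y. (deficit_const * exp_half l) * exp (- 1 * \<bar>y\<bar>))"
        using integrable_exp_abs[of 1] by (intro integrable_mult_right) auto
    qed measurable
  qed
  then show ?thesis unfolding isCont_def half_kernel_def by (intro tendsto_minus)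
qed

lemma hm_row: "(\<lambda>l. hm l y) \<in> borel_measurable borel" and hp_row: "(\<lambda>l. hp l y) \<in> borel_measurable borel"
  by measurable

lemma airy_neg_row: "airy_neg y \<in> borel_measurable borel"
  by measurable

lemma airy_neg_le_1: "\<bar>airy_neg y l\<bar> \<le> airy_const 1 * exp (- y) * exp_half l"
  using airy_neg_le[of 1 y l] by simp

lemma Hm_measurable [measurable (raw)]:
  assumes [measurable]: "f \<in> borel_measurable M" "g \<in> borel_measurable M"
  shows "(\<lambda>z. Hm (f z) (g z)) \<in> borel_measurable M"
  unfolding Hm_def by measurable

lemma Hp_measurable [measurable (raw)]:
  assumes [measurable]: "f \<in> borel_measurable M" "g \<in> borel_measurable M"
  shows "(\<lambda>z. Hp (f z) (g z)) \<in> borel_measurable M"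
  unfolding Hp_def by measurable

lemma K_Ai_measurable [measurable (raw)]:
  assumes [measurable]: "f \<in> borel_measurable M" "g \<in> borel_measurable M"
  shows "(\<lambda>z. K_Ai (f z) (g z)) \<in> borel_measurable M"
  unfolding K_Ai_eq by measurable

lemma K_Ai_le: "\<bar>K_Ai x y\<bar> \<le> airy_const 1 * exp (- y) * (airy_env 1 x * exp_half_mass)"
  using abs_airy_transform_le[OF airy_neg_row airy_neg_le_1, of 1 y x] by (simp add: K_Ai_eq mult_ac)

lemma Hm_le: "\<bar>Hm x y\<bar> \<le> C * exp (- 2 * \<bar>y\<bar>) * (airy_env 1 x * exp_half_mass)"
  using abs_airy_transform_le[OF hm_row hm_le, of 1 y x] by (simp add: Hm_def mult_ac)

lemma Hp_le: "\<bar>Hp x y\<bar> \<le> C * exp (- 2 * \<bar>y\<bar>) * (airy_env 1 x * exp_half_mass)"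
  using abs_airy_transform_le[OF hp_row hp_le, of 1 y x] by (simp add: Hp_def mult_ac)

lemma env_mass_nonneg: "0 \<le> airy_env 1 x * exp_half_mass"
  using airy_env_nonneg[of 1 x] exp_half_mass_nonneg by simp

lemma airy_transform_half_kernel:
  "airy_transform (half_kernel l) z = - (LBINT y. airy_neg y l * Hp z y + hm l y * K_Ai z y - hm l y * Hp z y)"
proof -
  have "airy_transform (half_kernel l) z = - (LBINT m. (LBINT y. Ai (z - m) * deficit l m y))"
    by (simp add: airy_transform_def half_kernel_def)
  also have "(LBINT m. (LBINT y. Ai (z - m) * deficit l m y)) = (LBINT y. (LBINT m. Ai (z - m) * deficit l m y))"
  proof (rule Fubini_dominated[OF lborel_pair_sigma_finite])
    show "integrable lborel (\<lambda>m. airy_env 1 z * (exp_half l * exp_half m))" using integrable_exp_half by simp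
    show "integrable lborel (\<lambda>y. deficit_const * exp (- 1 * \<bar>y\<bar>))" using integrable_exp_abs[of 1] by (intro integrable_mult_right) auto
    show "norm (Ai (z - m) * deficit l m y) \<le> airy_env 1 z * (exp_half l * exp_half m) * (deficit_const * exp (- 1 * \<bar>y\<bar>))" for m y
    proof -
      have "\<bar>Ai (z - m) * deficit l m y\<bar> \<le> airy_env 1 z * (deficit_const * exp (- 1 * \<bar>y\<bar>) * exp_half l * exp_half m)"
        by (rule airy_transform_integrand_le[where f = "\<lambda>m. deficit l m y"]) (use deficit_le[of l _ y] in \<open>auto simp: mult_ac\<close>)
      then show ?thesis by (simp add: mult_ac)
    qed
  qed measurable
  also have "\<dots> = (LBINT y. airy_neg y l * Hp z y + hm l y * K_Ai z y - hm l y * Hp z y)"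
  proof (intro Bochner_Integration.integral_cong refl)
    fix y
    have "(LBINT m. Ai (z - m) * deficit l m y)
       = (LBINT m. airy_neg y l * (Ai (z - m) * hp m y) + hm l y * (Ai (z - m) * airy_neg y m) - hm l y * (Ai (z - m) * hp m y))"
      by (simp add: deficit_def algebra_simps)
    also have "\<dots> = airy_neg y l * Hp z y + hm l y * K_Ai z y - hm l y * Hp z y"
      unfolding Hp_def K_Ai_eq airy_transform_def
      using integrable_airy_transform[OF hp_row hp_le, of z y] integrable_airy_transform[OF airy_neg_row airy_neg_le_1, of z y]
      by simp
    finally show "(LBINT m. Ai (z - m) * deficit l m y) = airy_neg y l * Hp z y + hm l y * K_Ai z y - hm l y * Hp z y" .
  qed
  finally show ?thesis .
qed

lemma integrable_cross: "integrable lborel (\<lambda>y. K_Ai x y * Hp z y + Hm x y * K_Ai z y - Hm x y * Hp z y)"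
proof (rule integrable_dominated[where g = "\<lambda>y. (deficit_const * ((airy_env 1 x * exp_half_mass) * (airy_env 1 z * exp_half_mass))) * exp (- 1 * \<bar>y\<bar>)"])
  show "norm (K_Ai x y * Hp z y + Hm x y * K_Ai z y - Hm x y * Hp z y)
     \<le> (deficit_const * ((airy_env 1 x * exp_half_mass) * (airy_env 1 z * exp_half_mass))) * exp (- 1 * \<bar>y\<bar>)" for y
    using products_le[OF K_Ai_le[of x y] K_Ai_le[of z y] Hm_le[of x y] Hp_le[of z y] env_mass_nonneg env_mass_nonneg]
    by (simp add: mult_ac)
qed (use integrable_exp_abs[of 1] in auto)

text \<open>The product of the two factors \<open>K_Ai\<close> integrates to
  \<open>K_Ai x z\<close>, which cancels the leading term; the remaining products all contain a
  hitting term.\<close>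

lemma full_kernel_eq_cross: "full_kernel x z = - (LBINT y. K_Ai x y * Hp z y + Hm x y * K_Ai z y - Hm x y * Hp z y)"
proof -
  have "(LBINT y. (K_Ai x y - Hm x y) * (K_Ai z y - Hp z y))
     = (LBINT y. K_Ai x y * K_Ai z y - (K_Ai x y * Hp z y + Hm x y * K_Ai z y - Hm x y * Hp z y))"
    by (simp add: algebra_simps)
  also have "\<dots> = K_Ai x z - (LBINT y. K_Ai x y * Hp z y + Hm x y * K_Ai z y - Hm x y * Hp z y)"
    by (subst Bochner_Integration.integral_diff[OF integrable_K_Ai_K_Ai integrable_cross]) (simp add: integral_K_Ai_K_Ai)
  finally show ?thesis by (simp add: full_kernel_def)
qed

lemma full_kernel_eq_airy_transform: "full_kernel x z = (LBINT l. Ai (x - l) * airy_transform (half_kernel l) z)"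
proof -
  let ?r = "\<lambda>l y. airy_neg y l * Hp z y + hm l y * K_Ai z y - hm l y * Hp z y"
  have r_le: "\<bar>?r l y\<bar> \<le> deficit_const * exp (- 1 * \<bar>y\<bar>) * (airy_env 1 z * exp_half_mass) * exp_half l" for l y
    using products_le[OF airy_neg_le_1[of y l] K_Ai_le[of z y] hm_le[of l y] Hp_le[of z y] _ env_mass_nonneg] by (simp add: mult_ac)
  have "(LBINT l. Ai (x - l) * airy_transform (half_kernel l) z) = - (LBINT l. (LBINT y. Ai (x - l) * ?r l y))"
    by (simp add: airy_transform_half_kernel)
  also have "(LBINT l. (LBINT y. Ai (x - l) * ?r l y)) = (LBINT y. (LBINT l. Ai (x - l) * ?r l y))"
  proof (rule Fubini_dominated[OF lborel_pair_sigma_finite])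
    show "integrable lborel (\<lambda>l. airy_env 1 x * exp_half l)" using integrable_exp_half by simp
    show "integrable lborel (\<lambda>y. (deficit_const * (airy_env 1 z * exp_half_mass)) * exp (- 1 * \<bar>y\<bar>))"
      using integrable_exp_abs[of 1] by (intro integrable_mult_right) auto
    show "norm (Ai (x - l) * ?r l y) \<le> airy_env 1 x * exp_half l * ((deficit_const * (airy_env 1 z * exp_half_mass)) * exp (- 1 * \<bar>y\<bar>))" for l y
      using airy_transform_integrand_le[where f = "\<lambda>l. ?r l y", OF _ r_le, of 1 x l] by (simp add: mult_ac)
  qed measurable
  also have "\<dots> = (LBINT y. K_Ai x y * Hp z y + Hm x y * K_Ai z y - Hm x y * Hp z y)"
  proof (intro Bochner_Integration.integral_cong refl)
    fix y
    have "(LBINT l. Ai (x - l) * ?r l y)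
       = (LBINT l. Hp z y * (Ai (x - l) * airy_neg y l) + K_Ai z y * (Ai (x - l) * hm l y) - Hp z y * (Ai (x - l) * hm l y))"
      by (simp add: algebra_simps)
    also have "\<dots> = Hp z y * K_Ai x y + K_Ai z y * Hm x y - Hp z y * Hm x y"
      unfolding Hm_def K_Ai_eq airy_transform_def
      using integrable_airy_transform[OF hm_row hm_le, of x y] integrable_airy_transform[OF airy_neg_row airy_neg_le_1, of x y]
      by simp
    finally show "(LBINT l. Ai (x - l) * ?r l y) = K_Ai x y * Hp z y + Hm x y * K_Ai z y - Hm x y * Hp z y" by (simp add: mult_ac)
  qed
  finally show ?thesis by (simp add: full_kernel_eq_cross)
qed

lemma full_kernel_measurable: "case_prod full_kernel \<in> borel_measurable (borel \<Otimes>\<^sub>M borel)"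
  unfolding full_kernel_def by measurable

text \<open>Cauchy-Schwarz in \<open>y\<close> with the weights \<open>exp (3 * y)\<close> and
  \<open>exp (- 3 * y)\<close> separates \<open>x\<close> from \<open>z\<close>. The factor
  \<open>K_Ai\<close> takes \<open>exp (3 * y)\<close>: the rates 1 and 2 of its bound leave the
  exponents \<open>y\<close> and \<open>- y\<close> after squaring. The hitting terms decay at rate
  4 after squaring and take either weight.\<close>

lemma full_kernel_dominated:
  obtains a b where "\<And>x z. \<bar>full_kernel x z\<bar> \<le> a x * b z" "\<And>x. 0 \<le> a x" "\<And>x. 0 \<le> b x"
    "a \<in> borel_measurable borel" "b \<in> borel_measurable borel"
    "integrable lborel (\<lambda>x. (1 + exp (2 * x)) * (a x)\<^sup>2)" "integrable lborel (\<lambda>x. (1 + exp (2 * x)) * (b x)\<^sup>2)"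
proof -
  let ?\<beta>K = "\<lambda>y. min (airy_const 1 * exp (- y)) (airy_const 2 * exp (- 2 * y))"
  let ?\<beta>H = "\<lambda>y. C * exp (- 2 * \<bar>y\<bar>)"
  let ?u = "\<lambda>y::real. exp (3 * y)" and ?v = "\<lambda>y::real. exp (- 3 * y)"
  have K: "\<bar>airy_neg y l\<bar> \<le> ?\<beta>K y * exp_half l" for l y
    using airy_neg_le[of 1 y l] airy_neg_le[of 2 y l] by (auto simp: min_def)
  have iK: "integrable lborel (\<lambda>y. ?u y * (?\<beta>K y)\<^sup>2)"
  proof (rule integrable_exp_bound)
    have *: "norm (?u y * (?\<beta>K y)\<^sup>2) \<le> (airy_const a)\<^sup>2 * exp ((3 - 2 * a) * y)" if "a = 1 \<or> a = 2" for a y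
    proof -
      have "0 \<le> ?\<beta>K y" using airy_const_pos[of 1] airy_const_pos[of 2] by auto
      moreover have "?\<beta>K y \<le> airy_const a * exp (- a * y)" using that by auto
      ultimately have "norm (?u y * (?\<beta>K y)\<^sup>2) \<le> ?u y * (airy_const a * exp (- a * y))\<^sup>2"
        by (simp add: power_mono)
      also have "\<dots> = (airy_const a)\<^sup>2 * exp ((3 - 2 * a) * y)"
        by (simp add: power2_eq_square algebra_simps flip: exp_add)
      finally show ?thesis .
    qed
    show "norm (?u y * (?\<beta>K y)\<^sup>2) \<le> (airy_const 1)\<^sup>2 * exp (1 * y)" for y using *[of 1 y] by simp
    show "norm (?u y * (?\<beta>K y)\<^sup>2) \<le> (airy_const 2)\<^sup>2 * exp (- 1 * y)" for y using *[of 2 y] by simp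
  qed auto
  have iH: "integrable lborel (\<lambda>y. exp (s * y) * (?\<beta>H y)\<^sup>2)" if "s = 3 \<or> s = - 3" for s
  proof (rule integrable_dominated[where g = "\<lambda>y. C\<^sup>2 * exp (- 1 * \<bar>y\<bar>)"])
    show "norm (exp (s * y) * (?\<beta>H y)\<^sup>2) \<le> C\<^sup>2 * exp (- 1 * \<bar>y\<bar>)" for y
    proof -
      have "exp (s * y) * (?\<beta>H y)\<^sup>2 = C\<^sup>2 * exp (s * y - 4 * \<bar>y\<bar>)"
        by (simp add: power2_eq_square exp_diff exp_minus field_simps flip: exp_add)
      also have "\<dots> \<le> C\<^sup>2 * exp (- 1 * \<bar>y\<bar>)" using that by (intro mult_left_mono) auto
      finally show ?thesis by simp
    qed
  qed (use integrable_exp_abs[of 1] in auto)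
  have swap: "(\<lambda>(l, y). airy_neg y l) \<in> borel_measurable (borel \<Otimes>\<^sub>M borel)" by measurable
  note nK = weighted_airy_transform_norm[OF swap _ _ K _ iK, folded K_Ai_eq]
  note nHm = weighted_airy_transform_norm[OF hm _ _ hm_le _ iH, folded Hm_def]
  note nHp = weighted_airy_transform_norm[OF hp _ _ hp_le _ iH, folded Hp_def]
  define kk where "kk = (\<lambda>x. LBINT y. ?u y * (K_Ai x y)\<^sup>2)"
  define mm where "mm = (\<lambda>s x. LBINT y. exp (s * y) * (Hm x y)\<^sup>2)"
  define pp where "pp = (\<lambda>s x. LBINT y. exp (s * y) * (Hp x y)\<^sup>2)"
  have iKu: "integrable lborel (\<lambda>y. ?u y * (K_Ai x y)\<^sup>2)" for x by (rule nK(1)) auto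
  have iM: "integrable lborel (\<lambda>y. exp (s * y) * (Hm x y)\<^sup>2)" if "s = 3 \<or> s = - 3" for s x by (rule nHm(1)) (use that in auto)
  have iP: "integrable lborel (\<lambda>y. exp (s * y) * (Hp x y)\<^sup>2)" if "s = 3 \<or> s = - 3" for s x by (rule nHp(1)) (use that in auto)
  have pos: "0 \<le> kk x" "0 \<le> mm s x" "0 \<le> pp s x" for x s
    unfolding kk_def mm_def pp_def by (auto intro!: Bochner_Integration.integral_nonneg)
  have [measurable]: "kk \<in> borel_measurable borel" "mm s \<in> borel_measurable borel" "pp s \<in> borel_measurable borel" for s
    unfolding kk_def mm_def pp_def by measurable
  have wk: "integrable lborel (\<lambda>x. (1 + exp (2 * x)) * kk x)" unfolding kk_def by (rule nK(4)) auto
  have wm: "integrable lborel (\<lambda>x. (1 + exp (2 * x)) * mm s x)" if "s = 3 \<or> s = - 3" for s unfolding mm_def by (rule nHm(4)) (use that in auto)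
  have wp: "integrable lborel (\<lambda>x. (1 + exp (2 * x)) * pp s x)" if "s = 3 \<or> s = - 3" for s unfolding pp_def by (rule nHp(4)) (use that in auto)
  have cs: "integrable lborel (\<lambda>y. f y * g y)" "\<bar>LBINT y. f y * g y\<bar> \<le> sqrt (LBINT y. ?u y * (f y)\<^sup>2) * sqrt (LBINT y. ?v y * (g y)\<^sup>2)"
    if [measurable]: "f \<in> borel_measurable borel" "g \<in> borel_measurable borel"
      and "integrable lborel (\<lambda>y. ?u y * (f y)\<^sup>2)" "integrable lborel (\<lambda>y. ?v y * (g y)\<^sup>2)" for f g :: "real \<Rightarrow> real"
  proof -
    have eqs: "(exp (3 / 2 * y) * f y)\<^sup>2 = ?u y * (f y)\<^sup>2" "(exp (- (3 / 2) * y) * g y)\<^sup>2 = ?v y * (g y)\<^sup>2"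
      "(exp (3 / 2 * y) * f y) * (exp (- (3 / 2) * y) * g y) = f y * g y" for y
    proof -
      have "exp (3 / 2 * y) * exp (3 / 2 * y) = exp (3 * y)" "exp (- (3 / 2) * y) * exp (- (3 / 2) * y) = exp (- 3 * y)"
        "exp (3 / 2 * y) * exp (- (3 / 2) * y) = 1" by (simp_all flip: exp_add)
      then show "(exp (3 / 2 * y) * f y)\<^sup>2 = ?u y * (f y)\<^sup>2" "(exp (- (3 / 2) * y) * g y)\<^sup>2 = ?v y * (g y)\<^sup>2"
        "(exp (3 / 2 * y) * f y) * (exp (- (3 / 2) * y) * g y) = f y * g y"
        unfolding power_mult_distrib power2_eq_square[of "exp _"]
        by (simp_all only: mult.assoc mult.left_commute[of _ "exp _" "f y"]) (metis mult.left_commute mult.right_neutral)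
    qed
    note c = abs_integral_mult_le_sqrt[of "\<lambda>y. exp (3 / 2 * y) * f y" lborel "\<lambda>y. exp (- (3 / 2) * y) * g y", unfolded eqs]
    show "integrable lborel (\<lambda>y. f y * g y)" "\<bar>LBINT y. f y * g y\<bar> \<le> sqrt (LBINT y. ?u y * (f y)\<^sup>2) * sqrt (LBINT y. ?v y * (g y)\<^sup>2)"
      by (rule c; use that in measurable)+
  qed
  \<comment> \<open>The factor 3 counts the three products. \<open>Hm\<close> occurs with both
    weights, since it is paired with \<open>K_Ai\<close> in one product and with \<open>Hp\<close>
    in another.\<close>
  define a where "a = (\<lambda>x. 3 * sqrt (kk x + mm 3 x + mm (- 3) x))"
  define b where "b = (\<lambda>x. sqrt (kk x + pp (- 3) x))"
  show ?thesis
  proof (rule that[of a b])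
    fix x z
    have m: "K_Ai x \<in> borel_measurable borel" "Hm x \<in> borel_measurable borel" "Hp x \<in> borel_measurable borel" for x by measurable
    note 1 = cs[OF m(1)[of x] m(3)[of z] iKu iP[of "-3"]] and 2 = cs[OF m(1)[of z] m(2)[of x] iKu iM[of "-3"]]
      and 3 = cs[OF m(2)[of x] m(3)[of z] iM[of 3] iP[of "-3"]]
    have "full_kernel x z = - ((LBINT y. K_Ai x y * Hp z y) + (LBINT y. K_Ai z y * Hm x y) - (LBINT y. Hm x y * Hp z y))"
      unfolding full_kernel_eq_cross using 1(1) 2(1) 3(1) by (simp add: mult.commute[of "Hm x _" "K_Ai z _"])
    then have "\<bar>full_kernel x z\<bar> \<le> \<bar>LBINT y. K_Ai x y * Hp z y\<bar> + \<bar>LBINT y. K_Ai z y * Hm x y\<bar> + \<bar>LBINT y. Hm x y * Hp z y\<bar>"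
      by linarith
    also have "\<dots> \<le> sqrt (kk x) * sqrt (pp (- 3) z) + sqrt (kk z) * sqrt (mm (- 3) x) + sqrt (mm 3 x) * sqrt (pp (- 3) z)"
      unfolding kk_def mm_def pp_def by (intro add_mono 1(2) 2(2) 3(2)) auto
    also have "\<dots> \<le> sqrt (kk x + mm 3 x + mm (- 3) x) * sqrt (kk z + pp (- 3) z) + sqrt (kk z + pp (- 3) z) * sqrt (kk x + mm 3 x + mm (- 3) x)
        + sqrt (kk x + mm 3 x + mm (- 3) x) * sqrt (kk z + pp (- 3) z)"
      using pos by (intro add_mono mult_mono real_sqrt_le_mono) auto
    also have "\<dots> = a x * b z" by (simp add: a_def b_def)
    finally show "\<bar>full_kernel x z\<bar> \<le> a x * b z" .
  next
    have "(1 + exp (2 * x)) * (a x)\<^sup>2 = 9 * ((1 + exp (2 * x)) * kk x + (1 + exp (2 * x)) * mm 3 x + (1 + exp (2 * x)) * mm (- 3) x)" for x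
      using pos by (simp add: a_def power_mult_distrib algebra_simps)
    then show "integrable lborel (\<lambda>x. (1 + exp (2 * x)) * (a x)\<^sup>2)"
      using wk wm by (simp only:) (intro integrable_mult_right Bochner_Integration.integrable_add; simp)
    have "(1 + exp (2 * x)) * (b x)\<^sup>2 = (1 + exp (2 * x)) * kk x + (1 + exp (2 * x)) * pp (- 3) x" for x
      using pos by (simp add: b_def algebra_simps)
    then show "integrable lborel (\<lambda>x. (1 + exp (2 * x)) * (b x)\<^sup>2)"
      using wk wp by (simp only:) (intro Bochner_Integration.integrable_add; simp)
  qed (use pos in \<open>auto simp: a_def b_def\<close>)
qed

text \<open>The kernel \<open>A M A\<^sup>*\<close> is not a product of two Hilbert-Schmidt kernels \<open>A M\<close> and \<open>A\<^sup>*\<close>, so the identity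
  \<open>det (I + A M A\<^sup>*) = det (I + M A\<^sup>* A)\<close> is applied with the weight \<open>exp (e x / 2)\<close> on both sides, which turns
  \<open>A\<^sup>* A = I\<close> into a Gaussian approximation of the identity, and \<open>e\<close> tends to 0.\<close>

theorem fredholm_det_full_kernel:
  assumes hp_cont: "\<And>y m. m < 0 \<Longrightarrow> isCont (\<lambda>m. hp m y) m"
    and det: "has_fredholm_det half_kernel d"
  shows "has_fredholm_det full_kernel d"
proof -
  define e where "e = (\<lambda>n. 1 / real (Suc n))"
  have e: "e \<longlonglongrightarrow> 0" "\<And>n. 0 < e n" "\<And>n. e n \<le> 1" "\<And>n. e n \<le> 2"
    using inverse_Suc_seq unfolding e_def by (auto simp: field_simps)
  \<comment> \<open>\<open>S n\<close> is the half-line kernel followed by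
    \<open>smear (e n)\<close>, and \<open>T n\<close> is the full kernel with an exponential weight
    on both sides. The cyclic exchange shows that they share the determinant
    \<open>\<delta> n\<close>, whose limit is then computed twice.\<close>
  define S where "S = (\<lambda>n l m. indicator {..<0} m * (LBINT k. half_kernel l k * smear (e n) m k))"
  define T where "T = (\<lambda>n x z. exp (e n * x / 2) * full_kernel x z * exp (e n * z / 2))"
  have [measurable]: "case_prod full_kernel \<in> borel_measurable (borel \<Otimes>\<^sub>M borel)" by (rule full_kernel_measurable)
  have S_meas: "case_prod (S n) \<in> borel_measurable (borel \<Otimes>\<^sub>M borel)" for n unfolding S_def by measurable
  have T_meas: "case_prod (T n) \<in> borel_measurable (borel \<Otimes>\<^sub>M borel)" for n unfolding T_def by measurable
  have S_le: "\<bar>S n l m\<bar> \<le> (half_const * exp 3 * exp_half l) * exp_half m" for n l m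
    using smear_half_line_le(1)[OF half_kernel_row_measurable half_kernel_le e(2,4), of m l n]
    by (auto simp: S_def exp_half_def[of m] mult_ac split: split_indicator)
  have S_int: "integrable lborel (\<lambda>x. (half_const * exp 3 * exp_half x) * exp_half x)"
    by (rule integrable_dominated[where g = "\<lambda>x. half_const * exp 3 * exp_half x"])
      (use integrable_exp_half half_const_nonneg exp_half_le_1 in \<open>auto intro!: mult_left_le\<close>)
  have S_lim: "(\<lambda>n. S n l m) \<longlonglongrightarrow> half_kernel l m" for l m
  proof (cases "m < 0")
    case True
    then show ?thesis
      using smear_tendsto[OF half_kernel_row_measurable half_kernel_le e(1,2,4) True half_kernel_cont[OF hp_cont True]] by (simp add: S_def)
  next
    case False
    then show ?thesis using half_line_support[OF half_kernel_row_measurable half_kernel_le, of m l] by (simp add: S_def)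
  qed
  have "\<exists>d. has_fredholm_det (S n) d" for n
    using fredholm_det_exists[OF S_meas S_le _ _ S_int] half_const_nonneg by (metis exp_half_nonneg exp_ge_zero mult_nonneg_nonneg)
  then obtain \<delta> where \<delta>: "\<And>n. has_fredholm_det (S n) (\<delta> n)" by metis
  obtain d' where "\<delta> \<longlonglongrightarrow> d'" "has_fredholm_det half_kernel d'"
    by (rule fredholm_det_tendsto[OF S_meas S_le _ _ S_int S_lim \<delta>]) (use half_const_nonneg in auto)
  then have \<delta>_lim: "\<delta> \<longlonglongrightarrow> d" using has_fredholm_det_unique[OF det] by simp
  have T_det: "has_fredholm_det (T n) (\<delta> n)" for n
  proof -
    define F where "F = (\<lambda>x l. exp (e n * x / 2) * airy_neg x l)"
    define G where "G = (\<lambda>l z. exp (e n * z / 2) * airy_transform (half_kernel l) z)"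
    have "has_fredholm_det (\<lambda>x z. LBINT l. F x l * G l z) (\<delta> n) \<longleftrightarrow> has_fredholm_det (\<lambda>l m. LBINT x. G l x * F x m) (\<delta> n)"
    proof (rule has_fredholm_det_cyclic)
      show "case_prod F \<in> borel_measurable (borel \<Otimes>\<^sub>M borel)" "case_prod G \<in> borel_measurable (borel \<Otimes>\<^sub>M borel)"
        unfolding F_def G_def by measurable
      show "\<bar>F x l\<bar> \<le> (exp (e n * x / 2) * airy_env (e n) x) * indicator {..<0} l" for x l
        using Ai_le_env[OF e(2), of l x n] by (auto simp: F_def airy_neg_def abs_mult split: split_indicator)
      show "\<bar>G l z\<bar> \<le> exp_half l * (exp (e n * z / 2) * airy_env (e n) z * (half_const * exp_half_mass))" for l z
        using abs_airy_transform_le[OF half_kernel_row_measurable half_kernel_le e(2), of l z n] by (simp add: G_def abs_mult mult_ac)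
      have sq: "exp (e n * x / 2) * airy_env (e n) x * (exp (e n * x / 2) * airy_env (e n) x * (half_const * exp_half_mass))
          = (half_const * exp_half_mass) * (exp (e n * x) * (airy_env (e n) x)\<^sup>2)" for x
      proof -
        have "exp (e n * x / 2) * exp (e n * x / 2) = exp (e n * x)" by (simp flip: exp_add)
        then show ?thesis by (simp add: power2_eq_square)
      qed
      show "integrable lborel (\<lambda>x. exp (e n * x / 2) * airy_env (e n) x * (exp (e n * x / 2) * airy_env (e n) x * (half_const * exp_half_mass)))"
        unfolding sq by (intro integrable_mult_right integrable_exp_env e)
      show "integrable lborel (\<lambda>l. indicator {..<0} l * exp_half l)"
        by (rule integrable_dominated[OF _ integrable_exp_half]) (auto split: split_indicator)
    qed (use airy_env_nonneg[OF e(2)] half_const_nonneg exp_half_mass_nonneg in auto)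
    moreover have "(\<lambda>x z. LBINT l. F x l * G l z) = T n"
    proof (intro ext)
      fix x z
      have "F x l * G l z = (exp (e n * x / 2) * exp (e n * z / 2)) * (Ai (x - l) * airy_transform (half_kernel l) z)" for l
      proof (cases "l < 0")
        case False
        then have "half_kernel l = (\<lambda>_. 0)" using half_kernel_le[of l] by (auto simp: exp_half_def)
        then show ?thesis by (simp add: G_def airy_transform_def)
      qed (simp add: F_def G_def airy_neg_def)
      then have "(LBINT l. F x l * G l z) = (exp (e n * x / 2) * exp (e n * z / 2)) * full_kernel x z"
        by (simp only: integral_mult_right_zero full_kernel_eq_airy_transform)
      then show "(LBINT l. F x l * G l z) = T n x z" by (simp add: T_def)
    qed
    moreover have "(\<lambda>l m. LBINT x. G l x * F x m) = S n"
    proof (intro ext)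
      fix l m
      have "G l x * F x m = indicator {..<0} m * (exp (e n * x) * Ai (x - m) * airy_transform (half_kernel l) x)" for x
      proof -
        have "exp (e n * x / 2) * exp (e n * x / 2) = exp (e n * x)" by (simp flip: exp_add)
        then show ?thesis by (simp add: F_def G_def airy_neg_def)
      qed
      then have "(LBINT x. G l x * F x m) = indicator {..<0} m * (LBINT x. exp (e n * x) * Ai (x - m) * airy_transform (half_kernel l) x)"
        by (simp only: integral_mult_right_zero)
      also have "\<dots> = S n l m"
      proof (cases "m < 0")
        case True
        then show ?thesis
          using integral_exp_Ai_airy_transform[OF half_kernel_row_measurable half_kernel_le e(2)] by (simp add: S_def)
      qed (simp add: S_def)
      finally show "(LBINT x. G l x * F x m) = S n l m" .
    qed
    ultimately show ?thesis using \<delta> by simp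
  qed
  obtain a b where ab: "\<And>x z. \<bar>full_kernel x z\<bar> \<le> a x * b z" "\<And>x. 0 \<le> a x" "\<And>x. 0 \<le> b x"
    "a \<in> borel_measurable borel" "b \<in> borel_measurable borel"
    "integrable lborel (\<lambda>x. (1 + exp (2 * x)) * (a x)\<^sup>2)" "integrable lborel (\<lambda>x. (1 + exp (2 * x)) * (b x)\<^sup>2)"
    by (rule full_kernel_dominated) blast
  note [measurable] = ab(4,5)
  \<comment> \<open>The exponent \<open>e n / 2\<close> lies between 0 and 1, so the weight is at
    most the sum of its values for the exponents 0 and 1.\<close>
  have weight: "exp (e n * x / 2) \<le> 1 + exp x" for n x
  proof (cases "0 \<le> x")
    case True
    have "e n * x \<le> 2 * x" using e(4) True by (rule mult_right_mono)
    then have "exp (e n * x / 2) \<le> exp x" by simp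
    then show ?thesis by linarith
  next
    case False
    then have "e n * x \<le> 0" using e(2)[of n] by (intro mult_nonneg_nonpos) auto
    then have "exp (e n * x / 2) \<le> 1" by simp
    then show ?thesis using exp_gt_zero[of x] by linarith
  qed
  have T_le: "\<bar>T n x z\<bar> \<le> ((1 + exp x) * a x) * ((1 + exp z) * b z)" for n x z
  proof -
    have "\<bar>T n x z\<bar> = (exp (e n * x / 2) * exp (e n * z / 2)) * \<bar>full_kernel x z\<bar>" by (simp add: T_def abs_mult)
    also have "\<dots> \<le> ((1 + exp x) * (1 + exp z)) * (a x * b z)"
      by (intro mult_mono weight ab) (auto intro: add_nonneg_nonneg)
    finally show ?thesis by (simp add: mult_ac)
  qed
  have T_int: "integrable lborel (\<lambda>x. ((1 + exp x) * a x) * ((1 + exp x) * b x))"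
  proof (rule integrable_dominated[where g = "\<lambda>x. (1 + exp (2 * x)) * (a x)\<^sup>2 + (1 + exp (2 * x)) * (b x)\<^sup>2"])
    fix x :: real
    have "exp (2 * x) = exp x * exp x" by (simp flip: exp_add)
    then have "(1 + exp x)\<^sup>2 \<le> 2 * (1 + exp (2 * x))"
      using sum_squares_bound[of 1 "exp x"] by (simp add: power2_eq_square algebra_simps)
    moreover have "a x * b x \<le> ((a x)\<^sup>2 + (b x)\<^sup>2) / 2" using sum_squares_bound[of "a x" "b x"] by simp
    ultimately have "(1 + exp x)\<^sup>2 * (a x * b x) \<le> (2 * (1 + exp (2 * x))) * (((a x)\<^sup>2 + (b x)\<^sup>2) / 2)"
      using ab(2,3) by (intro mult_mono) (auto intro: add_nonneg_nonneg)
    then show "norm (((1 + exp x) * a x) * ((1 + exp x) * b x)) \<le> (1 + exp (2 * x)) * (a x)\<^sup>2 + (1 + exp (2 * x)) * (b x)\<^sup>2"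
      using ab(2,3)[of x] by (simp add: power2_eq_square[of "1 + _"] abs_mult algebra_simps)
  qed (use ab(6,7) in auto)
  have T_lim: "(\<lambda>n. T n x z) \<longlonglongrightarrow> full_kernel x z" for x z
  proof -
    have "(\<lambda>n. T n x z) \<longlonglongrightarrow> exp (0 * x / 2) * full_kernel x z * exp (0 * z / 2)"
      unfolding T_def by (intro tendsto_intros e) auto
    then show ?thesis by simp
  qed
  obtain d' where "\<delta> \<longlonglongrightarrow> d'" "has_fredholm_det full_kernel d'"
    by (rule fredholm_det_tendsto[OF T_meas T_le _ _ T_int T_lim T_det]) (use ab(2,3) in \<open>auto intro!: mult_nonneg_nonneg add_nonneg_nonneg\<close>)
  then show ?thesis using LIMSEQ_unique[OF \<delta>_lim] by simp
qed

end

section \<open>Barriers at finitely many times\<close>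

text \<open>This class and \<open>exp_growth\<close> are dual: products of a member of each are
  integrable. For \<open>l \<le> 0\<close> the first passage expectations lie in this class, while
  \<open>airy_heat\<close> lies in \<open>exp_growth\<close>.\<close>

definition rapidly_decaying :: "(real \<Rightarrow> real) \<Rightarrow> bool" where
  "rapidly_decaying f \<longleftrightarrow> f \<in> borel_measurable borel \<and> (\<forall>A. \<exists>C. \<forall>b. \<bar>f b\<bar> \<le> C * exp (- A * \<bar>b\<bar>))"

definition exp_growth :: "(real \<Rightarrow> real) \<Rightarrow> bool" where
  "exp_growth f \<longleftrightarrow> f \<in> borel_measurable borel \<and> (\<exists>A C. 0 \<le> A \<and> (\<forall>b. \<bar>f b\<bar> \<le> C * exp (A * \<bar>b\<bar>)))"

definition heat_conv :: "real \<Rightarrow> (real \<Rightarrow> real) \<Rightarrow> real \<Rightarrow> real" where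
  "heat_conv s f b = (LBINT x. gauss s x * f (b + x))"

lemma rapidly_decaying_measurable: "rapidly_decaying f \<Longrightarrow> f \<in> borel_measurable borel"
  and exp_growth_measurable: "exp_growth f \<Longrightarrow> f \<in> borel_measurable borel"
  by (simp_all add: rapidly_decaying_def exp_growth_def)

lemma rapidly_decayingD: "rapidly_decaying f \<Longrightarrow> \<exists>C\<ge>0. \<forall>b. \<bar>f b\<bar> \<le> C * exp (- A * \<bar>b\<bar>)"
proof -
  assume "rapidly_decaying f"
  then obtain C where C: "\<And>b. \<bar>f b\<bar> \<le> C * exp (- A * \<bar>b\<bar>)" unfolding rapidly_decaying_def by blast
  have "0 \<le> C" using order_trans[OF abs_ge_zero C[of 0]] by simp
  with C show ?thesis by blast
qed

lemma exp_growthD: "exp_growth f \<Longrightarrow> \<exists>A C. 0 \<le> A \<and> 0 \<le> C \<and> (\<forall>b. \<bar>f b\<bar> \<le> C * exp (A * \<bar>b\<bar>))"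
proof -
  assume "exp_growth f"
  then obtain A C where C: "0 \<le> A" "\<And>b. \<bar>f b\<bar> \<le> C * exp (A * \<bar>b\<bar>)" unfolding exp_growth_def by blast
  have "0 \<le> C" using order_trans[OF abs_ge_zero C(2)[of 0]] by simp
  with C show ?thesis by blast
qed

lemma exp_growthI_exp:
  assumes "f \<in> borel_measurable borel" "\<And>b. \<bar>f b\<bar> \<le> C * exp (a * b)"
  shows "exp_growth f"
proof -
  have C: "0 \<le> C" using order_trans[OF abs_ge_zero assms(2)[of 0]] by simp
  have "\<bar>f b\<bar> \<le> C * exp (\<bar>a\<bar> * \<bar>b\<bar>)" for b
  proof (rule order_trans[OF assms(2)])
    have "a * b \<le> \<bar>a\<bar> * \<bar>b\<bar>" by (metis abs_ge_self abs_mult)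
    then show "C * exp (a * b) \<le> C * exp (\<bar>a\<bar> * \<bar>b\<bar>)" using C by (intro mult_left_mono) auto
  qed
  then show ?thesis using assms(1) unfolding exp_growth_def by (intro conjI exI[of _ "\<bar>a\<bar>"] exI[of _ C]) auto
qed

lemma rapidly_decaying_imp_exp_growth:
  assumes "rapidly_decaying f"
  shows "exp_growth f"
proof -
  obtain C where "\<And>b. \<bar>f b\<bar> \<le> C * exp (- 0 * \<bar>b\<bar>)" using rapidly_decayingD[OF assms] by blast
  then show ?thesis
    using rapidly_decaying_measurable[OF assms] by (intro exp_growthI_exp[where C = C and a = 0]) auto
qed

lemma exp_growth_diff:
  assumes "exp_growth f" "exp_growth g"
  shows "exp_growth (\<lambda>b. f b - g b)"
proof -
  obtain A C where f: "0 \<le> A" "0 \<le> C" "\<And>b. \<bar>f b\<bar> \<le> C * exp (A * \<bar>b\<bar>)" using exp_growthD[OF assms(1)] by blast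
  obtain A' C' where g: "0 \<le> A'" "0 \<le> C'" "\<And>b. \<bar>g b\<bar> \<le> C' * exp (A' * \<bar>b\<bar>)" using exp_growthD[OF assms(2)] by blast
  have "\<bar>f b - g b\<bar> \<le> (C + C') * exp ((A + A') * \<bar>b\<bar>)" for b
  proof -
    have "C * exp (A * \<bar>b\<bar>) \<le> C * exp ((A + A') * \<bar>b\<bar>)" "C' * exp (A' * \<bar>b\<bar>) \<le> C' * exp ((A + A') * \<bar>b\<bar>)"
      using f g by (intro mult_left_mono; simp add: distrib_right)+
    with f(3)[of b] g(3)[of b] show ?thesis by (simp only: distrib_right[of C]) linarith
  qed
  then show ?thesis
    using f(1) g(1) exp_growth_measurable[OF assms(1)] exp_growth_measurable[OF assms(2)]
    unfolding exp_growth_def by (intro conjI exI[of _ "A + A'"] exI[of _ "C + C'"]) auto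
qed

lemma integrable_decay_growth:
  assumes f: "rapidly_decaying f" and g: "exp_growth g"
  shows "integrable lborel (\<lambda>b. f b * g b)"
proof -
  note [measurable] = rapidly_decaying_measurable[OF f] exp_growth_measurable[OF g]
  obtain A C where g': "0 \<le> A" "0 \<le> C" "\<And>b. \<bar>g b\<bar> \<le> C * exp (A * \<bar>b\<bar>)" using exp_growthD[OF g] by blast
  obtain D where f': "0 \<le> D" "\<And>b. \<bar>f b\<bar> \<le> D * exp (- (A + 1) * \<bar>b\<bar>)" using rapidly_decayingD[OF f] by blast
  show ?thesis
  proof (rule integrable_dominated[where g = "\<lambda>b. (D * C) * exp (- 1 * \<bar>b\<bar>)"])
    show "norm (f b * g b) \<le> (D * C) * exp (- 1 * \<bar>b\<bar>)" for b
    proof -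
      have "\<bar>f b\<bar> * \<bar>g b\<bar> \<le> (D * exp (- (A + 1) * \<bar>b\<bar>)) * (C * exp (A * \<bar>b\<bar>))"
        using f' g' by (intro mult_mono) auto
      also have "\<dots> = (D * C) * exp (- 1 * \<bar>b\<bar>)" by (simp add: algebra_simps flip: exp_add)
      finally show ?thesis by (simp add: abs_mult)
    qed
  qed (use integrable_exp_abs[of 1] in auto)
qed

lemma integrable_gauss_exp_abs:
  assumes "s > 0"
  shows "integrable lborel (\<lambda>x. gauss s x * exp (A * \<bar>x\<bar>))"
proof (rule integrable_dominated[where g = "\<lambda>x. gauss s x * exp (A * x) + gauss s x * exp ((- A) * x)"])
  show "norm (gauss s x * exp (A * \<bar>x\<bar>)) \<le> gauss s x * exp (A * x) + gauss s x * exp ((- A) * x)" for x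
    by (cases "0 \<le> x") (auto simp: abs_mult)
qed (use integrable_gauss_exp[OF assms, of A] integrable_gauss_exp[OF assms, of "- A"] in auto)

lemma exp_abs_add_le: "0 \<le> A \<Longrightarrow> exp (A * \<bar>b + x\<bar>) \<le> exp (A * \<bar>b\<bar>) * exp (A * \<bar>x :: real\<bar>)"
proof -
  assume "0 \<le> A"
  then have "A * \<bar>b + x\<bar> \<le> A * (\<bar>b\<bar> + \<bar>x\<bar>)" by (intro mult_left_mono) auto
  then show ?thesis by (simp add: distrib_left flip: exp_add)
qed

lemma exp_minus_abs_add_le: "0 \<le> A \<Longrightarrow> exp (- A * \<bar>b + x\<bar>) \<le> exp (- A * \<bar>b\<bar>) * exp (A * \<bar>x :: real\<bar>)"
proof -
  assume "0 \<le> A"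
  then have "A * \<bar>b\<bar> \<le> A * (\<bar>b + x\<bar> + \<bar>x\<bar>)" by (intro mult_left_mono) auto
  then show ?thesis by (simp add: distrib_left flip: exp_add)
qed

lemma heat_conv_measurable [measurable (raw)]:
  assumes [measurable]: "(\<lambda>(z, x). f z x) \<in> borel_measurable (M \<Otimes>\<^sub>M borel)" "g \<in> borel_measurable M"
  shows "(\<lambda>z. heat_conv s (f z) (g z)) \<in> borel_measurable M"
proof -
  have "(\<lambda>(z, x). gauss s x * f z (g z + x)) \<in> borel_measurable (M \<Otimes>\<^sub>M lborel)"
    by measurable
  then show ?thesis unfolding heat_conv_def by (rule lborel.borel_measurable_lebesgue_integral)
qed

lemma heat_conv_0 [simp]: "heat_conv s (\<lambda>_. 0) b = 0"
  by (simp add: heat_conv_def)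

lemma integrable_heat_conv:
  assumes "s > 0" "exp_growth f"
  shows "integrable lborel (\<lambda>x. gauss s x * f (b + x))"
proof -
  note [measurable] = exp_growth_measurable[OF assms(2)]
  obtain A C where f: "0 \<le> A" "0 \<le> C" "\<And>b. \<bar>f b\<bar> \<le> C * exp (A * \<bar>b\<bar>)" using exp_growthD[OF assms(2)] by blast
  show ?thesis
  proof (rule integrable_dominated[where g = "\<lambda>x. (C * exp (A * \<bar>b\<bar>)) * (gauss s x * exp (A * \<bar>x\<bar>))"])
    show "norm (gauss s x * f (b + x)) \<le> (C * exp (A * \<bar>b\<bar>)) * (gauss s x * exp (A * \<bar>x\<bar>))" for x
    proof -
      have "\<bar>f (b + x)\<bar> \<le> C * (exp (A * \<bar>b\<bar>) * exp (A * \<bar>x\<bar>))"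
        by (rule order_trans[OF f(3) mult_left_mono[OF exp_abs_add_le]]) (use f in auto)
      then have "gauss s x * \<bar>f (b + x)\<bar> \<le> gauss s x * (C * (exp (A * \<bar>b\<bar>) * exp (A * \<bar>x\<bar>)))" by (rule mult_left_mono) simp
      then show ?thesis by (simp add: abs_mult mult_ac)
    qed
  qed (use integrable_gauss_exp_abs[OF assms(1)] in auto)
qed

lemma heat_conv_diff:
  assumes "s > 0" "exp_growth f" "exp_growth g"
  shows "heat_conv s (\<lambda>x. f x - g x) b = heat_conv s f b - heat_conv s g b"
  using integrable_heat_conv[OF assms(1,2), of b] integrable_heat_conv[OF assms(1,3), of b]
  by (simp add: heat_conv_def right_diff_distrib)

lemma rapidly_decaying_heat_conv:
  assumes s: "s > 0" and f: "rapidly_decaying f"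
  shows "rapidly_decaying (heat_conv s f)"
  unfolding rapidly_decaying_def
proof (intro conjI allI)
  note [measurable] = rapidly_decaying_measurable[OF f]
  show "heat_conv s f \<in> borel_measurable borel" by measurable
  fix A
  obtain C where C: "0 \<le> C" "\<And>b. \<bar>f b\<bar> \<le> C * exp (- \<bar>A\<bar> * \<bar>b\<bar>)" using rapidly_decayingD[OF f] by blast
  have "\<bar>heat_conv s f b\<bar> \<le> C * (LBINT x. gauss s x * exp (\<bar>A\<bar> * \<bar>x\<bar>)) * exp (- A * \<bar>b\<bar>)" for b
  proof -
    have "norm (heat_conv s f b) \<le> (LBINT x. (C * exp (- \<bar>A\<bar> * \<bar>b\<bar>)) * (gauss s x * exp (\<bar>A\<bar> * \<bar>x\<bar>)))"
      unfolding heat_conv_def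
    proof (rule norm_integral_dominated)
      show "norm (gauss s x * f (b + x)) \<le> (C * exp (- \<bar>A\<bar> * \<bar>b\<bar>)) * (gauss s x * exp (\<bar>A\<bar> * \<bar>x\<bar>))" for x
      proof -
        have "\<bar>f (b + x)\<bar> \<le> C * (exp (- \<bar>A\<bar> * \<bar>b\<bar>) * exp (\<bar>A\<bar> * \<bar>x\<bar>))"
          by (rule order_trans[OF C(2) mult_left_mono[OF exp_minus_abs_add_le]]) (use C in auto)
        then have "gauss s x * \<bar>f (b + x)\<bar> \<le> gauss s x * (C * (exp (- \<bar>A\<bar> * \<bar>b\<bar>) * exp (\<bar>A\<bar> * \<bar>x\<bar>)))" by (rule mult_left_mono) simp
        then show ?thesis by (simp add: abs_mult mult_ac)
      qed
    qed (use integrable_gauss_exp_abs[OF s] in auto)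
    also have "\<dots> = C * (LBINT x. gauss s x * exp (\<bar>A\<bar> * \<bar>x\<bar>)) * exp (- \<bar>A\<bar> * \<bar>b\<bar>)" by simp
    also have "\<dots> \<le> C * (LBINT x. gauss s x * exp (\<bar>A\<bar> * \<bar>x\<bar>)) * exp (- A * \<bar>b\<bar>)"
      using C(1) by (intro mult_left_mono mult_nonneg_nonneg Bochner_Integration.integral_nonneg) (auto intro!: mult_right_mono)
    finally show ?thesis by simp
  qed
  then show "\<exists>C. \<forall>b. \<bar>heat_conv s f b\<bar> \<le> C * exp (- A * \<bar>b\<bar>)" by blast
qed

text \<open>Fubini's theorem and the evenness of the heat kernel. The rate \<open>A + 1\<close> of
  \<open>f\<close> exceeds the growth rate \<open>A\<close> of \<open>g\<close> by 1, which
  dominates the integrand in both arrangements.\<close>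

lemma heat_conv_adjoint:
  assumes s: "s > 0" and f: "rapidly_decaying f" and g: "exp_growth g"
  shows "(LBINT b. f b * heat_conv s g b) = (LBINT b. heat_conv s f b * g b)"
proof -
  note [measurable] = rapidly_decaying_measurable[OF f] exp_growth_measurable[OF g]
  obtain A C where g': "0 \<le> A" "0 \<le> C" "\<And>b. \<bar>g b\<bar> \<le> C * exp (A * \<bar>b\<bar>)" using exp_growthD[OF g] by blast
  obtain D where f': "0 \<le> D" "\<And>b. \<bar>f b\<bar> \<le> D * exp (- (A + 1) * \<bar>b\<bar>)" using rapidly_decayingD[OF f] by blast
  have decay: "integrable lborel (\<lambda>b. (D * C) * exp (- 1 * \<bar>b\<bar>))" using integrable_exp_abs[of 1] by simp
  have "(LBINT b. f b * heat_conv s g b) = (LBINT b. (LBINT x. f b * (gauss s x * g (b + x))))"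
    by (simp add: heat_conv_def)
  also have "\<dots> = (LBINT x. (LBINT b. f b * (gauss s x * g (b + x))))"
  proof (rule Fubini_dominated[OF lborel_pair_sigma_finite _ decay integrable_gauss_exp_abs[OF s, of A]])
    fix b x
    have "\<bar>f b\<bar> * \<bar>g (b + x)\<bar> \<le> (D * exp (- (A + 1) * \<bar>b\<bar>)) * (C * (exp (A * \<bar>b\<bar>) * exp (A * \<bar>x\<bar>)))"
      using f' g' by (intro mult_mono order_trans[OF g'(3) mult_left_mono[OF exp_abs_add_le]]) auto
    also have "\<dots> = (D * C) * exp (- 1 * \<bar>b\<bar>) * exp (A * \<bar>x\<bar>)" by (simp add: algebra_simps flip: exp_add)
    finally have "gauss s x * (\<bar>f b\<bar> * \<bar>g (b + x)\<bar>) \<le> gauss s x * ((D * C) * exp (- 1 * \<bar>b\<bar>) * exp (A * \<bar>x\<bar>))"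
      by (rule mult_left_mono) simp
    then show "norm (f b * (gauss s x * g (b + x))) \<le> (D * C) * exp (- 1 * \<bar>b\<bar>) * (gauss s x * exp (A * \<bar>x\<bar>))"
      by (simp add: abs_mult mult_ac)
  qed measurable
  also have "\<dots> = (LBINT x. (LBINT b. f (b - x) * (gauss s x * g b)))"
  proof (rule Bochner_Integration.integral_cong[OF refl])
    fix x
    show "(LBINT b. f b * (gauss s x * g (b + x))) = (LBINT b. f (b - x) * (gauss s x * g b))"
      by (subst lborel_integral_real_affine[where c = 1 and t = "- x"]) auto
  qed
  also have "\<dots> = (LBINT x. (LBINT b. f (b + x) * (gauss s x * g b)))"
    using lborel_integral_real_affine[where c = "-1" and t = 0 and f = "\<lambda>x. LBINT b. f (b - x) * (gauss s x * g b)"] by simp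
  also have "\<dots> = (LBINT b. (LBINT x. f (b + x) * (gauss s x * g b)))"
  proof (rule Fubini_dominated[OF lborel_pair_sigma_finite _ integrable_gauss_exp_abs[OF s, of "A + 1"] decay])
    fix b x
    have "\<bar>f (b + x)\<bar> * \<bar>g b\<bar> \<le> (D * (exp (- (A + 1) * \<bar>b\<bar>) * exp ((A + 1) * \<bar>x\<bar>))) * (C * exp (A * \<bar>b\<bar>))"
      using f' g' by (intro mult_mono order_trans[OF f'(2) mult_left_mono[OF exp_minus_abs_add_le]]) auto
    also have "\<dots> = (D * C) * exp (- 1 * \<bar>b\<bar>) * exp ((A + 1) * \<bar>x\<bar>)" by (simp add: algebra_simps flip: exp_add)
    finally have "gauss s x * (\<bar>f (b + x)\<bar> * \<bar>g b\<bar>) \<le> gauss s x * ((D * C) * exp (- 1 * \<bar>b\<bar>) * exp ((A + 1) * \<bar>x\<bar>))"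
      by (rule mult_left_mono) simp
    then show "norm (f (b + x) * (gauss s x * g b)) \<le> gauss s x * exp ((A + 1) * \<bar>x\<bar>) * ((D * C) * exp (- 1 * \<bar>b\<bar>))"
      by (simp add: abs_mult mult_ac)
  qed measurable
  also have "\<dots> = (LBINT b. heat_conv s f b * g b)"
  proof (intro Bochner_Integration.integral_cong refl)
    fix b
    have "(LBINT x. f (b + x) * (gauss s x * g b)) = (LBINT x. (gauss s x * f (b + x)) * g b)" by (simp only: mult_ac)
    then show "(LBINT x. f (b + x) * (gauss s x * g b)) = heat_conv s f b * g b" by (simp only: integral_mult_left_zero heat_conv_def)
  qed
  finally show ?thesis .
qed

lemma heat_conv_airy_heat: "s > 0 \<Longrightarrow> heat_conv s (\<lambda>b. airy_heat (t + s) (b - l)) b = airy_heat t (b - l)"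
  using airy_heat_semigroup[of s t "b - l"] by (simp add: heat_conv_def algebra_simps)

lemma exp_growth_airy_heat: "exp_growth (\<lambda>b. airy_heat t (b - l))"
proof (rule exp_growthI_exp[where C = "heat_const t (t + 1) * exp ((t + 1) * l)" and a = "- (t + 1)"])
  show "\<bar>airy_heat t (b - l)\<bar> \<le> heat_const t (t + 1) * exp ((t + 1) * l) * exp (- (t + 1) * b)" for b
  proof -
    have "- (t + 1) * (b - l) = (t + 1) * l + - (t + 1) * b" by (simp add: algebra_simps)
    then show ?thesis using airy_heat_exp_bound[of t "t + 1" "b - l"] by (simp only: exp_add mult.assoc)
  qed
qed measurable

text \<open>The expectation of \<open>airy_heat t (b - l)\<close> at the first passage above the barrier, for a path started at \<open>b\<close> at the
  first time of the list. In the last step \<open>hd []\<close> occurs, together with \<open>first_hit [] = 0\<close>.\<close>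

primrec first_hit :: "(real \<times> real) list \<Rightarrow> real \<Rightarrow> real \<Rightarrow> real" where
  "first_hit [] = (\<lambda>l b. 0)"
| "first_hit (p # ps) = (\<lambda>l b. if snd p < b then airy_heat (fst p) (b - l) else heat_conv (fst (hd ps) - fst p) (first_hit ps l) b)"

abbreviation increasing :: "(real \<times> real) list \<Rightarrow> bool" where
  "increasing \<equiv> sorted_wrt (\<lambda>p q. fst p < fst q)"

lemma first_hit_measurable [measurable]: "case_prod (first_hit ps) \<in> borel_measurable (borel \<Otimes>\<^sub>M borel)"
proof (induction ps)
  case (Cons p ps)
  note [measurable] = Cons.IH
  show ?case by (simp add: split_beta') measurable
qed simp

lemma first_hit_bound:
  assumes "increasing ps" "0 \<le> K"
    and "\<And>p b. p \<in> set ps \<Longrightarrow> snd p < b \<Longrightarrow> \<bar>airy_heat (fst p) (b - l)\<bar> \<le> K * exp (A * b - A\<^sup>2 * fst p)"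
  shows "\<bar>first_hit ps l b\<bar> \<le> K * exp (A * b - A\<^sup>2 * fst (hd ps))"
  using assms
proof (induction ps arbitrary: b)
  case (Cons p ps)
  show ?case
  proof (cases "snd p < b")
    case True
    then show ?thesis using Cons.prems(3)[of p b] by simp
  next
    case False
    show ?thesis
    proof (cases ps)
      case (Cons q qs)
      define s where "s = fst q - fst p"
      have s: "s > 0" using Cons.prems(1) Cons by (simp add: s_def)
      have IH: "\<bar>first_hit ps l x\<bar> \<le> K * exp (A * x - A\<^sup>2 * fst q)" for x
        using Cons.IH[of x] Cons.prems Cons by simp
      have "norm (heat_conv s (first_hit ps l) b) \<le> (LBINT x. (K * exp (A * b - A\<^sup>2 * fst q)) * (gauss s x * exp (A * x)))"
        unfolding heat_conv_def
      proof (rule norm_integral_dominated)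
        show "norm (gauss s x * first_hit ps l (b + x)) \<le> (K * exp (A * b - A\<^sup>2 * fst q)) * (gauss s x * exp (A * x))" for x
        proof -
          have "gauss s x * \<bar>first_hit ps l (b + x)\<bar> \<le> gauss s x * (K * exp (A * (b + x) - A\<^sup>2 * fst q))"
            by (intro mult_left_mono IH) simp
          also have "exp (A * (b + x) - A\<^sup>2 * fst q) = exp (A * b - A\<^sup>2 * fst q) * exp (A * x)"
            by (simp add: algebra_simps flip: exp_add)
          finally show ?thesis by (simp add: abs_mult mult_ac)
        qed
      qed (use integrable_gauss_exp[OF s] in auto)
      also have "\<dots> = K * (exp (A * b - A\<^sup>2 * fst q) * exp (A\<^sup>2 * s))" by (simp add: integral_gauss_exp[OF s])
      also have "exp (A * b - A\<^sup>2 * fst q) * exp (A\<^sup>2 * s) = exp (A * b - A\<^sup>2 * fst p)"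
        by (simp add: s_def algebra_simps flip: exp_add)
      finally show ?thesis using False Cons by (simp add: s_def)
    qed (use False Cons.prems(2) in simp)
  qed
qed simp

text \<open>Because of \<open>b > snd p\<close> and \<open>a + A \<ge> 0\<close>, the factor
  \<open>exp (- (a + A) * b)\<close> is at most its value at the level. The constant depends on the
  list; a uniform one needs the parabola.\<close>

lemma finite_hit_bound:
  "\<exists>C\<ge>0. \<forall>p\<in>set ps. \<forall>b>snd p. \<forall>l\<le>0. \<bar>airy_heat (fst p) (b - l)\<bar> \<le> C * exp (\<alpha> * l) * exp (A * b - A\<^sup>2 * fst p)"
proof (induction ps)
  case (Cons p ps)
  then obtain C where C: "0 \<le> C" "\<And>q b l. q \<in> set ps \<Longrightarrow> b > snd q \<Longrightarrow> l \<le> 0 \<Longrightarrow> \<bar>airy_heat (fst q) (b - l)\<bar> \<le> C * exp (\<alpha> * l) * exp (A * b - A\<^sup>2 * fst q)"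
    by blast
  \<comment> \<open>The three terms of the maximum serve the contour condition, the rate in
    \<open>l\<close> and the sign of \<open>a + A\<close>.\<close>
  define a where "a = max (fst p + 1) (max \<alpha> (- A))"
  have a: "fst p < a" "\<alpha> \<le> a" "0 \<le> a + A" by (auto simp: a_def)
  define D where "D = heat_const (fst p) a * exp (- (a + A) * snd p) * exp (A\<^sup>2 * fst p)"
  have D: "0 \<le> D" using heat_const_pos[OF a(1)] by (simp add: D_def)
  have "\<bar>airy_heat (fst p) (b - l)\<bar> \<le> D * exp (\<alpha> * l) * exp (A * b - A\<^sup>2 * fst p)" if "b > snd p" "l \<le> 0" for b l
  proof -
    have "\<bar>airy_heat (fst p) (b - l)\<bar> \<le> heat_const (fst p) a * exp (- a * (b - l))" by (rule airy_heat_exp_bound[OF a(1)])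
    also have "- a * (b - l) = (a * l) + (- (a + A) * b) + A * b" by (simp add: algebra_simps)
    also have "heat_const (fst p) a * exp ((a * l) + (- (a + A) * b) + A * b)
      \<le> heat_const (fst p) a * exp ((\<alpha> * l) + (- (a + A) * snd p) + A * b)"
    proof (intro mult_left_mono)
      have "a * l \<le> \<alpha> * l" using a(2) that(2) by (rule mult_right_mono_neg)
      moreover have "(a + A) * snd p \<le> (a + A) * b" using a(3) that(1) by (intro mult_left_mono) auto
      ultimately show "exp ((a * l) + (- (a + A) * b) + A * b) \<le> exp ((\<alpha> * l) + (- (a + A) * snd p) + A * b)"
        unfolding exp_le_cancel_iff mult_minus_left by linarith
    qed (use heat_const_pos[OF a(1)] in simp)
    also have "\<dots> = D * exp (\<alpha> * l) * exp (A * b - A\<^sup>2 * fst p)"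
      by (simp add: D_def exp_add exp_diff)
    finally show ?thesis .
  qed
  note D_bound = this
  show ?case
  proof (intro exI[of _ "max C D"] conjI ballI allI impI)
    show "0 \<le> max C D" using C(1) by simp
    fix q b and l :: real assume q: "q \<in> set (p # ps)" "snd q < b" "l \<le> 0"
    obtain E where "E \<le> max C D" and E: "\<bar>airy_heat (fst q) (b - l)\<bar> \<le> E * exp (\<alpha> * l) * exp (A * b - A\<^sup>2 * fst q)"
    proof (cases "q = p")
      case True
      then show ?thesis using D_bound[of b l] q that[of D] by simp
    next
      case False
      then show ?thesis using C(2)[of q b l] q that[of C] by simp
    qed
    note E
    also have "E * exp (\<alpha> * l) * exp (A * b - A\<^sup>2 * fst q) \<le> max C D * exp (\<alpha> * l) * exp (A * b - A\<^sup>2 * fst q)"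
      using \<open>E \<le> max C D\<close> by (intro mult_right_mono) auto
    finally show "\<bar>airy_heat (fst q) (b - l)\<bar> \<le> max C D * exp (\<alpha> * l) * exp (A * b - A\<^sup>2 * fst q)" .
  qed
qed auto

lemma first_hit_exp_bound:
  assumes "increasing ps"
  shows "\<exists>C\<ge>0. \<forall>l\<le>0. \<forall>b. \<bar>first_hit ps l b\<bar> \<le> C * exp (\<alpha> * l) * exp (A * b)"
proof -
  obtain C where C: "0 \<le> C" "\<And>p b l. p \<in> set ps \<Longrightarrow> b > snd p \<Longrightarrow> l \<le> 0 \<Longrightarrow> \<bar>airy_heat (fst p) (b - l)\<bar> \<le> C * exp (\<alpha> * l) * exp (A * b - A\<^sup>2 * fst p)"
    using finite_hit_bound[of ps \<alpha> A] by blast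
  have "\<bar>first_hit ps l b\<bar> \<le> (C * exp (- A\<^sup>2 * fst (hd ps))) * exp (\<alpha> * l) * exp (A * b)" if "l \<le> 0" for l b
  proof -
    have "\<bar>first_hit ps l b\<bar> \<le> (C * exp (\<alpha> * l)) * exp (A * b - A\<^sup>2 * fst (hd ps))"
      by (rule first_hit_bound[OF assms]) (use C that in auto)
    then show ?thesis by (simp add: exp_diff exp_minus field_simps)
  qed
  then show ?thesis using C(1) by (intro exI[of _ "C * exp (- A\<^sup>2 * fst (hd ps))"]) auto
qed

text \<open>The free rate of the one-sided bound is taken as \<open>c + A\<close> for negative and
  as \<open>c - A\<close> for positive \<open>b\<close>. The tilt \<open>exp (c * b)\<close> will
  compensate the factor that the parabolic coordinates produce.\<close>

lemma first_hit_exp_abs_bound: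
  assumes "increasing ps"
  shows "\<exists>C\<ge>0. \<forall>l\<le>0. \<forall>b. \<bar>first_hit ps l b\<bar> \<le> C * exp (\<alpha> * l) * exp (c * b) * exp (- A * \<bar>b\<bar>)"
proof -
  obtain C where C: "0 \<le> C" "\<And>l b. l \<le> 0 \<Longrightarrow> \<bar>first_hit ps l b\<bar> \<le> C * exp (\<alpha> * l) * exp ((c + A) * b)"
    using first_hit_exp_bound[OF assms] by blast
  obtain D where D: "0 \<le> D" "\<And>l b. l \<le> 0 \<Longrightarrow> \<bar>first_hit ps l b\<bar> \<le> D * exp (\<alpha> * l) * exp ((c - A) * b)"
    using first_hit_exp_bound[OF assms] by blast
  have "\<bar>first_hit ps l b\<bar> \<le> (C + D) * exp (\<alpha> * l) * exp (c * b) * exp (- A * \<bar>b\<bar>)" if "l \<le> 0" for l b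
  proof (cases "0 \<le> b")
    case True
    then have "\<bar>first_hit ps l b\<bar> \<le> D * exp (\<alpha> * l) * (exp (c * b) * exp (- A * \<bar>b\<bar>))"
      using D(2)[OF that, of b] by (simp add: algebra_simps flip: exp_add)
    also have "\<dots> \<le> (C + D) * exp (\<alpha> * l) * (exp (c * b) * exp (- A * \<bar>b\<bar>))"
      using C(1) by (intro mult_right_mono) auto
    finally show ?thesis by (simp add: mult.assoc)
  next
    case False
    then have "\<bar>first_hit ps l b\<bar> \<le> C * exp (\<alpha> * l) * (exp (c * b) * exp (- A * \<bar>b\<bar>))"
      using C(2)[OF that, of b] by (simp add: algebra_simps flip: exp_add)
    also have "\<dots> \<le> (C + D) * exp (\<alpha> * l) * (exp (c * b) * exp (- A * \<bar>b\<bar>))"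
      using D(1) by (intro mult_right_mono) auto
    finally show ?thesis by (simp add: mult.assoc)
  qed
  then show ?thesis using C(1) D(1) by (intro exI[of _ "C + D"]) auto
qed

lemma rapidly_decaying_first_hit:
  assumes "increasing ps" "l \<le> 0"
  shows "rapidly_decaying (first_hit ps l)"
  unfolding rapidly_decaying_def
proof (intro conjI allI)
  fix A
  obtain C where "\<And>l b. l \<le> 0 \<Longrightarrow> \<bar>first_hit ps l b\<bar> \<le> C * exp (0 * l) * exp (0 * b) * exp (- A * \<bar>b\<bar>)"
    using first_hit_exp_abs_bound[OF assms(1)] by blast
  then show "\<exists>C. \<forall>b. \<bar>first_hit ps l b\<bar> \<le> C * exp (- A * \<bar>b\<bar>)" using assms(2) by auto
qed measurable

section \<open>Splitting the times into past and future\<close>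

definition reflect :: "real \<times> real \<Rightarrow> real \<times> real" where
  "reflect p = (- fst p, snd p)"

lemma reflect_simps [simp]: "fst (reflect p) = - fst p" "snd (reflect p) = snd p" "reflect (reflect p) = p"
  by (simp_all add: reflect_def)

text \<open>\<open>qs\<close> lists the times before the first time of \<open>ps\<close>, in decreasing order.\<close>

definition backward_hit :: "(real \<times> real) list \<Rightarrow> real \<Rightarrow> real \<Rightarrow> real \<Rightarrow> real" where
  "backward_hit qs t = (\<lambda>l. heat_conv (t - fst (hd qs)) (first_hit (map reflect qs) l))"

text \<open>With \<open>v\<close>, \<open>u\<close> the two values of \<open>airy_heat\<close> and
  \<open>w\<close>, \<open>h\<close> the backward and forward expectations at the first time of
  \<open>ps\<close>, this is minus the integral of \<open>(v - w) * h + w * u\<close>: inclusion and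
  exclusion for passages before that time and from that time on. Its value does not depend on where
  the list of times is split.\<close>

definition split_form :: "(real \<times> real) list \<Rightarrow> (real \<times> real) list \<Rightarrow> real \<Rightarrow> real \<Rightarrow> real" where
  "split_form qs ps l m =
     - (LBINT b. (airy_heat (- fst (hd ps)) (b - l) - backward_hit qs (fst (hd ps)) l b) * first_hit ps m b)
     - (LBINT b. backward_hit qs (fst (hd ps)) l b * airy_heat (fst (hd ps)) (b - m))"

lemma rapidly_decaying_backward_hit:
  assumes "increasing (map reflect qs)" "qs \<noteq> [] \<Longrightarrow> fst (hd qs) < t" "l \<le> 0"
  shows "rapidly_decaying (backward_hit qs t l)"
proof (cases "qs = []")
  case True
  then show ?thesis by (auto simp: backward_hit_def rapidly_decaying_def intro!: exI[of _ 0])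
next
  case False
  then show ?thesis unfolding backward_hit_def
    by (intro rapidly_decaying_heat_conv rapidly_decaying_first_hit assms) (use assms in auto)
qed

lemma first_hit_reflect_Cons:
  "first_hit (map reflect (p # qs)) l b = (if snd p < b then airy_heat (- fst p) (b - l) else backward_hit qs (fst p) l b)"
proof (cases qs)
  case (Cons q rs)
  then show ?thesis by (simp add: backward_hit_def)
qed (simp add: backward_hit_def)

text \<open>Heat convolution over the gap \<open>s\<close> moves from one factor to the other by
  symmetry, and it carries \<open>u'\<close> to \<open>u\<close> and \<open>v\<close> to
  \<open>v'\<close>. What is left is an identity of integrands at the time of \<open>p\<close>,
  checked separately for \<open>b\<close> above and below the level of \<open>p\<close>.\<close>

lemma split_form_shift:
  assumes qs: "increasing (map reflect qs)" "qs \<noteq> [] \<Longrightarrow> fst (hd qs) < fst p" and ps: "increasing (p # p' # ps)"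
    and l: "l \<le> 0" and m: "m \<le> 0"
  shows "split_form qs (p # p' # ps) l m = split_form (p # qs) (p' # ps) l m"
proof -
  define s where "s = fst p' - fst p"
  have s: "s > 0" using ps by (simp add: s_def)
  define H where "H = first_hit (p' # ps) m"
  define u where "u = (\<lambda>b. airy_heat (fst p) (b - m))"
  define u' where "u' = (\<lambda>b. airy_heat (fst p') (b - m))"
  define v where "v = (\<lambda>b. airy_heat (- fst p) (b - l))"
  define v' where "v' = (\<lambda>b. airy_heat (- fst p') (b - l))"
  define w where "w = backward_hit qs (fst p) l"
  define z where "z = first_hit (map reflect (p # qs)) l"
  have H: "rapidly_decaying H" unfolding H_def by (rule rapidly_decaying_first_hit) (use ps m in auto)
  have w: "rapidly_decaying w" unfolding w_def by (rule rapidly_decaying_backward_hit[OF qs l])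
  have inc: "increasing (map reflect (p # qs))"
  proof (cases qs)
    case (Cons q rs)
    have "fst q < fst p" using qs(2) Cons by simp
    moreover have "\<forall>r\<in>set rs. fst r < fst q" using qs(1) Cons by simp
    ultimately show ?thesis using qs(1) Cons by (auto intro: less_trans)
  qed simp
  have z: "rapidly_decaying z" unfolding z_def by (rule rapidly_decaying_first_hit[OF inc l])
  have growth: "exp_growth u" "exp_growth u'" "exp_growth v" "exp_growth v'"
    unfolding u_def u'_def v_def v'_def by (rule exp_growth_airy_heat)+
  note [measurable] = rapidly_decaying_measurable[OF H] rapidly_decaying_measurable[OF w] rapidly_decaying_measurable[OF z]
    growth[THEN exp_growth_measurable]
  have z_eq: "z b = (if snd p < b then v b else w b)" for b
    unfolding z_def v_def w_def by (rule first_hit_reflect_Cons)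
  \<comment> \<open>Above the level of \<open>p\<close> the backward passage occurs at once and
    \<open>r\<close> vanishes; below it \<open>r\<close> is \<open>v - w\<close>.\<close>
  define r where "r = (\<lambda>b. v b - z b)"
  have r: "exp_growth r" unfolding r_def by (intro exp_growth_diff growth rapidly_decaying_imp_exp_growth z)
  have hu: "heat_conv s u' b = u b" for b
    using heat_conv_airy_heat[OF s, of "fst p" m b] by (simp add: u_def u'_def s_def)
  have hv: "heat_conv s v b = v' b" for b
    using heat_conv_airy_heat[OF s, of "- fst p'" l b] by (simp add: v_def v'_def s_def)
  have w': "backward_hit (p # qs) (fst p') l = heat_conv s z"
    by (simp add: backward_hit_def z_def s_def)
  have first: "first_hit (p # p' # ps) m b = (if snd p < b then u b else heat_conv s H b)" for b
    by (simp add: u_def H_def s_def)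
  have "split_form (p # qs) (p' # ps) l m = - (LBINT b. (v' b - heat_conv s z b) * H b) - (LBINT b. heat_conv s z b * u' b)"
    by (simp add: split_form_def w' v'_def H_def u'_def del: first_hit.simps)
  also have "(LBINT b. (v' b - heat_conv s z b) * H b) = (LBINT b. H b * heat_conv s r b)"
    unfolding r_def by (simp add: heat_conv_diff[OF s growth(3) rapidly_decaying_imp_exp_growth[OF z]] hv mult.commute)
  also have "\<dots> = (LBINT b. heat_conv s H b * r b)" by (rule heat_conv_adjoint[OF s H r])
  also have "(LBINT b. heat_conv s z b * u' b) = (LBINT b. z b * heat_conv s u' b)"
    by (rule heat_conv_adjoint[OF s z growth(2), symmetric])
  also have "- (LBINT b. heat_conv s H b * r b) - (LBINT b. z b * heat_conv s u' b)
      = - ((LBINT b. heat_conv s H b * r b) + (LBINT b. z b * u b))"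
    by (simp add: hu)
  also have "(LBINT b. heat_conv s H b * r b) + (LBINT b. z b * u b) = (LBINT b. heat_conv s H b * r b + z b * u b)"
    by (intro Bochner_Integration.integral_add[symmetric] integrable_decay_growth rapidly_decaying_heat_conv s H r z growth)
  also have "\<dots> = (LBINT b. first_hit (p # p' # ps) m b * (v b - w b) + w b * u b)"
    unfolding first z_eq r_def by (intro Bochner_Integration.integral_cong refl) (auto simp: algebra_simps)
  also have "\<dots> = (LBINT b. first_hit (p # p' # ps) m b * (v b - w b)) + (LBINT b. w b * u b)"
    by (intro Bochner_Integration.integral_add integrable_decay_growth rapidly_decaying_first_hit exp_growth_diff rapidly_decaying_imp_exp_growth ps m w growth)
  also have "- \<dots> = split_form qs (p # p' # ps) l m"
    by (simp add: split_form_def v_def w_def u_def mult.commute del: first_hit.simps)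
  finally show ?thesis ..
qed

lemma split_form_append:
  assumes "increasing (xs @ p # ps)" "increasing (map reflect qs)" "qs \<noteq> [] \<Longrightarrow> fst (hd qs) < fst (hd (xs @ p # ps))" "l \<le> 0" "m \<le> 0"
  shows "split_form qs (xs @ p # ps) l m = split_form (rev xs @ qs) (p # ps) l m"
  using assms
proof (induction xs arbitrary: qs)
  case (Cons x xs)
  obtain y ys where y: "xs @ p # ps = y # ys" by (cases "xs @ p # ps") auto
  have inc: "increasing (x # y # ys)" using Cons.prems(1) y by simp
  have "split_form qs ((x # xs) @ p # ps) l m = split_form (x # qs) (xs @ p # ps) l m"
    using split_form_shift[OF Cons.prems(2) _ inc Cons.prems(4,5)] Cons.prems(3) y by simp
  also have "\<dots> = split_form (rev xs @ x # qs) (p # ps) l m"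
  proof (rule Cons.IH)
    show "increasing (map reflect (x # qs))"
    proof (cases qs)
      case (Cons q rs)
      have "fst q < fst x" using Cons.prems(3) Cons by simp
      moreover have "\<forall>r\<in>set rs. fst r < fst q" using Cons.prems(2) Cons by simp
      ultimately show ?thesis using Cons.prems(2) Cons by (auto intro: less_trans)
    qed simp
    show "fst (hd (x # qs)) < fst (hd (xs @ p # ps))" using inc y by simp
  qed (use Cons.prems y inc in auto)
  finally show ?case by simp
qed simp

lemma split_form_Nil: "split_form [] ps l m = - (LBINT b. airy_heat (- fst (hd ps)) (b - l) * first_hit ps m b)"
  by (simp add: split_form_def backward_hit_def)

text \<open>At time 0 both values of \<open>airy_heat\<close> are Airy functions. Above
  \<open>G\<close> both expectations are Airy functions too, and below \<open>G\<close> the function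
  \<open>hm\<close> equals \<open>w\<close>; in either case the integrand takes the symmetric form
  of \<open>deficit\<close>.\<close>

lemma split_form_zero:
  assumes "increasing (map reflect qs)" "qs \<noteq> [] \<Longrightarrow> fst (hd qs) < 0" "increasing ((0, G) # ps)" "l \<le> 0" "m \<le> 0"
  defines "hm \<equiv> first_hit ((0, G) # map reflect qs) l" and "hp \<equiv> first_hit ((0, G) # ps) m"
  shows "split_form qs ((0, G) # ps) l m = - (LBINT y. Ai (y - l) * hp y + hm y * Ai (y - m) - hm y * hp y)"
proof -
  define w where "w = backward_hit qs 0 l"
  have w: "rapidly_decaying w" unfolding w_def by (rule rapidly_decaying_backward_hit) (use assms in auto)
  have hp: "rapidly_decaying hp" unfolding hp_def by (rule rapidly_decaying_first_hit) (use assms in auto)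
  have Ai: "exp_growth (\<lambda>b. Ai (b - k))" for k using exp_growth_airy_heat[of 0 k] by simp
  have hm_eq: "hm y = (if G < y then Ai (y - l) else w y)" for y
    using first_hit_reflect_Cons[of "(0, G)" qs l y] by (simp add: hm_def w_def reflect_def)
  have hp_eq: "G < y \<Longrightarrow> hp y = Ai (y - m)" for y by (simp add: hp_def)
  have "split_form qs ((0, G) # ps) l m = - ((LBINT b. hp b * (Ai (b - l) - w b)) + (LBINT b. w b * Ai (b - m)))"
    by (simp add: split_form_def w_def hp_def mult.commute del: first_hit.simps)
  also have "(LBINT b. hp b * (Ai (b - l) - w b)) + (LBINT b. w b * Ai (b - m)) = (LBINT b. hp b * (Ai (b - l) - w b) + w b * Ai (b - m))"
    by (intro Bochner_Integration.integral_add[symmetric] integrable_decay_growth exp_growth_diff rapidly_decaying_imp_exp_growth Ai w hp)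
  also have "\<dots> = (LBINT y. Ai (y - l) * hp y + hm y * Ai (y - m) - hm y * hp y)"
    by (intro Bochner_Integration.integral_cong refl) (auto simp: hm_eq hp_eq algebra_simps)
  finally show ?thesis .
qed

text \<open>In the coordinates \<open>x = b + t^2\<close> the exponent becomes that of a heat
  kernel, up to a gauge factor in \<open>(t, b)\<close> divided by the same factor in
  \<open>(t', b')\<close>. In a product of such kernels the gauge factors telescope.\<close>

lemma exp_H_parabola:
  assumes "t < t'"
  shows "exp_H (t - t') (b + t\<^sup>2) (b' + t'\<^sup>2) = gauss (t' - t) (b' - b) * (exp (b * t + 2 * t ^ 3 / 3) * exp (- (b' * t' + 2 * t' ^ 3 / 3)))"
proof -
  define s where "s = t' - t"
  have s: "s > 0" and t': "t' = t + s" using assms by (auto simp: s_def)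
  let ?u = "b + t\<^sup>2" and ?w = "b' + t'\<^sup>2"
  have "exp_H (t - t') ?u ?w = (LBINT m. exp (s * m) * Ai (?u + m) * Ai (?w + m))"
    unfolding exp_H_def by (subst lborel_integral_real_affine[where c = "-1" and t = 0]) (auto simp: s_def algebra_simps)
  also have "\<dots> = exp (- (?u - ?w)\<^sup>2 / (4 * s) + (s ^ 3 / 12 - s * (?u + ?w) / 2)) / sqrt (4 * pi * s)"
    by (simp only: integral_exp_Ai_Ai[OF s] gauss_eq[OF s] exp_add times_divide_eq_left)
  also have "- (?u - ?w)\<^sup>2 / (4 * s) + (s ^ 3 / 12 - s * (?u + ?w) / 2)
     = - (b' - b)\<^sup>2 / (4 * s) + ((b * t + 2 * t ^ 3 / 3) + - (b' * t' + 2 * t' ^ 3 / 3))"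
    using s unfolding t' by (simp add: field_simps power2_eq_square power3_eq_cube)
  also have "exp \<dots> / sqrt (4 * pi * s) = gauss s (b' - b) * (exp (b * t + 2 * t ^ 3 / 3) * exp (- (b' * t' + 2 * t' ^ 3 / 3)))"
    unfolding gauss_eq[OF s] exp_add by simp
  finally show ?thesis by (simp only: s_def)
qed

text \<open>The expectation of \<open>airy_heat\<close> at the last time over the paths that stay
  below all levels: the full martingale value without the contribution of a first passage.\<close>

definition survive :: "(real \<times> real) list \<Rightarrow> real \<Rightarrow> real \<Rightarrow> real" where
  "survive ps l b = airy_heat (fst (hd ps)) (b - l) - first_hit ps l b"

lemma survive_measurable [measurable (raw)]:
  assumes [measurable]: "f \<in> borel_measurable M" "g \<in> borel_measurable M"
  shows "(\<lambda>z. survive ps (f z) (g z)) \<in> borel_measurable M"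
  unfolding survive_def by measurable

text \<open>The rate \<open>a\<close> can be taken above any \<open>a0\<close>, so that
  \<open>exp (a * l)\<close> absorbs the factor \<open>exp (- t0 * l)\<close> of the chain for
  \<open>l < 0\<close>.\<close>

lemma survive_bound:
  assumes "increasing ps"
  shows "\<exists>a C. a0 \<le> a \<and> 0 \<le> C \<and> (\<forall>l\<le>0. \<forall>b. \<bar>survive ps l b\<bar> \<le> C * exp (a * l) * exp (- a * b))"
proof -
  define t where "t = fst (hd ps)"
  define a where "a = max a0 (t + 1)"
  have a: "t < a" "a0 \<le> a" by (auto simp: a_def)
  obtain C where C: "0 \<le> C" "\<And>l b. l \<le> 0 \<Longrightarrow> \<bar>first_hit ps l b\<bar> \<le> C * exp (a * l) * exp (- a * b)"
    using first_hit_exp_bound[OF assms] by blast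
  have "\<bar>survive ps l b\<bar> \<le> (heat_const t a + C) * exp (a * l) * exp (- a * b)" if "l \<le> 0" for l b
  proof -
    have "\<bar>airy_heat t (b - l)\<bar> \<le> heat_const t a * exp (- a * (b - l))" by (rule airy_heat_exp_bound[OF a(1)])
    also have "- a * (b - l) = a * l + - a * b" by (simp add: algebra_simps)
    finally have "\<bar>airy_heat t (b - l)\<bar> \<le> heat_const t a * exp (a * l) * exp (- a * b)" by (simp only: exp_add mult.assoc)
    then show ?thesis using C(2)[OF that, of b] unfolding survive_def t_def[symmetric] distrib_right by linarith
  qed
  then show ?thesis using a(2) C(1) heat_const_pos[OF a(1)] by (intro exI[of _ a] exI[of _ "heat_const t a + C"]) auto
qed

lemma airy_heat_shift:
  "exp (- s * l) * exp (b * t + 2 * t ^ 3 / 3) * airy_heat t (b - l) = exp ((t - s) * l) * Ai (b + t\<^sup>2 - l)"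
proof -
  have "exp (- s * l) * exp (b * t + 2 * t ^ 3 / 3) * exp (- 2 * t ^ 3 / 3 - (b - l) * t) = exp ((t - s) * l)"
    by (simp add: algebra_simps flip: exp_add)
  then show ?thesis unfolding airy_heat_def by (simp add: algebra_simps)
qed

definition parabolic_shift :: "real \<times> real \<Rightarrow> real \<times> real" where
  "parabolic_shift p = (fst p, snd p + (fst p)\<^sup>2)"

text \<open>Induction from the last time. There the kernel is an integral over the spectral variable
  \<open>l\<close>, and the Airy function is \<open>airy_heat\<close> up to the gauge factor. Each
  earlier step applies a heat kernel under this integral and then the cut-off at the level, which is
  the recursion behind \<open>survive\<close>.\<close>

lemma airy_chain_survive:
  assumes "increasing ps" "ps \<noteq> []"
  shows "airy_chain t0 (map parabolic_shift ps) (b + (fst (hd ps))\<^sup>2) v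
    = (LBINT l. exp (- t0 * l) * exp (b * fst (hd ps) + 2 * (fst (hd ps)) ^ 3 / 3) * survive ps l b * airy_neg v l)"
  using assms
proof (induction ps arbitrary: b)
  case (Cons p ps)
  define t where "t = fst p"
  have ind: "indicator {..snd p + t\<^sup>2} (b + t\<^sup>2) = (if snd p < b then 0 else 1 :: real)" by (auto split: split_indicator)
  let ?E = "\<lambda>l. exp (- t0 * l) * exp (b * t + 2 * t ^ 3 / 3)"
  show ?case
  proof (cases ps)
    case Nil
    have "airy_chain t0 (map parabolic_shift (p # ps)) (b + t\<^sup>2) v = (if snd p < b then 0 else 1) * exp_H_K (t - t0) (b + t\<^sup>2) v"
      by (simp add: Nil parabolic_shift_def t_def[symmetric] ind)
    also have "exp_H_K (t - t0) (b + t\<^sup>2) v = (LBINT l. ?E l * airy_heat t (b - l) * airy_neg v l)"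
      unfolding exp_H_K_def set_lebesgue_integral_def airy_heat_shift
    proof (rule integral_cong_AE)
      show "AE l in lborel. indicator {..0} l *\<^sub>R (exp (l * (t - t0)) * Ai (b + t\<^sup>2 - l) * Ai (v - l))
          = exp ((t - t0) * l) * Ai (b + t\<^sup>2 - l) * airy_neg v l"
        using AE_lborel_singleton[of 0]
        by eventually_elim (auto simp: airy_neg_def mult_ac split: split_indicator)
    qed measurable
    also have "(if snd p < b then 0 else 1) * \<dots> = (LBINT l. ?E l * survive (p # ps) l b * airy_neg v l)"
      by (simp add: survive_def Nil t_def)
    finally show ?thesis by (simp add: t_def)
  next
    case (Cons q qs)
    define t' where "t' = fst q"
    define s where "s = t' - t"
    have tt': "t < t'" and s: "s > 0" using Cons.prems Cons by (auto simp: t_def t'_def s_def)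
    have inc: "increasing ps" using Cons.prems by simp
    have IH: "airy_chain t0 (map parabolic_shift ps) (b' + t'\<^sup>2) v
       = (LBINT l. exp (- t0 * l) * exp (b' * t' + 2 * t' ^ 3 / 3) * survive ps l b' * airy_neg v l)" for b'
      using Cons.IH[of b'] inc Cons by (simp add: t'_def)
    obtain a C where aC: "t0 \<le> a" "0 \<le> C" "\<And>l b. l \<le> 0 \<Longrightarrow> \<bar>survive ps l b\<bar> \<le> C * exp (a * l) * exp (- a * b)"
      using survive_bound[OF inc] by blast
    let ?D = "exp (b * t + 2 * t ^ 3 / 3)"
    let ?f = "\<lambda>b' l. ?D * gauss s (b' - b) * (exp (- t0 * l) * survive ps l b' * airy_neg v l)"
    have "airy_chain t0 (map parabolic_shift (p # ps)) (b + t\<^sup>2) v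
       = (if snd p < b then 0 else 1) * (LBINT w. exp_H (t - t') (b + t\<^sup>2) w * airy_chain t0 (map parabolic_shift ps) w v)"
      by (simp add: Cons parabolic_shift_def t_def[symmetric] t'_def[symmetric] ind)
    also have "(LBINT w. exp_H (t - t') (b + t\<^sup>2) w * airy_chain t0 (map parabolic_shift ps) w v)
       = (LBINT b'. exp_H (t - t') (b + t\<^sup>2) (b' + t'\<^sup>2) * airy_chain t0 (map parabolic_shift ps) (b' + t'\<^sup>2) v)"
      by (subst lborel_integral_real_affine[where c = 1 and t = "t'\<^sup>2"]) (auto simp: add.commute)
    also have "\<dots> = (LBINT b'. (LBINT l. ?f b' l))"
    proof (rule Bochner_Integration.integral_cong[OF refl])
      fix b'
      have e: "exp (- (b' * t' + 2 * t' ^ 3 / 3)) * exp (b' * t' + 2 * t' ^ 3 / 3) = 1" by (simp flip: exp_add)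
      have "exp_H (t - t') (b + t\<^sup>2) (b' + t'\<^sup>2) * (exp (- t0 * l) * exp (b' * t' + 2 * t' ^ 3 / 3) * survive ps l b' * airy_neg v l)
        = (exp (- (b' * t' + 2 * t' ^ 3 / 3)) * exp (b' * t' + 2 * t' ^ 3 / 3)) * ?f b' l" for l
        unfolding exp_H_parabola[OF tt'] s_def by (simp only: mult_ac)
      note pt = this
      have "exp_H (t - t') (b + t\<^sup>2) (b' + t'\<^sup>2) * airy_chain t0 (map parabolic_shift ps) (b' + t'\<^sup>2) v
        = (LBINT l. exp_H (t - t') (b + t\<^sup>2) (b' + t'\<^sup>2) * (exp (- t0 * l) * exp (b' * t' + 2 * t' ^ 3 / 3) * survive ps l b' * airy_neg v l))"
        by (simp only: IH integral_mult_right_zero)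
      then show "exp_H (t - t') (b + t\<^sup>2) (b' + t'\<^sup>2) * airy_chain t0 (map parabolic_shift ps) (b' + t'\<^sup>2) v = (LBINT l. ?f b' l)"
        by (simp only: pt e mult_1_left)
    qed
    also have "\<dots> = (LBINT l. (LBINT b'. ?f b' l))"
    proof (rule Fubini_dominated[OF lborel_pair_sigma_finite])
      have "integrable lborel (\<lambda>x. gauss s (- b + 1 * x) * exp ((- a) * (- b + 1 * x)))"
        by (rule lborel_integrable_real_affine[OF integrable_gauss_exp[OF s]]) simp
      then have "integrable lborel (\<lambda>x. (?D * C * airy_const 1 * exp (- v) * exp (- a * b)) * (gauss s (- b + 1 * x) * exp ((- a) * (- b + 1 * x))))"
        by (rule integrable_mult_right)
      moreover have exps: "exp (- a * b) * exp ((- a) * (- b + 1 * x)) = exp (- a * x)" for x by (simp add: algebra_simps flip: exp_add)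
      have "(?D * C * airy_const 1 * exp (- v) * exp (- a * b)) * (gauss s (- b + 1 * x) * exp ((- a) * (- b + 1 * x)))
         = (?D * C * airy_const 1 * exp (- v)) * (gauss s (x - b) * exp (- a * x))" for x
      proof -
        have "(?D * C * airy_const 1 * exp (- v) * exp (- a * b)) * (gauss s (- b + 1 * x) * exp ((- a) * (- b + 1 * x)))
          = (?D * C * airy_const 1 * exp (- v)) * (gauss s (- b + 1 * x) * (exp (- a * b) * exp ((- a) * (- b + 1 * x))))"
          by (simp only: mult_ac)
        also have "\<dots> = (?D * C * airy_const 1 * exp (- v)) * (gauss s (x - b) * exp (- a * x))"
          using exps by (simp only: mult_1_left uminus_add_conv_diff)
        finally show ?thesis .
      qed
      ultimately show "integrable lborel (\<lambda>x. (?D * C * airy_const 1 * exp (- v)) * (gauss s (x - b) * exp (- a * x)))"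
        by (simp only:)
      show "integrable lborel exp_half" by (rule integrable_exp_half)
      show "norm (?f b' l) \<le> (?D * C * airy_const 1 * exp (- v)) * (gauss s (b' - b) * exp (- a * b')) * exp_half l" for b' l
      proof (cases "l < 0")
        case True
        have "\<bar>exp (- t0 * l) * survive ps l b' * airy_neg v l\<bar> \<le> exp (- t0 * l) * (C * exp (a * l) * exp (- a * b')) * (airy_const 1 * exp (- 1 * v) * exp_half l)"
          unfolding abs_mult using True aC(2) by (intro mult_mono aC(3) airy_neg_le) auto
        also have "\<dots> = exp ((a - t0) * l) * (C * exp (- a * b') * (airy_const 1 * exp (- v) * exp_half l))"
          by (simp add: algebra_simps exp_diff exp_minus divide_inverse)
        also have "\<dots> \<le> 1 * (C * exp (- a * b') * (airy_const 1 * exp (- v) * exp_half l))"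
          using True aC(1,2) airy_const_pos[of 1] by (intro mult_right_mono) (auto simp: mult_nonneg_nonpos)
        finally have "?D * gauss s (b' - b) * \<bar>exp (- t0 * l) * survive ps l b' * airy_neg v l\<bar>
          \<le> ?D * gauss s (b' - b) * (1 * (C * exp (- a * b') * (airy_const 1 * exp (- v) * exp_half l)))"
          by (rule mult_left_mono) simp
        then show ?thesis by (simp add: abs_mult mult_ac)
      qed (use aC(2) airy_const_pos[of 1] in \<open>simp add: airy_neg_def\<close>)
    qed measurable
    also have "\<dots> = (LBINT l. ?E l * (airy_heat t (b - l) - heat_conv s (first_hit ps l) b) * airy_neg v l)"
    proof (rule Bochner_Integration.integral_cong[OF refl])
      fix l
      show "(LBINT b'. ?f b' l) = ?E l * (airy_heat t (b - l) - heat_conv s (first_hit ps l) b) * airy_neg v l"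
      proof (cases "l < 0")
        case True
        have "(LBINT b'. ?f b' l) = (LBINT b'. (?E l * airy_neg v l) * (gauss s (b' - b) * survive ps l b'))" by (simp only: mult_ac)
        also have "\<dots> = (?E l * airy_neg v l) * (LBINT b'. gauss s (b' - b) * survive ps l b')" by (rule integral_mult_right_zero)
        also have "(LBINT b'. gauss s (b' - b) * survive ps l b') = heat_conv s (survive ps l) b"
          unfolding heat_conv_def by (subst lborel_integral_real_affine[where c = 1 and t = b]) auto
        also have "\<dots> = heat_conv s (\<lambda>b. airy_heat (t + s) (b - l)) b - heat_conv s (first_hit ps l) b"
          unfolding survive_def[abs_def] using Cons True
          by (subst heat_conv_diff[OF s exp_growth_airy_heat rapidly_decaying_imp_exp_growth[OF rapidly_decaying_first_hit[OF inc]]])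
            (auto simp: t'_def[symmetric] s_def)
        finally show ?thesis by (simp add: heat_conv_airy_heat[OF s] mult_ac)
      qed (simp add: airy_neg_def)
    qed
    also have "(if snd p < b then 0 else 1) * \<dots> = (LBINT l. ?E l * survive (p # ps) l b * airy_neg v l)"
      by (simp add: survive_def t_def[symmetric] Cons t'_def[symmetric] s_def)
    finally show ?thesis by (simp add: t_def)
  qed
qed simp

definition hit_profile :: "(real \<times> real) list \<Rightarrow> real \<Rightarrow> real \<Rightarrow> real" where
  "hit_profile ps l y = indicator {..<0} l * first_hit ps l y"

lemma hit_profile_measurable [measurable]: "case_prod (hit_profile ps) \<in> borel_measurable (borel \<Otimes>\<^sub>M borel)"
  unfolding hit_profile_def by measurable

text \<open>Subtracting \<open>K_Ai\<close> removes the martingale part of \<open>survive\<close>,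
  so the operator is the product of \<open>F\<close>, which contains the first passage, and the
  cut-off adjoint Airy transform \<open>G'\<close>. In the reverse order it lives on
  \<open>l < 0\<close> and pairs \<open>airy_heat\<close> with \<open>first_hit\<close> at the first
  time, and \<open>split_form_append\<close> moves the splitting time to 0.\<close>

lemma has_fredholm_det_airy_chain:
  fixes qs ps G
  defines "L \<equiv> rev qs @ (0, G) # ps"
  assumes inc: "increasing L"
    and det: "has_fredholm_det (\<lambda>u v. - K_Ai u v + airy_chain (fst (hd L)) (map parabolic_shift L) u v) d"
    and pair: "scattering_pair (hit_profile ((0, G) # map reflect qs)) (hit_profile ((0, G) # ps)) C"
  shows "has_fredholm_det (scattering_pair.half_kernel (hit_profile ((0, G) # map reflect qs)) (hit_profile ((0, G) # ps))) d"
proof -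
  interpret scattering_pair "hit_profile ((0, G) # map reflect qs)" "hit_profile ((0, G) # ps)" C by fact
  define t where "t = fst (hd L)"
  have L: "L \<noteq> []" by (simp add: L_def)
  define E where "E = (\<lambda>l b. exp (- t * l) * exp (b * t + 2 * t ^ 3 / 3))"
  define F where "F = (\<lambda>u l. - (indicator {..<0} l * E l (u - t\<^sup>2) * first_hit L l (u - t\<^sup>2)))"
  define G' where "G' = (\<lambda>l v. airy_neg v l)"
  \<comment> \<open>At least \<open>t + 1\<close>, so that the bound still contains
    \<open>exp l\<close> after the factor \<open>exp (- t * l)\<close> of \<open>E\<close>.\<close>
  define \<alpha> where "\<alpha> = \<bar>t\<bar> + 1"
  have \<alpha>: "t + 1 \<le> \<alpha>" by (simp add: \<alpha>_def)
  \<comment> \<open>The tilt \<open>exp ((- t) * b)\<close> cancels the factor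
    \<open>exp (b * t)\<close> of \<open>E\<close>, and the rate 2 beats the growth of
    \<open>G'\<close>.\<close>
  obtain D where D: "0 \<le> D" "\<And>l b. l \<le> 0 \<Longrightarrow> \<bar>first_hit L l b\<bar> \<le> D * exp (\<alpha> * l) * exp ((- t) * b) * exp (- 2 * \<bar>b\<bar>)"
    using first_hit_exp_abs_bound[OF inc] by blast
  have F_le: "\<bar>F u l\<bar> \<le> (exp (2 * t ^ 3 / 3) * D * exp (- 2 * \<bar>u - t\<^sup>2\<bar>)) * exp_half l" for u l
  proof (cases "l < 0")
    case True
    let ?b = "u - t\<^sup>2"
    have "\<bar>F u l\<bar> \<le> E l ?b * (D * exp (\<alpha> * l) * exp ((- t) * ?b) * exp (- 2 * \<bar>?b\<bar>))"
      using D(2)[of l ?b] True by (auto simp: F_def E_def abs_mult intro!: mult_left_mono)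
    also have "\<dots> = exp (2 * t ^ 3 / 3) * D * exp (- 2 * \<bar>?b\<bar>) * exp ((\<alpha> - t) * l)"
    proof -
      have "- t * l + (?b * t + 2 * t ^ 3 / 3) + (\<alpha> * l + ((- t) * ?b + - 2 * \<bar>?b\<bar>)) = 2 * t ^ 3 / 3 + - 2 * \<bar>?b\<bar> + (\<alpha> - t) * l"
        by (simp add: algebra_simps)
      then have "exp (- t * l) * exp (?b * t + 2 * t ^ 3 / 3) * (exp (\<alpha> * l) * (exp ((- t) * ?b) * exp (- 2 * \<bar>?b\<bar>)))
        = exp (2 * t ^ 3 / 3) * exp (- 2 * \<bar>?b\<bar>) * exp ((\<alpha> - t) * l)"
        by (simp only: exp_add[symmetric])
      then show ?thesis by (simp only: E_def mult_ac)
    qed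
    also have "\<dots> \<le> exp (2 * t ^ 3 / 3) * D * exp (- 2 * \<bar>?b\<bar>) * exp (1 * l)"
    proof (intro mult_left_mono)
      have "(\<alpha> - t) * l \<le> 1 * l" using \<alpha> True by (intro mult_right_mono_neg) auto
      then show "exp ((\<alpha> - t) * l) \<le> exp (1 * l)" by simp
    qed (use D(1) in auto)
    finally show ?thesis using True by (simp add: exp_half_def)
  qed (simp add: F_def exp_half_def)
  have G'_le: "\<bar>G' l v\<bar> \<le> exp_half l * (airy_const 1 * exp (- v))" for l v
    using airy_neg_le[of 1 v l] by (simp add: G'_def mult_ac)
  have [measurable]: "case_prod F \<in> borel_measurable (borel \<Otimes>\<^sub>M borel)" "case_prod G' \<in> borel_measurable (borel \<Otimes>\<^sub>M borel)"
    unfolding F_def G'_def E_def by measurable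
  have half2: "integrable lborel (\<lambda>l. exp_half l * exp_half l)"
    by (rule integrable_dominated[OF _ integrable_exp_half]) (auto intro!: mult_left_le exp_half_le_1)
  have FG: "(\<lambda>u v. - K_Ai u v + airy_chain (fst (hd L)) (map parabolic_shift L) u v) = (\<lambda>u v. LBINT l. F u l * G' l v)"
  proof (intro ext)
    fix u v
    define b where "b = u - t\<^sup>2"
    have u: "u = b + t\<^sup>2" by (simp add: b_def)
    have iA: "integrable lborel (\<lambda>l. Ai (u - l) * airy_neg v l)"
      by (rule integrable_airy_transform[where B = "airy_const 1 * exp (- 1 * v)"]) (use airy_neg_le[of 1] in auto)
    have iF: "integrable lborel (\<lambda>l. F u l * G' l v)"
    proof (rule integrable_dominated)
      show "integrable lborel (\<lambda>l. (exp (2 * t ^ 3 / 3) * D * exp (- 2 * \<bar>u - t\<^sup>2\<bar>)) * (airy_const 1 * exp (- v)) * (exp_half l * exp_half l))"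
        using half2 by (rule integrable_mult_right)
      show "norm (F u l * G' l v) \<le> (exp (2 * t ^ 3 / 3) * D * exp (- 2 * \<bar>u - t\<^sup>2\<bar>)) * (airy_const 1 * exp (- v)) * (exp_half l * exp_half l)" for l
        using mult_mono[OF F_le[of u l] G'_le[of l v]] D(1) by (simp add: abs_mult mult_ac)
    qed measurable
    have "airy_chain (fst (hd L)) (map parabolic_shift L) u v = (LBINT l. E l b * survive L l b * airy_neg v l)"
      using airy_chain_survive[OF inc L, of t b v] by (simp add: u t_def E_def)
    also have "\<dots> = (LBINT l. Ai (u - l) * airy_neg v l + F u l * G' l v)"
    proof (rule Bochner_Integration.integral_cong[OF refl])
      fix l
      have "E l b * airy_heat t (b - l) = Ai (u - l)"
        using airy_heat_shift[of t l b t] by (simp add: E_def u)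
      then show "E l b * survive L l b * airy_neg v l = Ai (u - l) * airy_neg v l + F u l * G' l v"
        by (simp add: survive_def t_def[symmetric] F_def G'_def b_def[symmetric] airy_neg_def algebra_simps split: split_indicator)
    qed
    also have "\<dots> = K_Ai u v + (LBINT l. F u l * G' l v)"
      using iA iF by (simp add: K_Ai_eq airy_transform_def)
    finally show "- K_Ai u v + airy_chain (fst (hd L)) (map parabolic_shift L) u v = (LBINT l. F u l * G' l v)" by simp
  qed
  have "has_fredholm_det (\<lambda>l m. LBINT x. G' l x * F x m) d"
  proof (rule has_fredholm_det_cyclic[THEN iffD1, OF _ _ F_le G'_le])
    have "integrable lborel (\<lambda>x. exp (- 1 * \<bar>- (t\<^sup>2) + 1 * x\<bar>))"
      by (rule lborel_integrable_real_affine[OF integrable_exp_abs]) auto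
    then have i: "integrable lborel (\<lambda>x. (exp (2 * t ^ 3 / 3) * D * airy_const 1 * exp (- (t\<^sup>2))) * exp (- 1 * \<bar>- (t\<^sup>2) + 1 * x\<bar>))"
      by (rule integrable_mult_right)
    show "integrable lborel (\<lambda>x. exp (2 * t ^ 3 / 3) * D * exp (- 2 * \<bar>x - t\<^sup>2\<bar>) * (airy_const 1 * exp (- x)))"
    proof (rule integrable_dominated[OF _ i])
      fix x
      have "exp (- 2 * \<bar>x - t\<^sup>2\<bar>) * exp (- x) \<le> exp (- (t\<^sup>2)) * exp (- 1 * \<bar>- (t\<^sup>2) + 1 * x\<bar>)"
        by (simp add: abs_if flip: exp_add)
      then have "(exp (2 * t ^ 3 / 3) * D * airy_const 1) * (exp (- 2 * \<bar>x - t\<^sup>2\<bar>) * exp (- x))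
         \<le> (exp (2 * t ^ 3 / 3) * D * airy_const 1) * (exp (- (t\<^sup>2)) * exp (- 1 * \<bar>- (t\<^sup>2) + 1 * x\<bar>))"
        using D(1) airy_const_pos[of 1] by (intro mult_left_mono) auto
      then show "norm (exp (2 * t ^ 3 / 3) * D * exp (- 2 * \<bar>x - t\<^sup>2\<bar>) * (airy_const 1 * exp (- x)))
        \<le> (exp (2 * t ^ 3 / 3) * D * airy_const 1 * exp (- (t\<^sup>2))) * exp (- 1 * \<bar>- (t\<^sup>2) + 1 * x\<bar>)"
        using D(1) airy_const_pos[of 1] by (simp add: abs_mult mult_ac)
    qed measurable
    show "integrable lborel (\<lambda>l. exp_half l * exp_half l)" by (rule half2)
    show "has_fredholm_det (\<lambda>x z. LBINT l. F x l * G' l z) d" using det FG by simp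
  qed (use D(1) airy_const_pos[of 1] in auto)
  \<comment> \<open>The gauge factors at the first time leave a conjugation by
    \<open>exp (t * l)\<close>, which the determinant does not see.\<close>
  also have "(\<lambda>l m. LBINT x. G' l x * F x m) = (\<lambda>l m. exp (t * l) * half_kernel l m / exp (t * m))"
  proof (intro ext)
    fix l m
    show "(LBINT x. G' l x * F x m) = exp (t * l) * half_kernel l m / exp (t * m)"
    proof (cases "l < 0 \<and> m < 0")
      case False
      then have "half_kernel l m = 0" using half_kernel_le[of l m] by (auto simp: exp_half_def)
      moreover have "(\<lambda>x. G' l x * F x m) = (\<lambda>x. 0)" using False by (auto simp: G'_def F_def airy_neg_def)
      ultimately show ?thesis by (simp only:) simp
    next
      case True
      have pt: "G' l (t\<^sup>2 + 1 * b) * F (t\<^sup>2 + 1 * b) m = (exp (t * l) / exp (t * m)) * - (airy_heat (- t) (b - l) * first_hit L m b)" for b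
      proof -
        have "exp (- (- t) * l) * exp (b * (- t) + 2 * (- t) ^ 3 / 3) * airy_heat (- t) (b - l) = exp ((- t - - t) * l) * Ai (b + (- t)\<^sup>2 - l)"
          by (rule airy_heat_shift)
        then have A: "Ai (b + t\<^sup>2 - l) = exp (t * l) * exp (- (b * t + 2 * t ^ 3 / 3)) * airy_heat (- t) (b - l)" by simp
        have e: "exp (- (b * t + 2 * t ^ 3 / 3)) * exp (b * t + 2 * t ^ 3 / 3) = 1" by (simp flip: exp_add)
        have "G' l (t\<^sup>2 + 1 * b) * F (t\<^sup>2 + 1 * b) m = - (Ai (b + t\<^sup>2 - l) * (exp (- t * m) * exp (b * t + 2 * t ^ 3 / 3) * first_hit L m b))"
          using True by (simp add: G'_def F_def airy_neg_def E_def add.commute[of "t\<^sup>2" b])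
        also have "\<dots> = - ((exp (- (b * t + 2 * t ^ 3 / 3)) * exp (b * t + 2 * t ^ 3 / 3)) * (exp (t * l) * exp (- t * m) * (airy_heat (- t) (b - l) * first_hit L m b)))"
          unfolding A by (simp only: mult_ac)
        finally show ?thesis unfolding e by (simp add: exp_minus divide_inverse)
      qed
      have "(LBINT x. G' l x * F x m) = (LBINT b. G' l (t\<^sup>2 + 1 * b) * F (t\<^sup>2 + 1 * b) m)"
        by (subst lborel_integral_real_affine[where c = 1 and t = "t\<^sup>2"]) auto
      also have "\<dots> = (exp (t * l) / exp (t * m)) * - (LBINT b. airy_heat (- t) (b - l) * first_hit L m b)"
        unfolding pt by (simp only: integral_mult_right_zero Bochner_Integration.integral_minus)
      also have "- (LBINT b. airy_heat (- t) (b - l) * first_hit L m b) = split_form [] L l m"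
        by (simp add: split_form_Nil t_def)
      also have "\<dots> = split_form (rev (rev qs) @ []) ((0, G) # ps) l m"
        unfolding L_def by (rule split_form_append) (use inc True in \<open>auto simp: L_def\<close>)
      also have "\<dots> = split_form qs ((0, G) # ps) l m" by simp
      also have "\<dots> = half_kernel l m"
      proof -
        have "\<forall>q\<in>set qs. fst q < 0" "increasing ((0, G) # ps)" "sorted_wrt (\<lambda>p q. fst q < fst p) qs"
          using inc by (auto simp: L_def sorted_wrt_append sorted_wrt_rev)
        then have "split_form qs ((0, G) # ps) l m
          = - (LBINT y. Ai (y - l) * first_hit ((0, G) # ps) m y + first_hit ((0, G) # map reflect qs) l y * Ai (y - m)
             - first_hit ((0, G) # map reflect qs) l y * first_hit ((0, G) # ps) m y)"
          using True by (intro split_form_zero) (auto simp: sorted_wrt_map)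
        also have "\<dots> = half_kernel l m"
          unfolding half_kernel_def deficit_def using True by (simp add: hit_profile_def airy_neg_def del: first_hit.simps)
        finally show ?thesis .
      qed
      finally show ?thesis by simp
    qed
  qed
  finally show ?thesis by (subst (asm) has_fredholm_det_conjugate) auto
qed

section \<open>Bounds above a parabola\<close>

lemma cubic_bounded_above:
  fixes p0 p1 p2 p3 :: real
  assumes "p3 < 0"
  shows "\<exists>K. \<forall>t\<ge>0. p3 * t ^ 3 + p2 * t\<^sup>2 + p1 * t + p0 \<le> K"
proof -
  define q where "q = \<bar>p2\<bar> + \<bar>p1\<bar>"
  define T where "T = max 1 (q / - p3)"
  have q: "0 \<le> q" and T: "1 \<le> T" by (auto simp: q_def T_def)
  have "p3 * t ^ 3 + p2 * t\<^sup>2 + p1 * t + p0 \<le> q * T\<^sup>2 + \<bar>p0\<bar>" if t: "0 \<le> t" for t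
  proof (cases "t \<le> T")
    case True
    have "T \<le> T\<^sup>2" using T by (simp add: self_le_power)
    have "p3 * t ^ 3 \<le> 0" using assms t by (simp add: mult_nonpos_nonneg)
    moreover have "p2 * t\<^sup>2 \<le> \<bar>p2\<bar> * T\<^sup>2"
      using True t by (intro mult_mono power_mono) auto
    moreover have "p1 * t \<le> \<bar>p1\<bar> * T\<^sup>2"
      using True t T by (intro mult_mono) (auto intro: order_trans[OF True \<open>T \<le> T\<^sup>2\<close>])
    ultimately show ?thesis by (simp add: q_def distrib_right)
  next
    case False
    then have t1: "1 \<le> t" "q / - p3 \<le> t" using T by (auto simp: T_def)
    have "t \<le> t\<^sup>2" using t1(1) by (simp add: self_le_power)
    then have "p1 * t \<le> \<bar>p1\<bar> * t\<^sup>2" using t by (intro mult_mono) auto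
    moreover have "p2 * t\<^sup>2 \<le> \<bar>p2\<bar> * t\<^sup>2" by (intro mult_right_mono) auto
    moreover have "q * t\<^sup>2 \<le> (- p3 * t) * t\<^sup>2"
      using t1(2) assms by (intro mult_right_mono) (auto simp: field_simps)
    ultimately have "p3 * t ^ 3 + p2 * t\<^sup>2 + p1 * t \<le> 0"
      by (simp add: q_def power3_eq_cube power2_eq_square algebra_simps)
    moreover have "0 \<le> q * T\<^sup>2" using q by simp
    ultimately show ?thesis by linarith
  qed
  then show ?thesis by blast
qed

text \<open>The contour through \<open>a = 3 t / 2 + \<alpha>\<close> is optimal on the critical parabola \<open>c - 3 t\<^sup>2 / 4\<close>, where the
  cubic terms in \<open>t\<close> cancel.\<close>

lemma airy_heat_parabola_bound:
  assumes \<kappa>: "\<kappa> < 3 / 4" and \<alpha>: "0 < \<alpha>" and A: "- \<alpha> \<le> A"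
  shows "\<exists>C\<ge>0. \<forall>t\<ge>0. \<forall>b\<ge>c - \<kappa> * t\<^sup>2. \<forall>l\<le>0. \<bar>airy_heat t (b - l)\<bar> \<le> C * exp (\<alpha> * l) * exp (A * b - A\<^sup>2 * t)"
proof -
  \<comment> \<open>The coefficient of \<open>t ^ 3\<close> in the exponent for
    \<open>a = 3 * t / 2 + \<alpha>\<close> on the parabola. It equals
    \<open>- 9 / 8 + 3 * \<kappa> / 2\<close>, which is negative exactly for
    \<open>\<kappa> < 3 / 4\<close>.\<close>
  define p3 where "p3 = 9 / 8 - 9 / 4 + 3 * \<kappa> / 2"
  define p2 where "p2 = 9 * \<alpha> / 4 - 3 * \<alpha> + \<alpha> * \<kappa> + A * \<kappa>"
  define p1 where "p1 = 3 * \<alpha>\<^sup>2 / 2 - \<alpha>\<^sup>2 - 3 * c / 2 + A\<^sup>2"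
  define p0 where "p0 = \<alpha> ^ 3 / 3 - \<alpha> * c - A * c"
  have "p3 < 0" using \<kappa> by (simp add: p3_def)
  then obtain K where K: "\<And>t. 0 \<le> t \<Longrightarrow> p3 * t ^ 3 + p2 * t\<^sup>2 + p1 * t + p0 \<le> K"
    using cubic_bounded_above[of p3 p2 p1 p0] by blast
  define C where "C = exp K / (2 * sqrt (pi * \<alpha>))"
  have "\<bar>airy_heat t (b - l)\<bar> \<le> C * exp (\<alpha> * l) * exp (A * b - A\<^sup>2 * t)" if t: "0 \<le> t" and b: "c - \<kappa> * t\<^sup>2 \<le> b" and l: "l \<le> 0" for t b l
  proof -
    define a where "a = 3 * t / 2 + \<alpha>"
    have at: "\<alpha> \<le> a - t" "t < a" "\<alpha> \<le> a" using t \<alpha> by (auto simp: a_def)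
    have expo: "a ^ 3 / 3 - t * a\<^sup>2 + - a * (b - l) \<le> K + (\<alpha> * l + (A * b - A\<^sup>2 * t))"
    proof -
      have "a * l \<le> \<alpha> * l" using at(3) l by (rule mult_right_mono_neg)
      \<comment> \<open>As \<open>A + a\<close> is not negative, the exponent is largest for
        \<open>b\<close> on the parabola.\<close>
      moreover have "0 \<le> (A + a) * (b - (c - \<kappa> * t\<^sup>2))" using A at b by (intro mult_nonneg_nonneg) auto
      moreover have "a ^ 3 / 3 - t * a\<^sup>2 - a * (c - \<kappa> * t\<^sup>2) - A * (c - \<kappa> * t\<^sup>2) + A\<^sup>2 * t = p3 * t ^ 3 + p2 * t\<^sup>2 + p1 * t + p0"
        by (simp add: a_def p3_def p2_def p1_def p0_def power3_eq_cube power2_eq_square field_simps)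
      moreover note K[OF t]
      ultimately show ?thesis by (simp add: algebra_simps)
    qed
    have "\<bar>airy_heat t (b - l)\<bar> \<le> heat_const t a * exp (- a * (b - l))" by (rule airy_heat_exp_bound[OF at(2)])
    also have "\<dots> = exp (a ^ 3 / 3 - t * a\<^sup>2 + - a * (b - l)) / (2 * sqrt (pi * (a - t)))"
      by (simp only: heat_const_def exp_add times_divide_eq_left)
    also have "\<dots> \<le> exp (K + (\<alpha> * l + (A * b - A\<^sup>2 * t))) / (2 * sqrt (pi * \<alpha>))"
      using expo at(1) \<alpha> by (intro frac_le) auto
    also have "\<dots> = C * exp (\<alpha> * l) * exp (A * b - A\<^sup>2 * t)" by (simp add: C_def exp_add)
    finally show ?thesis .
  qed
  moreover have "0 \<le> C" using \<alpha> by (simp add: C_def)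
  ultimately show ?thesis by blast
qed

section \<open>First passage of a Brownian path\<close>

primrec path_hit :: "(real \<times> real) list \<Rightarrow> real \<Rightarrow> (real \<Rightarrow> real) \<Rightarrow> real" where
  "path_hit [] l B = 0"
| "path_hit (p # ps) l B = (if snd p < B (fst p) then airy_heat (fst p) (B (fst p) - l) else path_hit ps l B)"

text \<open>The path is read through its increments, which are independent; \<open>k\<close> is the
  index of the increment that follows the current time.\<close>

primrec inc_hit :: "(real \<times> real) list \<Rightarrow> nat \<Rightarrow> real \<Rightarrow> real \<Rightarrow> (nat \<Rightarrow> real) \<Rightarrow> real" where
  "inc_hit [] k l b x = 0"
| "inc_hit (p # ps) k l b x = (if snd p < b then airy_heat (fst p) (b - l) else inc_hit ps (Suc k) l (b + x k) x)"

lemma path_hit_eq_inc_hit: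
  assumes "\<And>i. Suc i < length ps \<Longrightarrow> x (k + i) = B (fst (ps ! Suc i)) - B (fst (ps ! i))"
  shows "path_hit ps l B = inc_hit ps k l (B (fst (hd ps))) x"
  using assms
proof (induction ps arbitrary: k)
  case (Cons p ps)
  show ?case
  proof (cases ps)
    case (Cons q qs)
    have "x k = B (fst q) - B (fst p)" using Cons.prems[of 0] Cons by simp
    moreover have "path_hit ps l B = inc_hit ps (Suc k) l (B (fst (hd ps))) x"
      using Cons.prems[of "Suc _"] by (intro Cons.IH) simp
    ultimately show ?thesis using Cons by simp
  qed simp
qed simp

lemma inc_hit_cong: "(\<And>i. k \<le> i \<Longrightarrow> x i = y i) \<Longrightarrow> inc_hit ps k l b x = inc_hit ps k l b y"
  by (induction ps arbitrary: k b) auto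

lemma abs_inc_hit_le:
  assumes "0 \<le> C" "\<And>p b. p \<in> set ps \<Longrightarrow> snd p < b \<Longrightarrow> \<bar>airy_heat (fst p) (b - l)\<bar> \<le> C"
  shows "\<bar>inc_hit ps k l b x\<bar> \<le> C"
  using assms by (induction ps arbitrary: k b) auto

lemma abs_path_hit_le:
  assumes "0 \<le> C" "\<And>p b. p \<in> set ps \<Longrightarrow> snd p < b \<Longrightarrow> \<bar>airy_heat (fst p) (b - l)\<bar> \<le> C"
  shows "\<bar>path_hit ps l B\<bar> \<le> C"
  using assms by (induction ps) auto

lemma inc_hit_measurable:
  assumes "\<And>i. k \<le> i \<Longrightarrow> Suc i < k + length ps \<Longrightarrow> (\<lambda>z. x z i) \<in> borel_measurable M" and [measurable]: "f \<in> borel_measurable M"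
  shows "(\<lambda>z. inc_hit ps k l (f z) (x z)) \<in> borel_measurable M"
  using assms
proof (induction ps arbitrary: k f)
  case (Cons p ps)
  note [measurable] = Cons.prems(2)
  show ?case
  proof (cases ps)
    case (Cons q qs)
    have [measurable]: "(\<lambda>z. x z k) \<in> borel_measurable M" using Cons.prems(1)[of k] Cons by simp
    have [measurable]: "(\<lambda>z. inc_hit ps (Suc k) l (f z + x z k) (x z)) \<in> borel_measurable M"
      by (rule Cons.IH) (use Cons.prems(1) in auto)
    show ?thesis by simp
  next
    case Nil
    then show ?thesis by (simp only: inc_hit.simps) measurable
  qed
qed simp

definition gauss_measure :: "real \<Rightarrow> real measure" where
  "gauss_measure s = density lborel (\<lambda>x. ennreal (gauss s x))"

lemma sets_gauss_measure [simp, measurable_cong]: "sets (gauss_measure s) = sets borel"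
  by (simp add: gauss_measure_def)

lemma space_gauss_measure [simp]: "space (gauss_measure s) = UNIV"
  by (simp add: gauss_measure_def)

lemma prob_space_gauss_measure: "s > 0 \<Longrightarrow> prob_space (gauss_measure s)"
  unfolding gauss_measure_def gauss_def by (rule prob_space_normal_density) simp

lemma integral_gauss_measure: "f \<in> borel_measurable borel \<Longrightarrow> (\<integral>x. f x \<partial>gauss_measure s) = (LBINT x. gauss s x * f x)"
  for f :: "real \<Rightarrow> real"
  unfolding gauss_measure_def by (subst integral_density) auto

text \<open>Fubini in the increment with index \<open>k\<close>: averaging over it is the heat
  convolution in the recursion of \<open>first_hit\<close>, and the other increments yield the
  expectation for the shorter list.\<close>

lemma integral_inc_hit:
  assumes s: "\<And>i. (s i :: real) > 0"
    and C: "0 \<le> C" "\<And>p b. p \<in> set ps \<Longrightarrow> snd p < b \<Longrightarrow> \<bar>airy_heat (fst p) (b - l)\<bar> \<le> C"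
    and steps: "\<And>i. Suc i < length ps \<Longrightarrow> s (k + i) = fst (ps ! Suc i) - fst (ps ! i)"
  shows "(\<integral>x. inc_hit ps k l b x \<partial>Pi\<^sub>M {k..<k + (length ps - 1)} (\<lambda>i. gauss_measure (s i))) = first_hit ps l b"
  using C steps
proof (induction ps arbitrary: k b)
  case (Cons p ps)
  interpret P: product_prob_space "\<lambda>i. gauss_measure (s i)" UNIV
    by (intro product_prob_spaceI prob_space_gauss_measure s)
  show ?case
  proof (cases ps)
    case Nil
    then show ?thesis by (simp add: P.prob_space prob_space.prob_space PiM_empty)
  next
    case (Cons q qs)
    let ?I = "{Suc k..<Suc k + (length ps - 1)}"
    let ?M = "\<lambda>i. gauss_measure (s i)"
    have I: "{k..<k + (length (p # ps) - 1)} = insert k ?I" using Cons by auto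
    have sk: "s k = fst q - fst p" using Cons.prems(3)[of 0] Cons by simp
    have IH: "(\<integral>x. inc_hit ps (Suc k) l b' x \<partial>Pi\<^sub>M ?I ?M) = first_hit ps l b'" for b'
      by (rule Cons.IH) (use Cons.prems(1,2) Cons.prems(3)[of "Suc _"] in auto)
    have inc_le: "\<bar>inc_hit ps j l b' x\<bar> \<le> C" for j b' x
      by (rule abs_inc_hit_le) (use Cons.prems in auto)
    have mI: "(\<lambda>x. inc_hit ps (Suc k) l (f x) (h x)) \<in> borel_measurable N"
      if "f \<in> borel_measurable N" "h \<in> measurable N (Pi\<^sub>M ?I ?M)" for f h and N :: "'z measure"
      using that by (intro inc_hit_measurable measurable_compose[OF that(2)] measurable_component_singleton[THEN measurable_compose]) auto
    interpret I: prob_space "Pi\<^sub>M ?I ?M" by (intro prob_space_PiM prob_space_gauss_measure s)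
    show ?thesis
    proof (cases "snd p < b")
      case True
      interpret J: prob_space "Pi\<^sub>M {k..<k + (length (p # ps) - 1)} ?M" by (intro prob_space_PiM prob_space_gauss_measure s)
      show ?thesis using True by (simp add: J.prob_space[simplified])
    next
      case False
      have "(\<integral>x. inc_hit (p # ps) k l b x \<partial>Pi\<^sub>M {k..<k + (length (p # ps) - 1)} ?M)
        = (\<integral>x. inc_hit ps (Suc k) l (b + x k) x \<partial>Pi\<^sub>M (insert k ?I) ?M)"
        unfolding I using False by simp
      also have "\<dots> = (\<integral>x. (\<integral>y. inc_hit ps (Suc k) l (b + (x(k := y)) k) (x(k := y)) \<partial>?M k) \<partial>Pi\<^sub>M ?I ?M)"
      proof (rule P.product_integral_insert)
        interpret K: prob_space "Pi\<^sub>M (insert k ?I) ?M" by (intro prob_space_PiM prob_space_gauss_measure s)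
        have "(\<lambda>x. inc_hit ps (Suc k) l (b + x k) x) \<in> borel_measurable (Pi\<^sub>M (insert k ?I) ?M)"
          by (intro inc_hit_measurable) (auto intro!: measurable_component_singleton[THEN measurable_compose] simp: Cons)
        then show "integrable (Pi\<^sub>M (insert k ?I) ?M) (\<lambda>x. inc_hit ps (Suc k) l (b + x k) x)"
          by (intro K.integrable_const_bound[of _ C]) (use inc_le in auto)
      qed auto
      \<comment> \<open>The shorter list reads the increments from index \<open>Suc k\<close> on, so
        the update at \<open>k\<close> is not seen.\<close>
      also have "\<dots> = (\<integral>x. (\<integral>y. inc_hit ps (Suc k) l (b + y) x \<partial>?M k) \<partial>Pi\<^sub>M ?I ?M)"
        by (intro Bochner_Integration.integral_cong refl) (auto intro: inc_hit_cong)
      also have "\<dots> = (\<integral>y. (\<integral>x. inc_hit ps (Suc k) l (b + y) x \<partial>Pi\<^sub>M ?I ?M) \<partial>?M k)"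
      proof (rule Fubini_dominated[where p = "\<lambda>_. C" and q = "\<lambda>_. 1"])
        show "pair_sigma_finite (Pi\<^sub>M ?I ?M) (?M k)"
          by (intro pair_sigma_finite.intro I.sigma_finite_measure_axioms P.M.sigma_finite_measure_axioms)
        have "(\<lambda>z. inc_hit ps (Suc k) l (b + snd z) (fst z)) \<in> borel_measurable (Pi\<^sub>M ?I ?M \<Otimes>\<^sub>M ?M k)"
          by (rule mI) (auto intro!: borel_measurable_add measurable_compose[OF measurable_snd])
        then show "(\<lambda>(x, y). inc_hit ps (Suc k) l (b + y) x) \<in> borel_measurable (Pi\<^sub>M ?I ?M \<Otimes>\<^sub>M ?M k)"
          by (simp add: split_beta')
        show "integrable (Pi\<^sub>M ?I ?M) (\<lambda>_. C)" "integrable (?M k) (\<lambda>_. 1)"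
          by (rule I.integrable_const P.M.integrable_const)+
      qed (use inc_le in auto)
      also have "\<dots> = (LBINT y. gauss (s k) y * first_hit ps l (b + y))"
        unfolding IH by (rule integral_gauss_measure) measurable
      finally show ?thesis using False Cons sk by (simp add: heat_conv_def)
    qed
  qed
next
  case Nil
  have "inc_hit [] k l b = (\<lambda>_. 0)" by (simp add: fun_eq_iff)
  then show ?case by simp
qed

lemma expectation_path_hit:
  assumes W: "brownian_motion N W" and ps: "increasing ps" "ps \<noteq> []" "0 \<le> fst (hd ps)"
    and C: "0 \<le> C" "\<And>p b. p \<in> set ps \<Longrightarrow> snd p < b \<Longrightarrow> \<bar>airy_heat (fst p) (b - l)\<bar> \<le> C"
  shows "(\<integral>\<omega>. path_hit ps l (\<lambda>t. b + (W t \<omega> - W (fst (hd ps)) \<omega>)) \<partial>N) = first_hit ps l b"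
proof -
  interpret N: prob_space N using W by (simp add: brownian_motion_def)
  define n where "n = length ps - 1"
  define t where "t = (\<lambda>i. fst (ps ! i))"
  \<comment> \<open>The value 1 beyond \<open>n\<close> is a filler that makes all factors of the
    product probability measures.\<close>
  define s where "s = (\<lambda>i. if i < n then t (Suc i) - t i else 1)"
  define X where "X = (\<lambda>i \<omega>. W (t (Suc i)) \<omega> - W (t i) \<omega>)"
  have t0: "t 0 = fst (hd ps)" using ps(2) by (simp add: t_def hd_conv_nth)
  have tS: "t i < t (Suc i)" if "i < n" for i
    using ps(1) that unfolding t_def n_def by (auto simp: sorted_wrt_iff_nth_less)
  have t_nonneg: "0 \<le> t i" if "i \<le> n" for i
    using that by (induction i) (use t0 ps(3) tS in \<open>force simp: less_eq_Suc_le\<close>)+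
  have s_pos: "s i > 0" for i using tS by (simp add: s_def)
  have path: "path_hit ps l (\<lambda>u. b + (W u \<omega> - W (fst (hd ps)) \<omega>)) = inc_hit ps 0 l b (\<lambda>i\<in>{..<n}. X i \<omega>)" for \<omega>
  proof -
    have "path_hit ps l (\<lambda>u. b + (W u \<omega> - W (fst (hd ps)) \<omega>)) = inc_hit ps 0 l (b + (W (fst (hd ps)) \<omega> - W (fst (hd ps)) \<omega>)) (\<lambda>i\<in>{..<n}. X i \<omega>)"
      by (rule path_hit_eq_inc_hit) (auto simp: X_def t_def n_def)
    then show ?thesis by simp
  qed
  have rv: "X i \<in> borel_measurable N" if "i < n" for i
  proof -
    have [measurable]: "W (t i) \<in> borel_measurable N" "W (t (Suc i)) \<in> borel_measurable N"
      using W t_nonneg[of i] t_nonneg[of "Suc i"] that by (auto simp: brownian_motion_def)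
    show ?thesis unfolding X_def by measurable
  qed
  have D: "distr N borel (X i) = gauss_measure (s i)" if "i < n" for i
  proof -
    have "distributed N lborel (X i) (normal_density 0 (sqrt (2 * (t (Suc i) - t i))))"
      using W tS[OF that] t_nonneg[of i] that unfolding X_def brownian_motion_def by auto
    then have "distr N lborel (X i) = gauss_measure (s i)"
      using that by (simp add: distributed_distr_eq_density gauss_measure_def gauss_def[abs_def] s_def)
    moreover have "distr N borel (X i) = distr N lborel (X i)" by (rule distr_cong) auto
    ultimately show ?thesis by simp
  qed
  have joint: "distr N (Pi\<^sub>M {..<n} (\<lambda>_. borel)) (\<lambda>\<omega>. \<lambda>i\<in>{..<n}. X i \<omega>) = Pi\<^sub>M {..<n} (\<lambda>i. gauss_measure (s i))"
  \<comment> \<open>Independence is turned into a product law for a nonempty index set; without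
    increments both sides live on a one-point space.\<close>
  proof (cases "n = 0")
    case False
    have "N.indep_vars (\<lambda>_. borel) X {..<n}"
    proof -
      have "0 \<le> t 0 \<and> (\<forall>i<n. t i \<le> t (Suc i))" using t_nonneg[of 0] tS by (auto intro: less_imp_le)
      then show ?thesis using W unfolding brownian_motion_def X_def by blast
    qed
    then have "distr N (Pi\<^sub>M {..<n} (\<lambda>_. borel)) (\<lambda>\<omega>. \<lambda>i\<in>{..<n}. X i \<omega>) = Pi\<^sub>M {..<n} (\<lambda>i. distr N borel (X i))"
      using False rv by (subst (asm) N.indep_vars_iff_distr_eq_PiM') auto
    also have "\<dots> = Pi\<^sub>M {..<n} (\<lambda>i. gauss_measure (s i))" by (rule PiM_cong) (auto simp: D)
    finally show ?thesis .
  next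
    case True
    have "distr N (count_space {\<lambda>_. undefined}) (\<lambda>\<omega>. \<lambda>_. undefined) = count_space {\<lambda>_ :: nat. undefined :: real}"
    proof (rule measure_eqI)
      fix A assume "A \<in> sets (distr N (count_space {\<lambda>_. undefined}) (\<lambda>\<omega>. \<lambda>_. undefined))"
      then have "A = {} \<or> A = {\<lambda>_. undefined}" by auto
      then show "emeasure (distr N (count_space {\<lambda>_. undefined}) (\<lambda>\<omega>. \<lambda>_. undefined)) A = emeasure (count_space {\<lambda>_. undefined}) A"
        by (auto simp: emeasure_distr N.emeasure_space_1)
    qed simp
    then show ?thesis using True by (simp add: PiM_empty restrict_def)
  qed
  have "(\<integral>\<omega>. path_hit ps l (\<lambda>u. b + (W u \<omega> - W (fst (hd ps)) \<omega>)) \<partial>N)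
     = (\<integral>x. inc_hit ps 0 l b x \<partial>distr N (Pi\<^sub>M {..<n} (\<lambda>_. borel)) (\<lambda>\<omega>. \<lambda>i\<in>{..<n}. X i \<omega>))"
    unfolding path
  proof (rule integral_distr[symmetric])
    show "(\<lambda>\<omega>. \<lambda>i\<in>{..<n}. X i \<omega>) \<in> measurable N (Pi\<^sub>M {..<n} (\<lambda>_. borel))" using rv by (intro measurable_restrict) auto
    show "inc_hit ps 0 l b \<in> borel_measurable (Pi\<^sub>M {..<n} (\<lambda>_. borel))"
      by (rule inc_hit_measurable) (auto simp: n_def)
  qed
  also have "\<dots> = (\<integral>x. inc_hit ps 0 l b x \<partial>Pi\<^sub>M {0..<0 + (length ps - 1)} (\<lambda>i. gauss_measure (s i)))"
    unfolding joint by (simp add: n_def lessThan_atLeast0)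
  also have "\<dots> = first_hit ps l b"
    by (rule integral_inc_hit[OF s_pos C]) (auto simp: s_def n_def t_def)
  finally show ?thesis .
qed

section \<open>Approximating a barrier by its values at countably many times\<close>

text \<open>The sorted list is searched from the front, so the result depends only on the set of
  crossing times. This makes the limit accessible, as refining inserts new times at arbitrary
  positions.\<close>

lemma path_hit_eq_Min:
  fixes B :: "real \<Rightarrow> real"
  assumes "increasing ps"
  defines "S \<equiv> {fst p |p. p \<in> set ps \<and> snd p < B (fst p)}"
  shows "path_hit ps l B = (if S = {} then 0 else airy_heat (Min S) (B (Min S) - l))"
  using assms(1) unfolding S_def
proof (induction ps)
  case (Cons p ps)
  let ?S = "\<lambda>ps. {fst p |p. p \<in> set ps \<and> snd p < B (fst p)}"
  show ?case
  proof (cases "snd p < B (fst p)")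
    case True
    have fin: "finite (?S (p # ps))" by (rule finite_subset[of _ "fst ` set (p # ps)"]) (force, simp)
    have min: "Min (?S (p # ps)) = fst p"
    proof (rule Min_eqI[OF fin])
      show "fst p \<in> ?S (p # ps)" using True by (intro CollectI exI[of _ p]) simp
    qed (use Cons.prems in \<open>auto intro: less_imp_le\<close>)
    have "fst p \<in> ?S (p # ps)" using True by (intro CollectI exI[of _ p]) simp
    then have ne: "?S (p # ps) \<noteq> {}" by blast
    show ?thesis by (simp only: path_hit.simps if_P[OF True] if_not_P[OF ne] min)
  next
    case False
    then have S: "?S (p # ps) = ?S ps" by auto
    have "path_hit ps l B = (if ?S ps = {} then 0 else airy_heat (Min (?S ps)) (B (Min (?S ps)) - l))"
      using Cons by simp
    then show ?thesis unfolding S by (simp only: path_hit.simps if_not_P[OF False])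
  qed
qed simp

text \<open>\<open>approx\<close> says that a strict upper bound of \<open>f\<close> at a point is
  also one at some \<open>d i\<close> arbitrarily near to it. The barrier is given on the whole line
  because one sequence of times serves both sides of 0.\<close>

locale barrier_side =
  fixes N :: "'b measure" and W :: "real \<Rightarrow> 'b \<Rightarrow> real" and f :: "real \<Rightarrow> ereal" and d :: "nat \<Rightarrow> real" and c \<kappa> :: real
  assumes W: "brownian_motion N W" and \<kappa>: "\<kappa> < 3 / 4"
    and f_ge: "\<And>t. ereal (c - \<kappa> * t\<^sup>2) \<le> f t"
    and d0: "d 0 = 0"
    and approx: "\<And>t r e. f t < ereal r \<Longrightarrow> 0 < e \<Longrightarrow> \<exists>i. \<bar>d i - t\<bar> < e \<and> f (d i) < ereal r"
begin

sublocale N: prob_space N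
  using W by (simp add: brownian_motion_def)

lemma W_measurable: "0 \<le> t \<Longrightarrow> W t \<in> borel_measurable N"
  and W_0: "\<omega> \<in> space N \<Longrightarrow> W 0 \<omega> = 0"
  and W_cont: "\<omega> \<in> space N \<Longrightarrow> continuous_on {0..} (\<lambda>t. W t \<omega>)"
  using W by (auto simp: brownian_motion_def)

lemma path_cont: "\<omega> \<in> space N \<Longrightarrow> continuous_on {0..} (\<lambda>t. y + W t \<omega>)"
  by (intro continuous_intros W_cont)

lemma ereal_f: "f t < \<infinity> \<Longrightarrow> ereal (real_of_ereal (f t)) = f t"
  using f_ge[of t] by (cases "f t") auto

text \<open>Time 0 is left out, since it heads the list \<open>levels\<close> with a level of its
  own.\<close>

definition times :: "nat \<Rightarrow> real set" where
  "times n = {t. (\<exists>i\<le>n. d i = t) \<and> 0 < t \<and> f t < \<infinity>}"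

text \<open>If \<open>f 0\<close> is infinite, levels increasing to infinity keep 0 in the list of times, as the common origin of both
  sides.\<close>

definition start_level :: "nat \<Rightarrow> real" where
  "start_level n = (if f 0 < \<infinity> then real_of_ereal (f 0) else \<bar>c\<bar> + real n)"

definition tail :: "nat \<Rightarrow> (real \<times> real) list" where
  "tail n = map (\<lambda>t. (t, real_of_ereal (f t))) (sorted_list_of_set (times n))"

definition levels :: "nat \<Rightarrow> (real \<times> real) list" where
  "levels n = (0, start_level n) # tail n"

lemma finite_times: "finite (times n)"
  by (rule finite_subset[of _ "d ` {..n}"]) (auto simp: times_def)

lemma set_tail: "set (tail n) = (\<lambda>t. (t, real_of_ereal (f t))) ` times n"
  using finite_times by (simp add: tail_def)

lemma increasing_levels: "increasing (levels n)"
proof -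
  have "sorted_wrt (<) (sorted_list_of_set (times n))" by simp
  then have "increasing (tail n)" by (simp add: tail_def sorted_wrt_map)
  then show ?thesis by (auto simp: levels_def set_tail times_def)
qed

lemma levels_nonempty: "levels n \<noteq> []" and fst_hd_levels: "fst (hd (levels n)) = 0"
  by (simp_all add: levels_def)

lemma levels_ge: "p \<in> set (levels n) \<Longrightarrow> 0 \<le> fst p \<and> c - \<kappa> * (fst p)\<^sup>2 \<le> snd p"
proof -
  have *: "c - \<kappa> * t\<^sup>2 \<le> real_of_ereal (f t)" if "f t < \<infinity>" for t
    using f_ge[of t] ereal_f[OF that] by (metis ereal_less_eq(3))
  assume "p \<in> set (levels n)"
  then show ?thesis using *[of 0] * by (auto simp: levels_def set_tail times_def start_level_def)
qed

text \<open>By \<open>approx\<close> and the continuity of the path, a strict crossing at an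
  arbitrary time is accompanied by crossings at times \<open>d i\<close> arbitrarily near, so for
  strict crossings countably many times lose nothing.\<close>

definition crossings :: "(real \<Rightarrow> real) \<Rightarrow> real set" where
  "crossings B = {t. (\<exists>i. d i = t) \<and> 0 \<le> t \<and> f t < ereal (B t)}"

definition crossing_value :: "real \<Rightarrow> (real \<Rightarrow> real) \<Rightarrow> real" where
  "crossing_value l B = (if crossings B = {} then 0 else airy_heat (Inf (crossings B)) (B (Inf (crossings B)) - l))"

lemma crossings_bdd_below: "bdd_below (crossings B)"
  by (rule bdd_belowI[of _ 0]) (auto simp: crossings_def)

lemma Inf_crossings_nonneg: "crossings B \<noteq> {} \<Longrightarrow> 0 \<le> Inf (crossings B)"
  by (rule cInf_greatest) (auto simp: crossings_def)

lemma isCont_airy_heat_seq: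
  assumes "t \<longlonglongrightarrow> t'" "z \<longlonglongrightarrow> z'"
  shows "(\<lambda>n. airy_heat (t n) (z n)) \<longlonglongrightarrow> airy_heat t' z'"
  using continuous_on_tendsto_compose[OF continuous_airy_heat tendsto_Pair[OF assms]] by simp

text \<open>The first crossing among the times up to index \<open>n\<close> tends to the infimum of
  all crossings, which need not be a crossing itself; the value there converges by the continuity of
  the path and of \<open>airy_heat\<close>.\<close>

lemma path_hit_levels_tendsto:
  assumes B: "continuous_on {0..} B"
  shows "(\<lambda>n. path_hit (levels n) l B) \<longlonglongrightarrow> crossing_value l B"
proof -
  define S where "S = (\<lambda>n. {fst p |p. p \<in> set (levels n) \<and> snd p < B (fst p)})"
  \<comment> \<open>From \<open>n0\<close> on the level that replaces an infinite \<open>f 0\<close>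
    is above the starting point of the path.\<close>
  obtain n0 :: nat where n0: "B 0 < real n0" using reals_Archimedean2 by blast
  have S: "S n = {t \<in> crossings B. \<exists>i\<le>n. d i = t}" if "n0 \<le> n" for n
  proof -
    have f: "real_of_ereal (f t) < B t \<longleftrightarrow> f t < ereal (B t)" if "f t < \<infinity>" for t
      using ereal_f[OF that] by (metis less_ereal.simps(1))
    have "B 0 \<le> \<bar>c\<bar> + real n" using n0 that by linarith
    then have "start_level n < B 0 \<longleftrightarrow> f 0 < ereal (B 0)"
      using f[of 0] by (cases "f 0 < \<infinity>") (auto simp: start_level_def)
    then have "S n = {t. t = 0 \<and> f 0 < ereal (B 0)} \<union> {t \<in> times n. f t < ereal (B t)}"
      using f by (force simp: S_def levels_def set_tail times_def)
    also have "\<dots> = {t \<in> crossings B. \<exists>i\<le>n. d i = t}"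
      using d0 by (auto simp: crossings_def times_def less_le)
    finally show ?thesis .
  qed
  have eq: "path_hit (levels n) l B = (if S n = {} then 0 else airy_heat (Min (S n)) (B (Min (S n)) - l))" for n
    unfolding S_def by (rule path_hit_eq_Min[OF increasing_levels])
  show ?thesis
  proof (cases "crossings B = {}")
    case True
    have "eventually (\<lambda>n. path_hit (levels n) l B = crossing_value l B) sequentially"
      using eventually_ge_at_top[of n0] by eventually_elim (simp add: eq S True crossing_value_def)
    then show ?thesis by (rule tendsto_eventually)
  next
    case False
    define \<tau> where "\<tau> = Inf (crossings B)"
    have \<tau>: "0 \<le> \<tau>" unfolding \<tau>_def by (rule Inf_crossings_nonneg) fact
    have fin: "finite (S n)" for n by (rule finite_subset[of _ "fst ` set (levels n)"]) (force simp: S_def, simp)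
    have ev: "eventually (\<lambda>n. S n \<noteq> {} \<and> Min (S n) \<in> crossings B \<and> Min (S n) < \<tau> + e) sequentially" if e: "0 < e" for e
    proof -
      obtain t where t: "t \<in> crossings B" "t < \<tau> + e"
        using cInf_lessD[OF False, of "\<tau> + e"] e by (auto simp: \<tau>_def)
      then obtain i where i: "d i = t" by (auto simp: crossings_def)
      show ?thesis
        using eventually_ge_at_top[of "max i n0"]
      proof eventually_elim
        case (elim n)
        have tS: "t \<in> S n" using elim t i by (auto simp: S)
        have "Min (S n) \<le> t" using tS fin by (rule Min_le[rotated])
        moreover have "Min (S n) \<in> S n" using tS fin by (intro Min_in) auto
        moreover have "S n \<subseteq> crossings B" using elim by (auto simp: S)
        ultimately show ?case using t(2) tS by force
      qed
    qed
    have ev1: "eventually (\<lambda>n. S n \<noteq> {} \<and> Min (S n) \<in> crossings B) sequentially"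
      using ev[of 1] by (auto elim: eventually_mono)
    have m: "(\<lambda>n. Min (S n)) \<longlonglongrightarrow> \<tau>"
    proof (rule tendstoI)
      fix e :: real assume "0 < e"
      from ev[OF this] show "eventually (\<lambda>n. dist (Min (S n)) \<tau> < e) sequentially"
      proof eventually_elim
        case (elim n)
        then have "\<tau> \<le> Min (S n)" unfolding \<tau>_def by (intro cInf_lower crossings_bdd_below) auto
        with elim show ?case by (simp add: dist_real_def)
      qed
    qed
    have "(\<lambda>n. B (Min (S n))) \<longlonglongrightarrow> B \<tau>"
      by (rule continuous_on_tendsto_compose[OF B m]) (use \<tau> ev1 in \<open>auto elim!: eventually_mono simp: crossings_def\<close>)
    then have "(\<lambda>n. airy_heat (Min (S n)) (B (Min (S n)) - l)) \<longlonglongrightarrow> airy_heat \<tau> (B \<tau> - l)"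
      by (intro isCont_airy_heat_seq m tendsto_diff tendsto_const)
    moreover have "crossing_value l B = airy_heat \<tau> (B \<tau> - l)" using False by (simp add: crossing_value_def \<tau>_def)
    moreover have "eventually (\<lambda>n. airy_heat (Min (S n)) (B (Min (S n)) - l) = path_hit (levels n) l B) sequentially"
      using ev1 by eventually_elim (simp add: eq)
    ultimately show ?thesis by (simp add: Lim_transform_eventually)
  qed
qed

lemma levels_hit_bound:
  assumes "0 < \<alpha>" "- \<alpha> \<le> A"
  shows "\<exists>C\<ge>0. \<forall>n. \<forall>p\<in>set (levels n). \<forall>b>snd p. \<forall>l\<le>0. \<bar>airy_heat (fst p) (b - l)\<bar> \<le> C * exp (\<alpha> * l) * exp (A * b - A\<^sup>2 * fst p)"
proof -
  obtain C where C: "0 \<le> C" "\<And>t b l. 0 \<le> t \<Longrightarrow> c - \<kappa> * t\<^sup>2 \<le> b \<Longrightarrow> l \<le> 0 \<Longrightarrow> \<bar>airy_heat t (b - l)\<bar> \<le> C * exp (\<alpha> * l) * exp (A * b - A\<^sup>2 * t)"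
    using airy_heat_parabola_bound[OF \<kappa> assms, of c] by blast
  have "\<bar>airy_heat (fst p) (b - l)\<bar> \<le> C * exp (\<alpha> * l) * exp (A * b - A\<^sup>2 * fst p)"
    if "p \<in> set (levels n)" "snd p < b" "l \<le> 0" for n p b l
    using levels_ge[OF that(1)] that(2,3) by (intro C(2)) auto
  then show ?thesis using C(1) by blast
qed

lemma first_hit_levels_le:
  assumes "0 < \<alpha>" "- \<alpha> \<le> A"
  shows "\<exists>C\<ge>0. \<forall>n. \<forall>l\<le>0. \<forall>b. \<bar>first_hit (levels n) l b\<bar> \<le> C * exp (\<alpha> * l) * exp (A * b)"
proof -
  obtain C where C: "0 \<le> C" "\<And>n p b l. p \<in> set (levels n) \<Longrightarrow> snd p < b \<Longrightarrow> l \<le> 0 \<Longrightarrow> \<bar>airy_heat (fst p) (b - l)\<bar> \<le> C * exp (\<alpha> * l) * exp (A * b - A\<^sup>2 * fst p)"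
    using levels_hit_bound[OF assms] by blast
  have "\<bar>first_hit (levels n) l b\<bar> \<le> (C * exp (\<alpha> * l)) * exp (A * b - A\<^sup>2 * fst (hd (levels n)))" if "l \<le> 0" for n l b
    by (rule first_hit_bound[OF increasing_levels]) (use C that in auto)
  then show ?thesis using C(1) by (auto simp: fst_hd_levels)
qed

text \<open>The rates \<open>A = 2\<close> and \<open>A = - 2\<close> give the decay for the two
  signs of \<open>y\<close>; \<open>\<alpha> = 2\<close> admits the latter. All levels lie above the
  same parabola, so the constant does not depend on \<open>n\<close>.\<close>

lemma hit_profile_levels_le: "\<exists>C\<ge>0. \<forall>n l y. \<bar>hit_profile (levels n) l y\<bar> \<le> C * exp (- 2 * \<bar>y\<bar>) * exp_half l"
proof -
  obtain C where C: "0 \<le> C" "\<And>n l b. l \<le> 0 \<Longrightarrow> \<bar>first_hit (levels n) l b\<bar> \<le> C * exp (2 * l) * exp (2 * b)"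
    using first_hit_levels_le[of 2 2] by auto
  obtain D where D: "0 \<le> D" "\<And>n l b. l \<le> 0 \<Longrightarrow> \<bar>first_hit (levels n) l b\<bar> \<le> D * exp (2 * l) * exp (- 2 * b)"
    using first_hit_levels_le[of 2 "- 2"] by auto
  have "\<bar>hit_profile (levels n) l y\<bar> \<le> (C + D) * exp (- 2 * \<bar>y\<bar>) * exp_half l" for n l y
  proof (cases "l < 0")
    case True
    have "\<bar>first_hit (levels n) l y\<bar> \<le> (C + D) * exp (2 * l) * exp (- 2 * \<bar>y\<bar>)"
    proof (cases "0 \<le> y")
      case y: True
      have "D * exp (2 * l) * exp (- 2 * y) \<le> (C + D) * exp (2 * l) * exp (- 2 * \<bar>y\<bar>)"
        using y C(1) D(1) by (intro mult_mono) auto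
      then show ?thesis using D(2)[of l n y] True by linarith
    next
      case y: False
      have "C * exp (2 * l) * exp (2 * y) \<le> (C + D) * exp (2 * l) * exp (- 2 * \<bar>y\<bar>)"
        using y C(1) D(1) by (intro mult_mono) auto
      then show ?thesis using C(2)[of l n y] True by linarith
    qed
    also have "\<dots> \<le> (C + D) * exp l * exp (- 2 * \<bar>y\<bar>)"
      using True C(1) D(1) by (intro mult_right_mono mult_left_mono) auto
    finally show ?thesis using True by (simp add: hit_profile_def exp_half_def mult_ac)
  qed (simp add: hit_profile_def exp_half_def)
  then show ?thesis using C(1) D(1) by (intro exI[of _ "C + D"]) auto
qed

lemma path_hit_levels_bounded: "\<exists>C\<ge>0. \<forall>n. \<forall>l\<le>0. \<forall>B. \<bar>path_hit (levels n) l B\<bar> \<le> C"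
  and levels_hit_bounded: "\<exists>C\<ge>0. \<forall>n. \<forall>p\<in>set (levels n). \<forall>b>snd p. \<forall>l\<le>0. \<bar>airy_heat (fst p) (b - l)\<bar> \<le> C"
proof -
  obtain C where C: "0 \<le> C" "\<And>n p b l. p \<in> set (levels n) \<Longrightarrow> snd p < b \<Longrightarrow> l \<le> 0 \<Longrightarrow> \<bar>airy_heat (fst p) (b - l)\<bar> \<le> C * exp (1 * l) * exp (0 * b - 0\<^sup>2 * fst p)"
    using levels_hit_bound[of 1 0] by force
  have le: "\<bar>airy_heat (fst p) (b - l)\<bar> \<le> C" if "p \<in> set (levels n)" "snd p < b" "l \<le> 0" for n p b l
  proof -
    have "C * exp l \<le> C * 1" using C(1) that(3) by (intro mult_left_mono) auto
    then show ?thesis using C(2)[OF that] by simp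
  qed
  then show "\<exists>C\<ge>0. \<forall>n. \<forall>p\<in>set (levels n). \<forall>b>snd p. \<forall>l\<le>0. \<bar>airy_heat (fst p) (b - l)\<bar> \<le> C" using C(1) by blast
  have "\<bar>path_hit (levels n) l B\<bar> \<le> C" if "l \<le> 0" for n l B
    by (rule abs_path_hit_le) (use C(1) le that in auto)
  then show "\<exists>C\<ge>0. \<forall>n. \<forall>l\<le>0. \<forall>B. \<bar>path_hit (levels n) l B\<bar> \<le> C" using C(1) by blast
qed

lemma crossing_value_bounded: "\<exists>C\<ge>0. \<forall>l\<le>0. \<forall>B. continuous_on {0..} B \<longrightarrow> \<bar>crossing_value l B\<bar> \<le> C"
proof -
  obtain C where C: "0 \<le> C" "\<And>n l B. l \<le> 0 \<Longrightarrow> \<bar>path_hit (levels n) l B\<bar> \<le> C" using path_hit_levels_bounded by blast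
  have "\<bar>crossing_value l B\<bar> \<le> C" if "l \<le> 0" "continuous_on {0..} B" for l B
    by (rule LIMSEQ_le_const2[OF tendsto_rabs[OF path_hit_levels_tendsto[OF that(2)]]]) (use C(2) that(1) in auto)
  then show ?thesis using C(1) by blast
qed

lemma path_hit_levels_measurable: "(\<lambda>\<omega>. path_hit (levels n) l (\<lambda>t. y + W t \<omega>)) \<in> borel_measurable N"
proof -
  have "(\<lambda>\<omega>. path_hit ps l (\<lambda>t. y + W t \<omega>)) \<in> borel_measurable N" if "\<forall>p\<in>set ps. 0 \<le> fst p" for ps
    using that
  proof (induction ps)
    case (Cons p ps)
    have [measurable]: "W (fst p) \<in> borel_measurable N" using Cons.prems by (intro W_measurable) simp
    have [measurable]: "(\<lambda>\<omega>. path_hit ps l (\<lambda>t. y + W t \<omega>)) \<in> borel_measurable N" using Cons by simp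
    show ?case by simp
  qed simp
  then show ?thesis using levels_ge by blast
qed

lemma crossing_value_measurable: "(\<lambda>\<omega>. crossing_value l (\<lambda>t. y + W t \<omega>)) \<in> borel_measurable N"
  by (rule borel_measurable_LIMSEQ_real[OF path_hit_levels_tendsto[OF path_cont] path_hit_levels_measurable])

definition expected_value :: "real \<Rightarrow> real \<Rightarrow> real" where
  "expected_value l y = (\<integral>\<omega>. crossing_value l (\<lambda>t. y + W t \<omega>) \<partial>N)"

definition profile :: "real \<Rightarrow> real \<Rightarrow> real" where
  "profile l y = indicator {..<0} l * expected_value l y"

lemma first_hit_levels_tendsto:
  assumes l: "l \<le> 0"
  shows "(\<lambda>n. first_hit (levels n) l y) \<longlonglongrightarrow> expected_value l y"
proof -
  obtain C where C: "0 \<le> C" "\<And>n l B. l \<le> 0 \<Longrightarrow> \<bar>path_hit (levels n) l B\<bar> \<le> C" using path_hit_levels_bounded by blast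
  obtain D where D: "0 \<le> D" "\<And>n p b l. p \<in> set (levels n) \<Longrightarrow> snd p < b \<Longrightarrow> l \<le> 0 \<Longrightarrow> \<bar>airy_heat (fst p) (b - l)\<bar> \<le> D"
    using levels_hit_bounded by blast
  have "(\<integral>\<omega>. path_hit (levels n) l (\<lambda>t. y + W t \<omega>) \<partial>N) = first_hit (levels n) l y" for n
  proof -
    have "(\<integral>\<omega>. path_hit (levels n) l (\<lambda>t. y + W t \<omega>) \<partial>N)
       = (\<integral>\<omega>. path_hit (levels n) l (\<lambda>t. y + (W t \<omega> - W (fst (hd (levels n))) \<omega>)) \<partial>N)"
      by (intro Bochner_Integration.integral_cong refl) (simp add: fst_hd_levels W_0)
    also have "\<dots> = first_hit (levels n) l y"
      by (rule expectation_path_hit[OF W increasing_levels levels_nonempty _ D(1)]) (use D(2) l in \<open>auto simp: fst_hd_levels\<close>)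
    finally show ?thesis .
  qed
  moreover have "(\<lambda>n. \<integral>\<omega>. path_hit (levels n) l (\<lambda>t. y + W t \<omega>) \<partial>N) \<longlonglongrightarrow> expected_value l y"
    unfolding expected_value_def
    by (rule integral_dominated_convergence[where w = "\<lambda>_. C"])
      (use C(2)[OF l] path_hit_levels_tendsto[OF path_cont] path_hit_levels_measurable crossing_value_measurable in auto)
  ultimately show ?thesis by simp
qed

lemma hit_profile_levels_tendsto: "(\<lambda>n. hit_profile (levels n) l y) \<longlonglongrightarrow> profile l y"
  unfolding hit_profile_def profile_def
  by (cases "l < 0") (auto intro: first_hit_levels_tendsto)

lemma profile_measurable: "case_prod profile \<in> borel_measurable (borel \<Otimes>\<^sub>M borel)"
  by (rule borel_measurable_LIMSEQ_real[OF _ hit_profile_measurable]) (auto intro: hit_profile_levels_tendsto)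

lemma profile_le:
  assumes "\<And>n l y. \<bar>hit_profile (levels n) l y\<bar> \<le> C * exp (- 2 * \<bar>y\<bar>) * exp_half l"
  shows "\<bar>profile l y\<bar> \<le> C * exp (- 2 * \<bar>y\<bar>) * exp_half l"
  by (rule LIMSEQ_le_const2[OF tendsto_rabs[OF hit_profile_levels_tendsto]]) (use assms in auto)

lemma isCont_profile:
  assumes m: "m < 0"
  shows "isCont (\<lambda>l. profile l y) m"
  unfolding isCont_def
proof (rule tendsto_at_iff_sequentially[THEN iffD2], intro allI impI)
  fix X :: "nat \<Rightarrow> real" assume X: "X \<longlonglongrightarrow> m"
  obtain C where C: "0 \<le> C" "\<And>l B. l \<le> 0 \<Longrightarrow> continuous_on {0..} B \<Longrightarrow> \<bar>crossing_value l B\<bar> \<le> C" using crossing_value_bounded by blast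
  have ev: "eventually (\<lambda>i. X i < 0) sequentially" using order_tendstoD(2)[OF X m] .
  have "(\<lambda>i. \<integral>\<omega>. indicator {..<0} (X i) * crossing_value (X i) (\<lambda>t. y + W t \<omega>) \<partial>N) \<longlonglongrightarrow> (\<integral>\<omega>. crossing_value m (\<lambda>t. y + W t \<omega>) \<partial>N)"
  proof (rule integral_dominated_convergence[where w = "\<lambda>_. C"])
    show "AE \<omega> in N. (\<lambda>i. indicator {..<0} (X i) * crossing_value (X i) (\<lambda>t. y + W t \<omega>)) \<longlonglongrightarrow> crossing_value m (\<lambda>t. y + W t \<omega>)"
    proof (intro AE_I2)
      fix \<omega> assume "\<omega> \<in> space N"
      have "(\<lambda>i. crossing_value (X i) B) \<longlonglongrightarrow> crossing_value m B" for B
        unfolding crossing_value_def by (auto intro!: isCont_airy_heat_seq tendsto_intros X)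
      then show "(\<lambda>i. indicator {..<0} (X i) * crossing_value (X i) (\<lambda>t. y + W t \<omega>)) \<longlonglongrightarrow> crossing_value m (\<lambda>t. y + W t \<omega>)"
        by (rule Lim_transform_eventually) (use ev in \<open>auto elim!: eventually_mono\<close>)
    qed
    show "AE \<omega> in N. norm (indicator {..<0} (X i) * crossing_value (X i) (\<lambda>t. y + W t \<omega>)) \<le> C" for i
      using C by (intro AE_I2) (auto simp: path_cont split: split_indicator)
  qed (use crossing_value_measurable in auto)
  then show "((\<lambda>l. profile l y) \<circ> X) \<longlonglongrightarrow> profile m y"
    using m by (simp add: o_def profile_def expected_value_def)
qed

section \<open>Immediate crossings, and crossing against touching\<close>

lemma expected_value_immediate:
  assumes "\<And>\<omega>. \<omega> \<in> space N \<Longrightarrow> crossings (\<lambda>t. y + W t \<omega>) \<noteq> {} \<and> Inf (crossings (\<lambda>t. y + W t \<omega>)) = 0"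
  shows "expected_value l y = Ai (y - l)"
proof -
  have "expected_value l y = (\<integral>\<omega>. Ai (y - l) \<partial>N)"
    unfolding expected_value_def crossing_value_def
    by (intro Bochner_Integration.integral_cong refl) (use assms in \<open>simp add: W_0\<close>)
  then show ?thesis by (simp add: N.prob_space)
qed

lemma expected_value_above_start:
  assumes "f 0 < ereal y"
  shows "expected_value l y = Ai (y - l)"
proof (rule expected_value_immediate)
  fix \<omega> assume "\<omega> \<in> space N"
  then have "0 \<in> crossings (\<lambda>t. y + W t \<omega>)" using assms d0 by (auto simp: crossings_def W_0)
  then show "crossings (\<lambda>t. y + W t \<omega>) \<noteq> {} \<and> Inf (crossings (\<lambda>t. y + W t \<omega>)) = 0"
    using Inf_crossings_nonneg[of "\<lambda>t. y + W t \<omega>"] cInf_lower[OF _ crossings_bdd_below] by force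
qed

text \<open>The barrier falls below some \<open>r < y\<close> at arbitrarily small positive times,
  while the path is still above \<open>r\<close>. So the crossings accumulate at 0.\<close>

lemma expected_value_above_Liminf:
  assumes "Liminf (at_right 0) f < ereal y"
  shows "expected_value l y = Ai (y - l)"
proof (rule expected_value_immediate)
  fix \<omega> assume \<omega>: "\<omega> \<in> space N"
  let ?B = "\<lambda>t. y + W t \<omega>"
  obtain r where r: "Liminf (at_right 0) f < ereal r" "r < y"
    using ereal_dense2[OF assms] by auto
  have freq: "\<exists>t. 0 < t \<and> t < e \<and> f t < ereal r" if e: "0 < e" for e :: real
  proof (rule ccontr)
    assume "\<not> ?thesis"
    then have "\<forall>t>0. t < e \<longrightarrow> ereal r \<le> f t" by (meson not_less)
    then have "eventually (\<lambda>t. ereal r \<le> f t) (at_right 0)"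
      unfolding eventually_at_right_field using e by blast
    then have "ereal r \<le> Liminf (at_right 0) f" by (rule Liminf_bounded)
    with r(1) show False by simp
  qed
  have small: "\<exists>t\<in>crossings ?B. t < e" if e: "0 < e" for e
  proof -
    have "(?B \<longlongrightarrow> ?B 0) (at 0 within {0..})"
      using path_cont[OF \<omega>, of y] by (auto simp: continuous_on_def)
    then have "eventually (\<lambda>t. r < ?B t) (at 0 within {0..})"
      using r(2) W_0[OF \<omega>] by (intro order_tendstoD(1)) auto
    then obtain \<delta> where \<delta>: "0 < \<delta>" "\<And>t. 0 \<le> t \<Longrightarrow> t \<noteq> 0 \<Longrightarrow> dist t 0 < \<delta> \<Longrightarrow> r < ?B t"
      unfolding eventually_at by auto
    obtain t where t: "0 < t" "t < min e \<delta>" "f t < ereal r" using freq[of "min e \<delta>"] e \<delta>(1) by auto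
    \<comment> \<open>The tolerance keeps \<open>d i\<close> positive and below
      \<open>min e \<delta>\<close>.\<close>
    obtain i where i: "\<bar>d i - t\<bar> < min t (min e \<delta> - t)" "f (d i) < ereal r"
      using approx[OF t(3), of "min t (min e \<delta> - t)"] t by auto
    have di: "0 < d i" "d i < min e \<delta>" using i(1) by (auto simp: min_def abs_less_iff split: if_splits)
    have "r < ?B (d i)" using \<delta>(2)[of "d i"] di by (auto simp: dist_real_def)
    then have "f (d i) < ereal (?B (d i))" using i(2) by (cases "f (d i)") auto
    then have "d i \<in> crossings ?B" using di by (auto simp: crossings_def)
    then show ?thesis using di by auto
  qed
  have ne: "crossings ?B \<noteq> {}" using small[of 1] by auto
  moreover have "Inf (crossings ?B) \<le> 0"
  proof (rule field_le_epsilon)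
    fix e :: real assume "0 < e"
    then obtain t where "t \<in> crossings ?B" "t < e" using small by blast
    then show "Inf (crossings ?B) \<le> 0 + e" using cInf_lower[OF _ crossings_bdd_below, of t ?B] by auto
  qed
  ultimately show "crossings ?B \<noteq> {} \<and> Inf (crossings ?B) = 0" using Inf_crossings_nonneg[OF ne] by auto
qed

text \<open>For fixed \<open>T\<close> a path can touch the barrier before \<open>T\<close> without crossing it only if its starting point is
  the random level \<open>touch_level T\<close>. So this is excluded almost surely unless the starting point is an atom.\<close>

definition touch_level :: "real \<Rightarrow> 'b \<Rightarrow> ereal" where
  "touch_level T \<omega> = (INF i\<in>{i. 0 \<le> d i \<and> d i \<le> T}. f (d i) - ereal (W (d i) \<omega>))"

lemma touch_level_measurable: "touch_level T \<in> borel_measurable N"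
  unfolding touch_level_def
  by (intro borel_measurable_INF borel_measurable_ereal_diff borel_measurable_ereal borel_measurable_const W_measurable) auto

definition touch_atoms :: "real set" where
  "touch_atoms = {y. \<exists>T\<in>\<rat>. measure N {\<omega> \<in> space N. touch_level T \<omega> = ereal y} \<noteq> 0}"

text \<open>For each rational \<open>T\<close> these are atoms of the law of
  \<open>touch_level T\<close>, and a probability measure has only countably many.\<close>

lemma countable_touch_atoms: "countable touch_atoms"
proof -
  have "countable {y. measure N {\<omega> \<in> space N. touch_level T \<omega> = ereal y} \<noteq> 0}" for T
  proof -
    interpret D: prob_space "distr N borel (touch_level T)" by (rule N.prob_space_distr[OF touch_level_measurable])
    have "measure (distr N borel (touch_level T)) {ereal y} = measure N {\<omega> \<in> space N. touch_level T \<omega> = ereal y}" for y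
      by (subst measure_distr[OF touch_level_measurable]) (auto intro!: arg_cong[where f = "measure N"])
    then have "{y. measure N {\<omega> \<in> space N. touch_level T \<omega> = ereal y} \<noteq> 0} = ereal -` {x. measure (distr N borel (touch_level T)) {x} \<noteq> 0}"
      by auto
    moreover have "inj_on ereal A" for A by (simp add: inj_on_def)
    ultimately show ?thesis using D.countable_support by (auto intro: countable_image_inj_on[of ereal] countable_subset[rotated])
  qed
  moreover have "touch_atoms = (\<Union>T\<in>\<rat>. {y. measure N {\<omega> \<in> space N. touch_level T \<omega> = ereal y} \<noteq> 0})"
    by (auto simp: touch_atoms_def)
  ultimately show ?thesis by (simp add: countable_rat)
qed

text \<open>The two times can differ only by a touching time \<open>t\<close> before all crossings.
  Up to a rational \<open>T\<close> in between there is no crossing, so \<open>touch_level T\<close>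
  is at least \<open>y\<close>; the times \<open>d i\<close> near \<open>t\<close> show that it is
  at most \<open>y\<close>. Equality is excluded.\<close>

lemma hitting_time_eq:
  assumes \<omega>: "\<omega> \<in> space N" and y: "\<And>T. T \<in> \<rat> \<Longrightarrow> touch_level T \<omega> \<noteq> ereal y"
  defines "B \<equiv> \<lambda>t. y + W t \<omega>"
  shows "hitting_time f B = (if crossings B = {} then \<infinity> else ereal (Inf (crossings B)))"
proof (rule antisym)
  let ?H = "{ereal t |t. 0 \<le> t \<and> f t \<le> ereal (B t)}"
  show "hitting_time f B \<le> (if crossings B = {} then \<infinity> else ereal (Inf (crossings B)))"
  proof (cases "crossings B = {}")
    case False
    have le: "hitting_time f B \<le> ereal s" if s: "Inf (crossings B) < s" for s
    proof -
      obtain t where "t \<in> crossings B" "t < s" using cInf_lessD[OF False s] by blast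
      then have "hitting_time f B \<le> ereal t" unfolding hitting_time_def
        by (intro Inf_lower) (auto simp: crossings_def)
      also have "\<dots> \<le> ereal s" using \<open>t < s\<close> by simp
      finally show ?thesis .
    qed
    have "hitting_time f B \<le> ereal (Inf (crossings B))"
    proof (rule ereal_le_epsilon2)
      show "hitting_time f B \<le> ereal (Inf (crossings B)) + ereal e" if "0 < e" for e
        using le[of "Inf (crossings B) + e"] that by simp
    qed
    then show ?thesis using False by simp
  qed simp
  show "(if crossings B = {} then \<infinity> else ereal (Inf (crossings B))) \<le> hitting_time f B"
    unfolding hitting_time_def
  proof (rule Inf_greatest, rule ccontr)
    fix u assume "u \<in> ?H" and "\<not> (if crossings B = {} then \<infinity> else ereal (Inf (crossings B))) \<le> u"
    then obtain t where t: "0 \<le> t" "f t \<le> ereal (B t)" "crossings B = {} \<or> t < Inf (crossings B)"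
      by (auto split: if_splits)
    have "\<exists>T\<in>\<rat>. t < T \<and> (crossings B = {} \<or> T < Inf (crossings B))"
      using t(3) Rats_dense_in_real[of t "t + 1"] Rats_dense_in_real[of t "Inf (crossings B)"] by auto
    then obtain T where T: "T \<in> \<rat>" "t < T" "crossings B = {} \<or> T < Inf (crossings B)" by blast
    have no_cross: "ereal (B (d i)) \<le> f (d i)" if "0 \<le> d i" "d i \<le> T" for i
    proof (rule ccontr)
      assume "\<not> ?thesis"
      then have "d i \<in> crossings B" using that by (auto simp: crossings_def)
      moreover from this have "Inf (crossings B) \<le> d i" by (rule cInf_lower[OF _ crossings_bdd_below])
      ultimately show False using T(3) that by auto
    qed
    have "touch_level T \<omega> = ereal y"
    proof (rule antisym)
      show "ereal y \<le> touch_level T \<omega>"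
        unfolding touch_level_def
      proof (rule INF_greatest)
        fix i assume "i \<in> {i. 0 \<le> d i \<and> d i \<le> T}"
        then show "ereal y \<le> f (d i) - ereal (W (d i) \<omega>)"
          using no_cross[of i] by (cases "f (d i)") (auto simp: B_def)
      qed
      show "touch_level T \<omega> \<le> ereal y"
      proof (rule ereal_le_epsilon2)
          fix e :: real assume e: "0 < e"
          obtain i where i: "0 \<le> d i" "d i \<le> T" "f (d i) \<le> ereal (y + W (d i) \<omega> + e)"
          \<comment> \<open>At \<open>t = 0\<close> the index 0 itself is taken, since other times
            \<open>d i\<close> nearby may be negative.\<close>
          proof (cases "t = 0")
            case True
            have "f (d 0) \<le> ereal (y + W (d 0) \<omega>)" using t(2) True by (simp add: B_def d0)
            also have "\<dots> \<le> ereal (y + W (d 0) \<omega> + e)" using e by simp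
            finally show ?thesis using that[of 0] d0 T(2) True by simp
          next
            case False
            then have t0: "0 < t" using t(1) by simp
            have "((\<lambda>t. W t \<omega>) \<longlongrightarrow> W t \<omega>) (at t within {0..})"
              using W_cont[OF \<omega>] t(1) by (auto simp: continuous_on_def)
            then have "eventually (\<lambda>s. W t \<omega> - e / 2 < W s \<omega>) (at t within {0..})"
              using e by (intro order_tendstoD(1)) auto
            then obtain \<delta> where \<delta>: "0 < \<delta>" "\<And>s. 0 \<le> s \<Longrightarrow> s \<noteq> t \<Longrightarrow> dist s t < \<delta> \<Longrightarrow> W t \<omega> - e / 2 < W s \<omega>"
              unfolding eventually_at by auto
            have "f t < ereal (B t + e / 2)" by (rule le_less_trans[OF t(2)]) (use e in simp)
            then obtain i where i: "\<bar>d i - t\<bar> < min \<delta> (min t (T - t))" "f (d i) < ereal (B t + e / 2)"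
              using approx[of t "B t + e / 2" "min \<delta> (min t (T - t))"] \<delta>(1) t0 T(2) by auto
            have di: "0 \<le> d i" "d i \<le> T" "dist (d i) t < \<delta>" using i(1) by (auto simp: min_def abs_less_iff dist_real_def split: if_splits)
            have "W t \<omega> - e / 2 \<le> W (d i) \<omega>" using \<delta>(2)[OF di(1) _ di(3)] e by (cases "d i = t") auto
            then have "B t + e / 2 \<le> y + W (d i) \<omega> + e" by (simp add: B_def)
            then have "f (d i) \<le> ereal (y + W (d i) \<omega> + e)" using i(2) by (cases "f (d i)") auto
            then show ?thesis using that di by blast
          qed
          have "touch_level T \<omega> \<le> f (d i) - ereal (W (d i) \<omega>)"
            unfolding touch_level_def using i by (intro INF_lower) auto
          also have "\<dots> \<le> ereal y + ereal e" using i(3) by (cases "f (d i)") auto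
          finally show "touch_level T \<omega> \<le> ereal y + ereal e" .
      qed
    qed
    then show False using y[OF T(1)] by simp
  qed
qed

text \<open>Off the atoms, almost surely no rational \<open>T\<close> has touch level
  \<open>y\<close>, and the hitting time is the infimum of the crossings. The integrand then agrees
  almost everywhere with a measurable function, which makes it measurable for the
  completion.\<close>

lemma scattering_Psi_eq:
  assumes y: "y \<notin> touch_atoms"
  shows "scattering_Psi N W f l y = Ai (y - l) - expected_value l y"
proof -
  define F where "F = (\<lambda>\<omega>. let B = (\<lambda>t. y + W t \<omega>); \<tau> = hitting_time f B; t = real_of_ereal \<tau> in
          if \<tau> < \<infinity> then exp (- 2 * t ^ 3 / 3 - (B t - l) * t) * Ai (B t - l + t\<^sup>2) else 0)"
  define F' where "F' = (\<lambda>\<omega>. crossing_value l (\<lambda>t. y + W t \<omega>))"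
  have [measurable]: "F' \<in> borel_measurable N" unfolding F'_def by (rule crossing_value_measurable)
  have "AE \<omega> in N. touch_level T \<omega> \<noteq> ereal y" if "T \<in> \<rat>" for T
  proof -
    note [measurable] = touch_level_measurable[of T]
    have "measure N {\<omega> \<in> space N. touch_level T \<omega> = ereal y} = 0" using y that by (auto simp: touch_atoms_def)
    then have "{\<omega> \<in> space N. touch_level T \<omega> = ereal y} \<in> null_sets N" by (auto simp: N.emeasure_eq_measure)
    then show ?thesis by (rule AE_mp[OF AE_not_in]) (rule AE_I2, simp)
  qed
  then have "AE \<omega> in N. \<forall>T\<in>\<rat>. touch_level T \<omega> \<noteq> ereal y"
    by (subst AE_ball_countable) (auto simp: countable_rat)
  then have "AE \<omega> in N. F' \<omega> = F \<omega>"
    using AE_space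
  proof eventually_elim
    case (elim \<omega>)
    then have "hitting_time f (\<lambda>t. y + W t \<omega>) = (if crossings (\<lambda>t. y + W t \<omega>) = {} then \<infinity> else ereal (Inf (crossings (\<lambda>t. y + W t \<omega>))))"
      by (intro hitting_time_eq) auto
    then show ?case by (auto simp: F_def F'_def Let_def crossing_value_def airy_heat_def)
  qed
  then have ae: "AE \<omega> in completion N. F' \<omega> = F \<omega>" by (rule AE_completion)
  have F'c: "F' \<in> borel_measurable (completion N)" by (rule measurable_completion) measurable
  have "F \<in> borel_measurable (completion N)"
  proof (rule measurableI)
    fix A :: "real set" assume A: "A \<in> sets borel"
    show "F -` A \<inter> space (completion N) \<in> sets (completion N)"
    proof (rule completion.in_sets_AE)
      show "AE \<omega> in completion N. \<omega> \<in> F' -` A \<inter> space (completion N) \<longleftrightarrow> \<omega> \<in> F -` A \<inter> space (completion N)"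
        using ae by eventually_elim auto
      show "F' -` A \<inter> space (completion N) \<in> sets (completion N)" using F'c A by (rule measurable_sets)
    qed auto
  qed simp
  then have "integral\<^sup>L (completion N) F = integral\<^sup>L (completion N) F'"
    using F'c ae by (intro integral_cong_AE) (auto elim: eventually_mono)
  also have "\<dots> = expected_value l y"
    unfolding expected_value_def F'_def[symmetric] by (rule integral_completion) measurable
  finally show ?thesis unfolding scattering_Psi_def F_def by simp
qed

end

section \<open>Two-sided barriers\<close>

locale barrier =
  fixes N :: "'b measure" and W :: "real \<Rightarrow> 'b \<Rightarrow> real" and g :: "real \<Rightarrow> ereal" and d :: "nat \<Rightarrow> real" and c \<kappa> :: real
  assumes W: "brownian_motion N W" and \<kappa>: "\<kappa> < 3 / 4"
    and g_ge: "\<And>t. ereal (c - \<kappa> * t\<^sup>2) \<le> g t"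
    and d0: "d 0 = 0"
    and approx: "\<And>t r e. g t < ereal r \<Longrightarrow> 0 < e \<Longrightarrow> \<exists>i. \<bar>d i - t\<bar> < e \<and> g (d i) < ereal r"
begin

sublocale plus: barrier_side N W g d c \<kappa>
  by unfold_locales (fact W \<kappa> g_ge d0 approx)+

sublocale minus: barrier_side N W "\<lambda>t. g (- t)" "\<lambda>i. - d i" c \<kappa>
proof unfold_locales
  show "ereal (c - \<kappa> * t\<^sup>2) \<le> g (- t)" for t using g_ge[of "- t"] by simp
  show "\<exists>i. \<bar>- d i - t\<bar> < e \<and> g (- (- d i)) < ereal r" if r: "g (- t) < ereal r" "0 < e" for t r e
  proof -
    obtain i where "\<bar>d i - - t\<bar> < e" "g (d i) < ereal r" using approx[OF r] by blast
    moreover have "\<bar>- d i - t\<bar> = \<bar>d i - - t\<bar>" by arith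
    ultimately show ?thesis by (intro exI[of _ i]) simp
  qed
qed (use W \<kappa> d0 in auto)

lemma start_level_minus: "minus.start_level n = plus.start_level n"
  by (simp add: minus.start_level_def plus.start_level_def)

abbreviation hit_minus :: "nat \<Rightarrow> real \<Rightarrow> real \<Rightarrow> real" where "hit_minus n \<equiv> hit_profile (minus.levels n)"
abbreviation hit_plus :: "nat \<Rightarrow> real \<Rightarrow> real \<Rightarrow> real" where "hit_plus n \<equiv> hit_profile (plus.levels n)"

lemma scattering_pairs: "\<exists>C. (\<forall>n. scattering_pair (hit_minus n) (hit_plus n) C) \<and> scattering_pair minus.profile plus.profile C"
proof -
  obtain C D where C: "\<And>n l y. \<bar>hit_minus n l y\<bar> \<le> C * exp (- 2 * \<bar>y\<bar>) * exp_half l"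
    and D: "\<And>n l y. \<bar>hit_plus n l y\<bar> \<le> D * exp (- 2 * \<bar>y\<bar>) * exp_half l"
    using minus.hit_profile_levels_le plus.hit_profile_levels_le by blast
  have "E * exp (- 2 * \<bar>y\<bar>) * exp_half l \<le> max C D * exp (- 2 * \<bar>y\<bar>) * exp_half l" if "E \<le> max C D" for E l y
    using that exp_half_nonneg[of l] by (intro mult_right_mono) auto
  then have C': "\<bar>hit_minus n l y\<bar> \<le> max C D * exp (- 2 * \<bar>y\<bar>) * exp_half l"
    and D': "\<bar>hit_plus n l y\<bar> \<le> max C D * exp (- 2 * \<bar>y\<bar>) * exp_half l" for n l y
    using order_trans[OF C] order_trans[OF D] by auto
  have "scattering_pair (hit_minus n) (hit_plus n) (max C D)" for n
    by unfold_locales (use C' D' in auto)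
  moreover have "scattering_pair minus.profile plus.profile (max C D)"
    by unfold_locales (use minus.profile_le[OF C'] plus.profile_le[OF D'] minus.profile_measurable plus.profile_measurable in auto)
  ultimately show ?thesis by blast
qed

definition scattered :: "real \<Rightarrow> real \<Rightarrow> real" where
  "scattered x z = (LBINT y. (K_Ai x y - airy_transform (\<lambda>l. minus.profile l y) x) * (K_Ai z y - airy_transform (\<lambda>l. plus.profile l y) z))"

text \<open>The limit is taken in the half-line kernels, where one constant \<open>C\<close> serves
  all \<open>n\<close> and the limit; only the limit kernel is carried over to the real
  line.\<close>

lemma has_fredholm_det_scattered:
  assumes det: "\<And>n C. scattering_pair (hit_minus n) (hit_plus n) C \<Longrightarrow> has_fredholm_det (scattering_pair.half_kernel (hit_minus n) (hit_plus n)) (P n)"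
    and P: "P \<longlonglongrightarrow> p"
  shows "has_fredholm_det (\<lambda>x z. - K_Ai x z + scattered x z) p"
proof -
  obtain C where pair: "\<And>n. scattering_pair (hit_minus n) (hit_plus n) C" and "scattering_pair minus.profile plus.profile C"
    using scattering_pairs by blast
  interpret scattering_pair minus.profile plus.profile C by fact
  let ?T = "\<lambda>n. scattering_pair.half_kernel (hit_minus n) (hit_plus n)"
  have lim: "(\<lambda>n. ?T n l m) \<longlonglongrightarrow> half_kernel l m" for l m
  proof -
    have "(\<lambda>n. LBINT y. scattering_pair.deficit (hit_minus n) (hit_plus n) l m y) \<longlonglongrightarrow> (LBINT y. deficit l m y)"
    proof (rule integral_dominated_convergence[where w = "\<lambda>y. (deficit_const * (exp_half l * exp_half m)) * exp (- 1 * \<bar>y\<bar>)"])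
      show "AE y in lborel. (\<lambda>n. scattering_pair.deficit (hit_minus n) (hit_plus n) l m y) \<longlonglongrightarrow> deficit l m y"
        unfolding scattering_pair.deficit_def[OF pair] deficit_def
        by (intro AE_I2 tendsto_intros minus.hit_profile_levels_tendsto plus.hit_profile_levels_tendsto)
      show "AE y in lborel. norm (scattering_pair.deficit (hit_minus n) (hit_plus n) l m y) \<le> (deficit_const * (exp_half l * exp_half m)) * exp (- 1 * \<bar>y\<bar>)" for n
        using scattering_pair.deficit_le[OF pair, of n l m] by (auto simp: scattering_pair.deficit_const_def[OF pair] deficit_const_def mult_ac)
      show "integrable lborel (\<lambda>y. (deficit_const * (exp_half l * exp_half m)) * exp (- 1 * \<bar>y\<bar>))"
        by (intro integrable_mult_right integrable_exp_abs) simp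
      show "(\<lambda>y. scattering_pair.deficit (hit_minus n) (hit_plus n) l m y) \<in> borel_measurable lborel" for n
        using scattering_pair.integrable_deficit[OF pair] by (auto dest: borel_measurable_integrable)
      show "(\<lambda>y. deficit l m y) \<in> borel_measurable lborel"
        using integrable_deficit by (auto dest: borel_measurable_integrable)
    qed
    then show ?thesis unfolding scattering_pair.half_kernel_def[OF pair] half_kernel_def by (rule tendsto_minus)
  qed
  have half2: "integrable lborel (\<lambda>l. (half_const * exp_half l) * exp_half l)"
    by (rule integrable_dominated[where g = "\<lambda>l. half_const * exp_half l"])
      (use half_const_nonneg exp_half_nonneg exp_half_le_1 in \<open>auto simp: abs_mult integrable_exp_half mult_left_le intro!: mult_nonneg_nonneg\<close>)
  obtain p' where p': "P \<longlonglongrightarrow> p'" "has_fredholm_det half_kernel p'"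
  proof (rule fredholm_det_tendsto[OF _ _ _ _ half2 lim det[OF pair]])
    show "case_prod (?T n) \<in> borel_measurable (borel \<Otimes>\<^sub>M borel)" for n by (rule scattering_pair.half_kernel_measurable[OF pair])
    show "\<bar>?T n l m\<bar> \<le> (half_const * exp_half l) * exp_half m" for n l m
      using scattering_pair.half_kernel_le[OF pair, of n l m]
      by (simp add: scattering_pair.half_const_def[OF pair] scattering_pair.deficit_const_def[OF pair] half_const_def deficit_const_def)
  qed (use half_const_nonneg exp_half_nonneg in auto)
  have "p' = p" using p'(1) P by (rule LIMSEQ_unique)
  then have "has_fredholm_det full_kernel p"
    using fredholm_det_full_kernel[OF plus.isCont_profile p'(2)] by simp
  then show ?thesis by (simp add: full_kernel_def[abs_def] scattered_def[abs_def] Hm_def Hp_def)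
qed

section \<open>The Airy process below a barrier\<close>

definition chain :: "nat \<Rightarrow> (real \<times> real) list" where
  "chain n = rev (map reflect (minus.tail n)) @ (0, plus.start_level n) # plus.tail n"

lemma increasing_chain: "increasing (chain n)"
proof -
  have "increasing (rev (map reflect (minus.tail n)))"
    using minus.increasing_levels[of n] by (simp add: minus.levels_def sorted_wrt_rev sorted_wrt_map)
  then show ?thesis
    using minus.increasing_levels[of n] plus.increasing_levels[of n]
    by (force simp: chain_def minus.levels_def plus.levels_def sorted_wrt_append)
qed

lemma set_chain:
  "set (chain n) = {(t, real_of_ereal (g t)) |t. (\<exists>i\<le>n. d i = t) \<and> t \<noteq> 0 \<and> g t < \<infinity>} \<union> {(0, plus.start_level n)}"
proof -
  have "set (map reflect (minus.tail n)) = {(t, real_of_ereal (g t)) |t. (\<exists>i\<le>n. d i = t) \<and> t < 0 \<and> g t < \<infinity>}"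
    by (force simp: minus.set_tail minus.times_def reflect_def image_iff)
  moreover have "set (plus.tail n) = {(t, real_of_ereal (g t)) |t. (\<exists>i\<le>n. d i = t) \<and> 0 < t \<and> g t < \<infinity>}"
    by (auto simp: plus.set_tail plus.times_def)
  ultimately show ?thesis by (auto simp: chain_def)
qed

definition below_chain :: "'a measure \<Rightarrow> (real \<Rightarrow> 'a \<Rightarrow> real) \<Rightarrow> nat \<Rightarrow> 'a set" where
  "below_chain M X n = {\<omega> \<in> space M. \<forall>p\<in>set (chain n). X (fst p) \<omega> \<le> snd p + (fst p)\<^sup>2}"

lemma has_fredholm_det_below_chain:
  assumes X: "airy2_process M X" and pair: "scattering_pair (hit_minus n) (hit_plus n) C"
  shows "has_fredholm_det (scattering_pair.half_kernel (hit_minus n) (hit_plus n)) (measure M (below_chain M X n))"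
proof -
  let ?ts = "map fst (chain n)" and ?xs = "map (\<lambda>p. snd p + (fst p)\<^sup>2) (chain n)"
  have ne: "chain n \<noteq> []" by (simp add: chain_def)
  have det: "has_fredholm_det (\<lambda>u v. - K_Ai u v + airy_chain (hd ts) (zip ts xs) u v)
      (measure M {\<omega> \<in> space M. \<forall>i<length ts. X (ts ! i) \<omega> \<le> xs ! i})"
    if "ts \<noteq> []" "length xs = length ts" "sorted_wrt (<) ts" for ts xs
    using X that unfolding airy2_process_def by blast
  have "sorted_wrt (<) ?ts" using increasing_chain by (simp add: sorted_wrt_map)
  then have "has_fredholm_det (\<lambda>u v. - K_Ai u v + airy_chain (hd ?ts) (zip ?ts ?xs) u v)
      (measure M {\<omega> \<in> space M. \<forall>i<length ?ts. X (?ts ! i) \<omega> \<le> ?xs ! i})"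
    using ne by (intro det) simp_all
  also have "zip ?ts ?xs = map parabolic_shift (chain n)"
    by (simp add: zip_map_map zip_same_conv_map parabolic_shift_def)
  also have "hd ?ts = fst (hd (chain n))" using ne by (simp add: hd_map)
  also have "{\<omega> \<in> space M. \<forall>i<length ?ts. X (?ts ! i) \<omega> \<le> ?xs ! i} = below_chain M X n"
    by (auto simp: below_chain_def all_set_conv_all_nth)
  finally have "has_fredholm_det (\<lambda>u v. - K_Ai u v + airy_chain (fst (hd (chain n))) (map parabolic_shift (chain n)) u v)
      (measure M (below_chain M X n))" .
  moreover have "minus.levels n = (0, plus.start_level n) # map reflect (map reflect (minus.tail n))"
    by (simp add: minus.levels_def start_level_minus o_def)
  ultimately show ?thesis
    using has_fredholm_det_airy_chain[of "map reflect (minus.tail n)" "plus.start_level n" "plus.tail n" _ C]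
      increasing_chain[of n] pair by (simp only: chain_def plus.levels_def)
qed

text \<open>The events need not be monotone in \<open>n\<close>, because the level that replaces an
  infinite \<open>g 0\<close> increases. But for each sample point membership is eventually the same
  as in the limit event; this also yields the measurability of the latter.\<close>

lemma measure_below_chain_tendsto:
  assumes X: "airy2_process M X"
  shows "(\<lambda>n. measure M (below_chain M X n)) \<longlonglongrightarrow> measure M {\<omega> \<in> space M. \<forall>t. ereal (X t \<omega>) \<le> g t + ereal (t\<^sup>2)}"
    (is "_ \<longlonglongrightarrow> measure M ?E")
proof -
  interpret M: prob_space M using X by (simp add: airy2_process_def)
  have [measurable]: "X t \<in> borel_measurable M" for t using X by (simp add: airy2_process_def)
  have chain_meas: "below_chain M X n \<in> sets M" for n unfolding below_chain_def by measurable
  have g: "ereal x \<le> g t + ereal (t\<^sup>2) \<longleftrightarrow> x \<le> real_of_ereal (g t) + t\<^sup>2" if "g t < \<infinity>" for x t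
    using that g_ge[of t] by (cases "g t") auto
  have ev: "eventually (\<lambda>n. \<omega> \<in> below_chain M X n \<longleftrightarrow> \<omega> \<in> ?E) sequentially" if \<omega>: "\<omega> \<in> space M" for \<omega>
  proof (cases "\<omega> \<in> ?E")
    case True
    obtain n0 :: nat where n0: "X 0 \<omega> < real n0" using reals_Archimedean2 by blast
    have "\<omega> \<in> below_chain M X n" if n: "n0 \<le> n" for n
    proof -
      have "X 0 \<omega> \<le> plus.start_level n"
        using True g[of 0 "X 0 \<omega>"] n n0 by (auto simp: plus.start_level_def dest: spec[of _ 0])
      then show ?thesis using True g \<omega> by (auto simp: below_chain_def set_chain)
    qed
    then show ?thesis using True by (intro eventually_sequentiallyI[of n0]) blast
  next
    case False
    \<comment> \<open>A violation at \<open>t\<close> is strict and the Airy path is continuous, so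
      it shows at some \<open>d i\<close> and in all later chains.\<close>
    then obtain t where t: "g t + ereal (t\<^sup>2) < ereal (X t \<omega>)" using \<omega> by (auto simp: not_le)
    then have "g t < ereal (X t \<omega> - t\<^sup>2)" by (cases "g t") auto
    then obtain r where r: "g t < ereal r" "r < X t \<omega> - t\<^sup>2" using ereal_dense2[of "g t" "ereal (X t \<omega> - t\<^sup>2)"] by auto
    have "continuous_on UNIV (\<lambda>s. X s \<omega> - s\<^sup>2)"
      using X \<omega> by (intro continuous_intros) (simp add: airy2_process_def)
    then have "((\<lambda>s. X s \<omega> - s\<^sup>2) \<longlongrightarrow> X t \<omega> - t\<^sup>2) (at t)" by (simp add: continuous_on_def)
    then have "eventually (\<lambda>s. r < X s \<omega> - s\<^sup>2) (at t)" using r(2) by (rule order_tendstoD(1))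
    then obtain e where e: "0 < e" "\<And>s. s \<noteq> t \<Longrightarrow> dist s t < e \<Longrightarrow> r < X s \<omega> - s\<^sup>2" unfolding eventually_at by auto
    obtain i where i: "\<bar>d i - t\<bar> < e" "g (d i) < ereal r" using approx[OF r(1) e(1)] by blast
    have "r < X (d i) \<omega> - (d i)\<^sup>2" using e(2)[of "d i"] i(1) r(2) by (cases "d i = t") (auto simp: dist_real_def)
    then have gi: "g (d i) < \<infinity>" "real_of_ereal (g (d i)) + (d i)\<^sup>2 < X (d i) \<omega>"
      using i(2) g_ge[of "d i"] by (cases "g (d i)"; auto)+
    have "\<omega> \<notin> below_chain M X n" if n: "i \<le> n" for n
    proof -
      have "(d i, real_of_ereal (g (d i))) \<in> set (chain n)"
        using gi(1) n by (cases "d i = 0") (auto simp: set_chain plus.start_level_def)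
      then show ?thesis using gi(2) by (force simp: below_chain_def)
    qed
    then show ?thesis using False by (intro eventually_sequentiallyI[of i]) blast
  qed
  have lim: "(\<lambda>n. indicator (below_chain M X n) \<omega> :: real) \<longlonglongrightarrow> indicator ?E \<omega>" if "\<omega> \<in> space M" for \<omega>
    by (rule tendsto_eventually) (use ev[OF that] in \<open>auto elim!: eventually_mono simp: indicator_def\<close>)
  have E: "(indicator ?E :: _ \<Rightarrow> real) \<in> borel_measurable M"
    by (rule borel_measurable_LIMSEQ_real[OF lim]) (use chain_meas in auto)
  have "(\<lambda>n. LINT \<omega>|M. indicator (below_chain M X n) \<omega> :: real) \<longlonglongrightarrow> (LINT \<omega>|M. indicator ?E \<omega>)"
    by (rule integral_dominated_convergence[where w = "\<lambda>_. 1"]) (use E chain_meas lim in auto)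
  moreover have "?E \<inter> space M = ?E" "below_chain M X n \<inter> space M = below_chain M X n" for n
    by (auto simp: below_chain_def)
  ultimately show ?thesis by simp
qed

section \<open>The Brownian scattering operator\<close>

text \<open>The two integrands in \<open>y\<close> agree off a countable set, which consists of the
  atoms of both sides and the end point of the cut-off. Below the end point
  \<open>scattering_Psi_eq\<close> applies to both factors; above it one factor of \<open>?D\<close>
  is zero.\<close>

lemma scattered_eq: "scattered x z = airy_scattering N W g x z"
proof -
  have half: "(LBINT l. Ai (x - l) * indicator {..0} l * (Ai (y - l) - E l)) = K_Ai x y - airy_transform (\<lambda>l. indicator {..<0} l * E l) x"
    if m: "(\<lambda>l. indicator {..<0} l * E l) \<in> borel_measurable borel" and le: "\<And>l. \<bar>indicator {..<0} l * E l\<bar> \<le> B * exp_half l" for x y E and B :: real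
  proof -
    have "(LBINT l. Ai (x - l) * indicator {..0} l * (Ai (y - l) - E l)) = (LBINT l. Ai (x - l) * airy_neg y l - Ai (x - l) * (indicator {..<0} l * E l))"
      by (rule integral_discrete_difference[of "{0}"]) (auto simp: airy_neg_def algebra_simps split: split_indicator)
    also have "\<dots> = airy_transform (airy_neg y) x - airy_transform (\<lambda>l. indicator {..<0} l * E l) x"
      unfolding airy_transform_def
      by (intro Bochner_Integration.integral_diff integrable_airy_transform[OF m le] integrable_airy_transform[OF _ airy_neg_le[of 1]]) auto
    finally show ?thesis by (simp add: K_Ai_eq)
  qed
  have zero: "K_Ai x y - airy_transform (\<lambda>l. indicator {..<0} l * Ai (y - l)) x = 0" for x y
    by (simp add: K_Ai_eq airy_neg_def[abs_def])
  obtain C where "scattering_pair minus.profile plus.profile C" using scattering_pairs by blast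
  then interpret scattering_pair minus.profile plus.profile C .
  let ?L = "barrier_at_0 g" and ?Z = "minus.touch_atoms \<union> plus.touch_atoms \<union> {real_of_ereal (barrier_at_0 g)}"
  let ?D = "\<lambda>y. (K_Ai x y - airy_transform (\<lambda>l. minus.profile l y) x) * (K_Ai z y - airy_transform (\<lambda>l. plus.profile l y) z)"
  have "airy_scattering N W g x z = (LBINT y. ?D y)"
    unfolding airy_scattering_def brownian_scattering_def set_lebesgue_integral_def
  proof (rule integral_discrete_difference[of ?Z])
    show "countable ?Z" using minus.countable_touch_atoms plus.countable_touch_atoms by auto
    fix y assume y: "y \<notin> ?Z"
    note half = half[of _ "C * exp (- 2 * \<bar>y\<bar>)"]
    have Im: "(LBINT l. Ai (x - l) * indicator {..0} l * scattering_Psi N W (\<lambda>t. g (- t)) l y) = K_Ai x y - airy_transform (\<lambda>l. minus.profile l y) x"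
      using y half[OF hm_row[of y, unfolded minus.profile_def] hm_le[of _ y, unfolded minus.profile_def], of x y]
      by (simp add: minus.scattering_Psi_eq minus.profile_def)
    have Ip: "(LBINT l. scattering_Psi N W g l y * (indicator {..0} l * Ai (z - l))) = K_Ai z y - airy_transform (\<lambda>l. plus.profile l y) z"
      using y half[OF hp_row[of y, unfolded plus.profile_def] hp_le[of _ y, unfolded plus.profile_def], of z y]
      by (simp add: plus.scattering_Psi_eq plus.profile_def mult_ac)
    consider "ereal y < ?L" | "?L < ereal y" using y by (cases "?L") (auto simp: neq_iff)
    then show "indicator {y. ereal y < ?L} y *\<^sub>R
        ((LBINT l. Ai (x - l) * indicator {..0} l * scattering_Psi N W (\<lambda>t. g (- t)) l y) *
         (LBINT l. scattering_Psi N W g l y * (indicator {..0} l * Ai (z - l)))) = ?D y"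
    proof cases
      case 1
      then show ?thesis by (simp only: Im Ip) simp
    next
      case 2
      \<comment> \<open>Time reversal bounds the lower limit of \<open>g\<close> from the left from
        below by the lower limit of the reflected barrier from the right, so \<open>minus\<close>
        can use the one-sided result.\<close>
      have at_left: "at_left (0::real) = filtermap uminus (at_right 0)" using at_left_minus[of "0::real"] by simp
      have "Liminf (at_right 0) (\<lambda>t. g (- t)) \<le> Liminf (at_left 0) g"
        unfolding at_left by (rule Liminf_filtermap_ge) (simp add: inj_def)
      moreover have "g 0 < ereal y \<or> Liminf (at_left 0) g < ereal y \<or> Liminf (at_right 0) g < ereal y"
        using 2 by (auto simp: barrier_at_0_def min_less_iff_disj)
      ultimately have "(\<forall>l. plus.expected_value l y = Ai (y - l)) \<or> (\<forall>l. minus.expected_value l y = Ai (y - l))"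
        using plus.expected_value_above_start[of y] plus.expected_value_above_Liminf[of y] minus.expected_value_above_Liminf[of y]
        by (meson le_less_trans)
      then have "?D y = 0" using zero by (auto simp: plus.profile_def minus.profile_def)
      then show ?thesis using 2 by simp
    qed
  qed auto
  then show ?thesis by (simp add: scattered_def)
qed

lemma has_fredholm_det_airy_scattering:
  assumes "airy2_process M X"
  shows "has_fredholm_det (\<lambda>x z. - K_Ai x z + airy_scattering N W g x z)
    (measure M {\<omega> \<in> space M. \<forall>t. ereal (X t \<omega>) \<le> g t + ereal (t\<^sup>2)})"
  using has_fredholm_det_scattered[OF has_fredholm_det_below_chain[OF assms] measure_below_chain_tendsto[OF assms]]
  by (simp add: scattered_eq)

end

text \<open>One point is chosen for each rational interval and rational level for which there is
  one. A strict bound at \<open>t\<close> leaves room for such an interval around \<open>t\<close>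
  and such a level, so countably many points witness all of them.\<close>

lemma exists_lower_approximating_sequence:
  fixes g :: "real \<Rightarrow> ereal"
  obtains d :: "nat \<Rightarrow> real" where "d 0 = 0" "\<And>t r e. g t < ereal r \<Longrightarrow> 0 < e \<Longrightarrow> \<exists>i. \<bar>d i - t\<bar> < e \<and> g (d i) < ereal r"
proof -
  \<comment> \<open>For a triple without such a point \<open>SOME\<close> yields an arbitrary
    number, which only adds a point to the countable set.\<close>
  define h where "h = (\<lambda>(p, q, s). SOME t. real_of_rat p < t \<and> t < real_of_rat q \<and> g t < ereal (real_of_rat s))"
  define D where "D = insert 0 (range h)"
  have D: "\<exists>s\<in>D. \<bar>s - t\<bar> < e \<and> g s < ereal r" if t: "g t < ereal r" and e: "0 < e" for t r e
  proof -
    obtain m where m: "g t < ereal m" "m < r" using ereal_dense2[OF t] by auto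
    obtain s where s: "m < real_of_rat s" "real_of_rat s < r" using of_rat_dense[OF m(2)] by blast
    obtain p where p: "t - e < real_of_rat p" "real_of_rat p < t" using of_rat_dense[of "t - e" t] e by auto
    obtain q where q: "t < real_of_rat q" "real_of_rat q < t + e" using of_rat_dense[of t "t + e"] e by auto
    have "g t < ereal (real_of_rat s)" using m(1) s(1) by (cases "g t") auto
    then have "real_of_rat p < t \<and> t < real_of_rat q \<and> g t < ereal (real_of_rat s)" using p(2) q(1) by blast
    then have "real_of_rat p < h (p, q, s) \<and> h (p, q, s) < real_of_rat q \<and> g (h (p, q, s)) < ereal (real_of_rat s)"
      unfolding h_def prod.case by (rule someI)
    moreover from this have "g (h (p, q, s)) < ereal r" using s(2) by (cases "g (h (p, q, s))") auto
    moreover have "h (p, q, s) \<in> D" by (simp add: D_def)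
    ultimately show ?thesis using p(1) q(2) by (intro bexI[of _ "h (p, q, s)"]) auto
  qed
  have "countable D" by (simp add: D_def)
  \<comment> \<open>Index 0 is reserved for the time 0, where the two sides of the barrier
    meet.\<close>
  define d where "d = case_nat 0 (from_nat_into D)"
  have range: "range (from_nat_into D) = D" by (rule range_from_nat_into) (auto simp: D_def \<open>countable D\<close>)
  show thesis
  proof
    show "d 0 = 0" by (simp add: d_def)
    show "\<exists>i. \<bar>d i - t\<bar> < e \<and> g (d i) < ereal r" if t: "g t < ereal r" "0 < e" for t r e
    proof -
      obtain s where s: "s \<in> D" "\<bar>s - t\<bar> < e" "g s < ereal r" using D[OF t] by blast
      obtain i where "from_nat_into D i = s" using s(1) range by force
      then show ?thesis using s by (intro exI[of _ "Suc i"]) (simp add: d_def)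
    qed
  qed
qed

theorem theorem1p19:
  fixes M :: "'a measure" and X :: "real \<Rightarrow> 'a \<Rightarrow> real"
    and N :: "'b measure" and W :: "real \<Rightarrow> 'b \<Rightarrow> real"
    and g :: "real \<Rightarrow> ereal" and c \<kappa> :: real
  assumes "airy2_process M X"
    and "brownian_motion N W"
    and "g \<in> H1_ext"
    and "0 \<le> \<kappa>" and "\<kappa> < 3 / 4"
    and "\<forall>t. g t \<ge> ereal (c - \<kappa> * t\<^sup>2)"
  shows "has_fredholm_det
           (\<lambda>x z. - K_Ai x z + airy_scattering N W g x z)
           (measure M {\<omega> \<in> space M. \<forall>t. ereal (X t \<omega>) \<le> g t + ereal (t\<^sup>2)})"
proof -
  obtain d :: "nat \<Rightarrow> real" where d: "d 0 = 0" "\<And>t r e. g t < ereal r \<Longrightarrow> 0 < e \<Longrightarrow> \<exists>i. \<bar>d i - t\<bar> < e \<and> g (d i) < ereal r"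
    using exists_lower_approximating_sequence by blast
  interpret barrier N W g d c \<kappa>
    by unfold_locales (use assms d in auto)
  show ?thesis by (rule has_fredholm_det_airy_scattering[OF assms(1)])
qed

end
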